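(* Let $X$ be an infinite-dimensional complex Banach space such that $\mathcal{K}(X)$ is amenable and $\mathcal{K}(X^* )$ has a bounded two-sided approximate identity. Then $\mathcal{K}(X^* )$ is amenable.
   Context: For a Banach space $Z$, $\mathcal{K}(Z)$ is the Banach algebra of compact operators on $Z$ with the operator norm. A Banach algebra $\mathcal{A}$ is amenable if for every Banach $\mathcal{A}$-bimodule $Z$, every continuous derivation $D:\mathcal{A}\to Z^*$ is inner, i.e. of the form $a\mapsto a\cdot z^*-z^*\cdot a$ for some $z^*\in Z^*$. Here $Z^*$ carries the dual module actions $\langle a\cdot z^*,z\rangle=\langle z^*,z\cdot a\rangle$, $\langle z^*\cdot a,z\rangle=\langle z^*,a\cdot z\rangle$, and a derivation is a linear map with $D(ab)=a\cdot D(b)+D(a)\cdot b$. A bounded two-sided approximate identity of a Banach algebra $\mathcal{A}$ is a norm-bounded net $(e_\beta)$ in $\mathcal{A}$ with $e_\beta a\to a$ and $ae_\beta\to a$ for all $a\in\mathcal{A}$. *)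

theory Defs
  imports "HOL-Analysis.Analysis"
begin

section \<open>Complex Banach spaces on carrier sets\<close>

text \<open>
  Amenability quantifies over all Banach spaces carrying a module structure, so Banach spaces are
  records over an arbitrary carrier type rather than instances of a type class.
\<close>

record 'a normed_vs =
  car :: "'a set"
  vzero :: 'a ("\<zero>\<index>")
  vadd :: "'a \<Rightarrow> 'a \<Rightarrow> 'a" (infixl "\<oplus>\<index>" 65)
  vscale :: "complex \<Rightarrow> 'a \<Rightarrow> 'a" (infixr "\<odot>\<index>" 75)
  vnorm :: "'a \<Rightarrow> real" ("\<parallel>_\<parallel>\<index>")

definition vdiff :: "('a, 'm) normed_vs_scheme \<Rightarrow> 'a \<Rightarrow> 'a \<Rightarrow> 'a" (infixl "\<ominus>\<index>" 65)
  where "x \<ominus>\<^bsub>V\<^esub> y = x \<oplus>\<^bsub>V\<^esub> (- 1) \<odot>\<^bsub>V\<^esub> y"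

text \<open>The distance is cut off outside the carrier because the library locale \<open>Metric_space\<close>
  demands nonnegativity and symmetry on the whole type.\<close>

definition vdist :: "('a, 'm) normed_vs_scheme \<Rightarrow> 'a \<Rightarrow> 'a \<Rightarrow> real"
  where "vdist V x y = (if x \<in> car V \<and> y \<in> car V then \<parallel>x \<ominus>\<^bsub>V\<^esub> y\<parallel>\<^bsub>V\<^esub> else 0)"

definition vtopology :: "('a, 'm) normed_vs_scheme \<Rightarrow> 'a topology"
  where "vtopology V = Metric_space.mtopology (car V) (vdist V)"

definition unit_ball :: "('a, 'm) normed_vs_scheme \<Rightarrow> 'a set"
  where "unit_ball V = {x \<in> car V. \<parallel>x\<parallel>\<^bsub>V\<^esub> \<le> 1}"

locale complex_normed_space =
  fixes V :: "('a, 'm) normed_vs_scheme" (structure)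
  assumes zero_closed: "\<zero> \<in> car V"
    and add_closed: "\<lbrakk>x \<in> car V; y \<in> car V\<rbrakk> \<Longrightarrow> x \<oplus> y \<in> car V"
    and scale_closed: "x \<in> car V \<Longrightarrow> c \<odot> x \<in> car V"
    and add_assoc: "\<lbrakk>x \<in> car V; y \<in> car V; z \<in> car V\<rbrakk> \<Longrightarrow> (x \<oplus> y) \<oplus> z = x \<oplus> (y \<oplus> z)"
    and add_comm: "\<lbrakk>x \<in> car V; y \<in> car V\<rbrakk> \<Longrightarrow> x \<oplus> y = y \<oplus> x"
    and add_zero: "x \<in> car V \<Longrightarrow> x \<oplus> \<zero> = x"
    and add_inverse: "x \<in> car V \<Longrightarrow> \<exists>y \<in> car V. x \<oplus> y = \<zero>"
    and scale_add: "\<lbrakk>x \<in> car V; y \<in> car V\<rbrakk> \<Longrightarrow> c \<odot> (x \<oplus> y) = c \<odot> x \<oplus> c \<odot> y"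
    and add_scale: "x \<in> car V \<Longrightarrow> (c + d) \<odot> x = c \<odot> x \<oplus> d \<odot> x"
    and scale_scale: "x \<in> car V \<Longrightarrow> c \<odot> d \<odot> x = (c * d) \<odot> x"
    and scale_one: "x \<in> car V \<Longrightarrow> 1 \<odot> x = x"
    and norm_definite: "x \<in> car V \<Longrightarrow> \<parallel>x\<parallel> = 0 \<longleftrightarrow> x = \<zero>"
    and norm_triangle: "\<lbrakk>x \<in> car V; y \<in> car V\<rbrakk> \<Longrightarrow> \<parallel>x \<oplus> y\<parallel> \<le> \<parallel>x\<parallel> + \<parallel>y\<parallel>"
    and norm_scale: "x \<in> car V \<Longrightarrow> \<parallel>c \<odot> x\<parallel> = cmod c * \<parallel>x\<parallel>"

locale complex_banach_space = complex_normed_space +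
  assumes complete: "Metric_space.mcomplete (car V) (vdist V)"

inductive_set vspan :: "('a, 'm) normed_vs_scheme \<Rightarrow> 'a set \<Rightarrow> 'a set"
  for V (structure) and B
  where
    zero: "\<zero> \<in> vspan V B"
  | base: "b \<in> B \<Longrightarrow> b \<in> vspan V B"
  | add: "\<lbrakk>x \<in> vspan V B; y \<in> vspan V B\<rbrakk> \<Longrightarrow> x \<oplus> y \<in> vspan V B"
  | scale: "x \<in> vspan V B \<Longrightarrow> c \<odot> x \<in> vspan V B"

definition infinite_dimensional :: "('a, 'm) normed_vs_scheme \<Rightarrow> bool"
  where "infinite_dimensional V \<longleftrightarrow> \<not> (\<exists>B \<subseteq> car V. finite B \<and> vspan V B = car V)"


section \<open>Bounded and compact operators, dual spaces\<close>

definition linear_map ::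
    "('a, 'm) normed_vs_scheme \<Rightarrow> ('b, 'n) normed_vs_scheme \<Rightarrow> ('a \<Rightarrow> 'b) \<Rightarrow> bool"
  where "linear_map V W T \<longleftrightarrow> T \<in> car V \<rightarrow> car W \<and>
    (\<forall>x \<in> car V. \<forall>y \<in> car V. T (x \<oplus>\<^bsub>V\<^esub> y) = T x \<oplus>\<^bsub>W\<^esub> T y) \<and>
    (\<forall>c. \<forall>x \<in> car V. T (c \<odot>\<^bsub>V\<^esub> x) = c \<odot>\<^bsub>W\<^esub> T x)"

text \<open>As usual, continuity of a linear map is expressed by boundedness.\<close>

definition bounded_linear_map ::
    "('a, 'm) normed_vs_scheme \<Rightarrow> ('b, 'n) normed_vs_scheme \<Rightarrow> ('a \<Rightarrow> 'b) \<Rightarrow> bool"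
  where "bounded_linear_map V W T \<longleftrightarrow> linear_map V W T \<and>
    (\<exists>K. \<forall>x \<in> car V. \<parallel>T x\<parallel>\<^bsub>W\<^esub> \<le> K * \<parallel>x\<parallel>\<^bsub>V\<^esub>)"

definition opnorm ::
    "('a, 'm) normed_vs_scheme \<Rightarrow> ('b, 'n) normed_vs_scheme \<Rightarrow> ('a \<Rightarrow> 'b) \<Rightarrow> real"
  where "opnorm V W T = (SUP x \<in> unit_ball V. \<parallel>T x\<parallel>\<^bsub>W\<^esub>)"

text \<open>Operators are extensional functions (\<open>undefined\<close> off the carrier), so that operators agreeing
  on the carrier are equal.\<close>

definition operator_space ::
    "('a, 'm) normed_vs_scheme \<Rightarrow> ('b, 'n) normed_vs_scheme \<Rightarrow> ('a \<Rightarrow> 'b) normed_vs"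
  where "operator_space V W =
    \<lparr>car = {T \<in> extensional (car V). bounded_linear_map V W T},
     vzero = (\<lambda>x \<in> car V. \<zero>\<^bsub>W\<^esub>),
     vadd = (\<lambda>S T. \<lambda>x \<in> car V. S x \<oplus>\<^bsub>W\<^esub> T x),
     vscale = (\<lambda>c T. \<lambda>x \<in> car V. c \<odot>\<^bsub>W\<^esub> T x),
     vnorm = opnorm V W\<rparr>"

definition complex_line :: "complex normed_vs"
  where "complex_line =
    \<lparr>car = UNIV, vzero = 0, vadd = (+), vscale = (*), vnorm = cmod\<rparr>"

definition dual :: "('a, 'm) normed_vs_scheme \<Rightarrow> ('a \<Rightarrow> complex) normed_vs"
  where "dual V = operator_space V complex_line"

definition compact_operator ::
    "('a, 'm) normed_vs_scheme \<Rightarrow> ('b, 'n) normed_vs_scheme \<Rightarrow> ('a \<Rightarrow> 'b) \<Rightarrow> bool"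
  where "compact_operator V W T \<longleftrightarrow> linear_map V W T \<and>
    compactin (vtopology W) (vtopology W closure_of (T ` unit_ball V))"


section \<open>Banach algebras\<close>

record 'a normed_alg = "'a normed_vs" +
  vmult :: "'a \<Rightarrow> 'a \<Rightarrow> 'a" (infixl "\<otimes>\<index>" 70)

locale complex_banach_algebra = complex_banach_space A
  for A :: "('a, 'm) normed_alg_scheme" (structure) +
  assumes mult_closed: "\<lbrakk>a \<in> car A; b \<in> car A\<rbrakk> \<Longrightarrow> a \<otimes> b \<in> car A"
    and mult_assoc: "\<lbrakk>a \<in> car A; b \<in> car A; c \<in> car A\<rbrakk> \<Longrightarrow> (a \<otimes> b) \<otimes> c = a \<otimes> (b \<otimes> c)"
    and mult_add_left:
      "\<lbrakk>a \<in> car A; b \<in> car A; c \<in> car A\<rbrakk> \<Longrightarrow> (a \<oplus> b) \<otimes> c = a \<otimes> c \<oplus> b \<otimes> c"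
    and mult_add_right:
      "\<lbrakk>a \<in> car A; b \<in> car A; c \<in> car A\<rbrakk> \<Longrightarrow> a \<otimes> (b \<oplus> c) = a \<otimes> b \<oplus> a \<otimes> c"
    and mult_scale_left: "\<lbrakk>a \<in> car A; b \<in> car A\<rbrakk> \<Longrightarrow> (k \<odot> a) \<otimes> b = k \<odot> (a \<otimes> b)"
    and mult_scale_right: "\<lbrakk>a \<in> car A; b \<in> car A\<rbrakk> \<Longrightarrow> a \<otimes> (k \<odot> b) = k \<odot> (a \<otimes> b)"
    and norm_mult_le: "\<lbrakk>a \<in> car A; b \<in> car A\<rbrakk> \<Longrightarrow> \<parallel>a \<otimes> b\<parallel> \<le> \<parallel>a\<parallel> * \<parallel>b\<parallel>"

definition compact_operators :: "('a, 'm) normed_vs_scheme \<Rightarrow> ('a \<Rightarrow> 'a) normed_alg"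
  where "compact_operators V =
    \<lparr>car = {T \<in> extensional (car V). compact_operator V V T},
     vzero = vzero (operator_space V V),
     vadd = vadd (operator_space V V),
     vscale = vscale (operator_space V V),
     vnorm = opnorm V V,
     vmult = compose (car V)\<rparr>"

text \<open>\<open>I\<close> is the directed index set of the net, with preorder \<open>le\<close>.\<close>

definition bounded_approximate_identity ::
    "('a, 'm) normed_alg_scheme \<Rightarrow> 'i set \<Rightarrow> ('i \<Rightarrow> 'i \<Rightarrow> bool) \<Rightarrow> ('i \<Rightarrow> 'a) \<Rightarrow> bool"
  where "bounded_approximate_identity A I le e \<longleftrightarrow>
    I \<noteq> {} \<and> (\<forall>i \<in> I. le i i) \<and>
    (\<forall>i \<in> I. \<forall>j \<in> I. \<forall>k \<in> I. le i j \<longrightarrow> le j k \<longrightarrow> le i k) \<and>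
    (\<forall>i \<in> I. \<forall>j \<in> I. \<exists>k \<in> I. le i k \<and> le j k) \<and>
    e \<in> I \<rightarrow> car A \<and> (\<exists>K. \<forall>i \<in> I. \<parallel>e i\<parallel>\<^bsub>A\<^esub> \<le> K) \<and>
    (\<forall>a \<in> car A. \<forall>\<epsilon> > 0. \<exists>i \<in> I. \<forall>j \<in> I. le i j \<longrightarrow>
      \<parallel>e j \<otimes>\<^bsub>A\<^esub> a \<ominus>\<^bsub>A\<^esub> a\<parallel>\<^bsub>A\<^esub> < \<epsilon> \<and> \<parallel>a \<otimes>\<^bsub>A\<^esub> e j \<ominus>\<^bsub>A\<^esub> a\<parallel>\<^bsub>A\<^esub> < \<epsilon>)"


section \<open>Banach bimodules, derivations and amenability\<close>

locale banach_bimodule = A: complex_banach_algebra A + Z: complex_banach_space Z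
  for A :: "('a, 'm) normed_alg_scheme" and Z :: "('z, 'n) normed_vs_scheme"
    and lact :: "'a \<Rightarrow> 'z \<Rightarrow> 'z" and ract :: "'z \<Rightarrow> 'a \<Rightarrow> 'z" +
  assumes lact_closed: "\<lbrakk>a \<in> car A; z \<in> car Z\<rbrakk> \<Longrightarrow> lact a z \<in> car Z"
    and ract_closed: "\<lbrakk>z \<in> car Z; a \<in> car A\<rbrakk> \<Longrightarrow> ract z a \<in> car Z"
    and lact_add_left: "\<lbrakk>a \<in> car A; b \<in> car A; z \<in> car Z\<rbrakk> \<Longrightarrow>
      lact (a \<oplus>\<^bsub>A\<^esub> b) z = lact a z \<oplus>\<^bsub>Z\<^esub> lact b z"
    and lact_add_right: "\<lbrakk>a \<in> car A; z \<in> car Z; w \<in> car Z\<rbrakk> \<Longrightarrow>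
      lact a (z \<oplus>\<^bsub>Z\<^esub> w) = lact a z \<oplus>\<^bsub>Z\<^esub> lact a w"
    and lact_scale_left: "\<lbrakk>a \<in> car A; z \<in> car Z\<rbrakk> \<Longrightarrow> lact (c \<odot>\<^bsub>A\<^esub> a) z = c \<odot>\<^bsub>Z\<^esub> lact a z"
    and lact_scale_right: "\<lbrakk>a \<in> car A; z \<in> car Z\<rbrakk> \<Longrightarrow> lact a (c \<odot>\<^bsub>Z\<^esub> z) = c \<odot>\<^bsub>Z\<^esub> lact a z"
    and ract_add_left: "\<lbrakk>a \<in> car A; z \<in> car Z; w \<in> car Z\<rbrakk> \<Longrightarrow>
      ract (z \<oplus>\<^bsub>Z\<^esub> w) a = ract z a \<oplus>\<^bsub>Z\<^esub> ract w a"
    and ract_add_right: "\<lbrakk>a \<in> car A; b \<in> car A; z \<in> car Z\<rbrakk> \<Longrightarrow>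
      ract z (a \<oplus>\<^bsub>A\<^esub> b) = ract z a \<oplus>\<^bsub>Z\<^esub> ract z b"
    and ract_scale_left: "\<lbrakk>a \<in> car A; z \<in> car Z\<rbrakk> \<Longrightarrow> ract (c \<odot>\<^bsub>Z\<^esub> z) a = c \<odot>\<^bsub>Z\<^esub> ract z a"
    and ract_scale_right: "\<lbrakk>a \<in> car A; z \<in> car Z\<rbrakk> \<Longrightarrow> ract z (c \<odot>\<^bsub>A\<^esub> a) = c \<odot>\<^bsub>Z\<^esub> ract z a"
    and lact_mult: "\<lbrakk>a \<in> car A; b \<in> car A; z \<in> car Z\<rbrakk> \<Longrightarrow> lact (a \<otimes>\<^bsub>A\<^esub> b) z = lact a (lact b z)"
    and ract_mult: "\<lbrakk>a \<in> car A; b \<in> car A; z \<in> car Z\<rbrakk> \<Longrightarrow> ract z (a \<otimes>\<^bsub>A\<^esub> b) = ract (ract z a) b"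
    and lact_ract: "\<lbrakk>a \<in> car A; b \<in> car A; z \<in> car Z\<rbrakk> \<Longrightarrow> ract (lact a z) b = lact a (ract z b)"
    and lact_bounded: "\<exists>K. \<forall>a \<in> car A. \<forall>z \<in> car Z. \<parallel>lact a z\<parallel>\<^bsub>Z\<^esub> \<le> K * \<parallel>a\<parallel>\<^bsub>A\<^esub> * \<parallel>z\<parallel>\<^bsub>Z\<^esub>"
    and ract_bounded: "\<exists>K. \<forall>a \<in> car A. \<forall>z \<in> car Z. \<parallel>ract z a\<parallel>\<^bsub>Z\<^esub> \<le> K * \<parallel>a\<parallel>\<^bsub>A\<^esub> * \<parallel>z\<parallel>\<^bsub>Z\<^esub>"

text \<open>The dual actions: \<open>\<langle>a \<cdot> \<phi>, z\<rangle> = \<langle>\<phi>, z \<cdot> a\<rangle>\<close> and \<open>\<langle>\<phi> \<cdot> a, z\<rangle> = \<langle>\<phi>, a \<cdot> z\<rangle>\<close>.\<close>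

definition dual_lact ::
    "('z, 'n) normed_vs_scheme \<Rightarrow> ('z \<Rightarrow> 'a \<Rightarrow> 'z) \<Rightarrow> 'a \<Rightarrow> ('z \<Rightarrow> complex) \<Rightarrow> 'z \<Rightarrow> complex"
  where "dual_lact Z ract a \<phi> = (\<lambda>z \<in> car Z. \<phi> (ract z a))"

definition dual_ract ::
    "('z, 'n) normed_vs_scheme \<Rightarrow> ('a \<Rightarrow> 'z \<Rightarrow> 'z) \<Rightarrow> ('z \<Rightarrow> complex) \<Rightarrow> 'a \<Rightarrow> 'z \<Rightarrow> complex"
  where "dual_ract Z lact \<phi> a = (\<lambda>z \<in> car Z. \<phi> (lact a z))"

definition continuous_dual_derivation ::
    "('a, 'm) normed_alg_scheme \<Rightarrow> ('z, 'n) normed_vs_scheme \<Rightarrow>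
     ('a \<Rightarrow> 'z \<Rightarrow> 'z) \<Rightarrow> ('z \<Rightarrow> 'a \<Rightarrow> 'z) \<Rightarrow> ('a \<Rightarrow> 'z \<Rightarrow> complex) \<Rightarrow> bool"
  where "continuous_dual_derivation A Z lact ract D \<longleftrightarrow> bounded_linear_map A (dual Z) D \<and>
    (\<forall>a \<in> car A. \<forall>b \<in> car A.
      D (a \<otimes>\<^bsub>A\<^esub> b) = dual_lact Z ract a (D b) \<oplus>\<^bsub>dual Z\<^esub> dual_ract Z lact (D a) b)"

definition inner_dual_derivation ::
    "('a, 'm) normed_alg_scheme \<Rightarrow> ('z, 'n) normed_vs_scheme \<Rightarrow>
     ('a \<Rightarrow> 'z \<Rightarrow> 'z) \<Rightarrow> ('z \<Rightarrow> 'a \<Rightarrow> 'z) \<Rightarrow> ('a \<Rightarrow> 'z \<Rightarrow> complex) \<Rightarrow> bool"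
  where "inner_dual_derivation A Z lact ract D \<longleftrightarrow>
    (\<exists>\<phi> \<in> car (dual Z). \<forall>a \<in> car A.
      D a = dual_lact Z ract a \<phi> \<ominus>\<^bsub>dual Z\<^esub> dual_ract Z lact \<phi> a)"

text \<open>
  Since HOL formulas cannot quantify over types, the type \<open>'z\<close> of the elements of the bimodules is a
  parameter.  The unrestricted notion is \<open>amenable TYPE('z) A\<close> for every type \<open>'z\<close>: in the conclusion
  of a theorem, where \<open>'z\<close> is a free type variable, this says that \<open>A\<close> is amenable.  In a hypothesis
  one has to name one type.
\<close>

definition amenable :: "'z itself \<Rightarrow> ('a, 'm) normed_alg_scheme \<Rightarrow> bool"
  where "amenable (_ :: 'z itself) A \<longleftrightarrow> complex_banach_algebra A \<and>
    (\<forall>(Z :: 'z normed_vs) lact ract D.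
      banach_bimodule A Z lact ract \<and> continuous_dual_derivation A Z lact ract D \<longrightarrow>
      inner_dual_derivation A Z lact ract D)"

text \<open>
  The type at which amenability of \<open>A\<close> (with elements of type \<open>'a\<close>) is assumed.  Amenability at
  \<open>('a, 'z) bimodule_universe\<close> is implied by amenability in the unrestricted sense; conversely it
  implies \<open>amenable TYPE('w) A\<close> for every type \<open>'w\<close>, whatever \<open>'z\<close> is.  The left summand
  provides all bimodules on \<open>'z\<close>.  The right one holds a copy of the dual of \<open>A\<close>, which yields
  a bounded approximate identity, and the quotient of the space of bounded bilinear forms on
  \<open>A \<times> A\<close> by the forms \<open>(a, b) \<mapsto> f (a b)\<close> with \<open>f\<close> in the dual of \<open>A\<close>; the dual of
  this quotient is the bidual of the kernel of the multiplication map on the projective tensor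
  square of \<open>A\<close>, and innerness of derivations into it yields a virtual diagonal, which makes every
  continuous derivation into a dual bimodule inner.
\<close>

type_synonym ('a, 'z) bimodule_universe = "'z + ('a \<Rightarrow> 'a \<Rightarrow> complex) set"

end

theory Submission
  imports Defs
begin

text \<open>
  Why the theorem holds.  Taking adjoints maps \<open>B = \<K>(X)\<close> onto a subalgebra of \<open>A = \<K>(X\<^sup>*)\<close> and
  reverses products.  Three facts connect the two algebras.

  \<^item> The adjoints form a left ideal of \<open>A\<close>: for compact \<open>T\<close> the second adjoint \<open>T\<^sup>*\<^sup>*\<close> maps the bidual
  into \<open>X\<close>, so \<open>S T\<^sup>*\<close> with \<open>S\<close> in \<open>A\<close> is again the adjoint of an operator on \<open>X\<close>, which is compact
  by Schauder's theorem (\<open>adjoints_left_ideal\<close>).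

  \<^item> Products \<open>u\<^sup>* a\<close> with \<open>u\<close> in \<open>B\<close> approximate every \<open>a\<close> in \<open>A\<close>.  Amenability of \<open>B\<close> gives elements
  \<open>u\<close> of bounded norm that act nearly as right units (\<open>amenable_bounded_approximate_units\<close>); hence
  \<open>u\<^sup>* f\<close> is close to \<open>f\<close> for finitely many functionals \<open>f\<close> at a time, and the compactness of \<open>a\<close>
  makes this uniform (\<open>adjoint_approximate_units\<close>).

  \<^item> \<open>A\<close> has a bounded approximate identity, by hypothesis.

  Now let \<open>D\<close> be a derivation from \<open>A\<close> into a dual bimodule.  Its restriction to the adjoints is a
  derivation of \<open>B\<close> if the two module actions are exchanged, so it is inner, and we may assume that
  \<open>D\<close> vanishes on the adjoints.  For \<open>a\<close> in \<open>A\<close> and an adjoint \<open>b\<close> the left ideal property gives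
  \<open>0 = D(a b) = a \<cdot> D(b) + D(a) \<cdot> b = D(a) \<cdot> b\<close>, and by approximation \<open>D(a) \<cdot> c = 0\<close> for all \<open>c\<close> in \<open>A\<close>.
  Thus \<open>D(a c) = a \<cdot> D(c)\<close>, and letting \<open>c\<close> run through the approximate identity shows that \<open>D\<close> is
  inner (\<open>amenable_of_antihomomorphism\<close>).

  Functionals are produced by the Hahn--Banach theorem for sublinear functionals on carrier sets.
  Besides separation it supplies the limits in dual spaces that are usually taken from weak-*
  compactness (\<open>generalized_limit\<close>).
\<close>

section \<open>Normed spaces on carrier sets\<close>

context complex_normed_space
begin

lemma norm_zero [simp]: "\<parallel>\<zero>\<parallel> = 0"
  using norm_definite zero_closed by blast

lemma scale_zero_left: "x \<in> car V \<Longrightarrow> 0 \<odot> x = \<zero>"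
  using norm_definite norm_scale scale_closed by fastforce

lemma scale_zero_right: "c \<odot> \<zero> = \<zero>"
  using norm_definite norm_scale scale_closed zero_closed by fastforce

lemma add_left_comm:
  "\<lbrakk>x \<in> car V; y \<in> car V; z \<in> car V\<rbrakk> \<Longrightarrow> x \<oplus> (y \<oplus> z) = y \<oplus> (x \<oplus> z)"
  by (metis add_assoc add_comm)

lemma diff_closed: "\<lbrakk>x \<in> car V; y \<in> car V\<rbrakk> \<Longrightarrow> x \<ominus> y \<in> car V"
  by (simp add: vdiff_def add_closed scale_closed)

lemma add_minus: "x \<in> car V \<Longrightarrow> x \<oplus> (- 1) \<odot> x = \<zero>"
  using add_scale[of x 1 "-1"] by (simp add: scale_one scale_zero_left)

lemma diff_self: "x \<in> car V \<Longrightarrow> x \<ominus> x = \<zero>"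
  by (simp add: vdiff_def add_minus)

lemma minus_minus: "x \<in> car V \<Longrightarrow> (- 1) \<odot> (- 1) \<odot> x = x"
  by (simp add: scale_scale scale_one)

lemma diff_zero: "x \<in> car V \<Longrightarrow> x \<ominus> \<zero> = x"
  by (simp add: vdiff_def scale_zero_right add_zero)

lemma diff_add_cancel: "\<lbrakk>x \<in> car V; y \<in> car V\<rbrakk> \<Longrightarrow> y \<oplus> (x \<ominus> y) = x"
  by (simp add: vdiff_def add_left_comm scale_closed add_minus add_zero)

lemma diff_eq_zero_iff: "\<lbrakk>x \<in> car V; y \<in> car V\<rbrakk> \<Longrightarrow> x \<ominus> y = \<zero> \<longleftrightarrow> x = y"
  by (metis diff_add_cancel add_zero diff_self)

lemma diff_add_diff:
  assumes "x \<in> car V" "y \<in> car V" "z \<in> car V"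
  shows "(x \<ominus> y) \<oplus> (y \<ominus> z) = x \<ominus> z"
proof -
  have "(x \<ominus> y) \<oplus> (y \<ominus> z) = (y \<oplus> (x \<ominus> y)) \<oplus> (- 1) \<odot> z"
    using assms by (simp add: vdiff_def[of V y z] add_assoc add_left_comm diff_closed scale_closed)
  then show ?thesis
    using assms by (simp add: diff_add_cancel) (simp add: vdiff_def)
qed

lemma add_diff_add:
  assumes "x \<in> car V" "y \<in> car V" "x' \<in> car V" "y' \<in> car V"
  shows "(x \<oplus> y) \<ominus> (x' \<oplus> y') = (x \<ominus> x') \<oplus> (y \<ominus> y')"
  using assms by (simp add: vdiff_def scale_add add_assoc add_left_comm add_closed scale_closed)

lemma scale_diff:
  "\<lbrakk>x \<in> car V; y \<in> car V\<rbrakk> \<Longrightarrow> c \<odot> (x \<ominus> y) = c \<odot> x \<ominus> c \<odot> y"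
  by (simp add: vdiff_def scale_add scale_scale scale_closed)

lemma minus_diff: "\<lbrakk>x \<in> car V; y \<in> car V\<rbrakk> \<Longrightarrow> (- 1) \<odot> (x \<ominus> y) = y \<ominus> x"
  by (simp add: vdiff_def scale_add minus_minus scale_closed add_comm)

lemma norm_minus: "x \<in> car V \<Longrightarrow> \<parallel>(- 1) \<odot> x\<parallel> = \<parallel>x\<parallel>"
  by (simp add: norm_scale)

lemma norm_nonneg: "x \<in> car V \<Longrightarrow> 0 \<le> \<parallel>x\<parallel>"
  using norm_triangle[of x "(- 1) \<odot> x"] by (simp add: add_minus norm_minus scale_closed)

lemma norm_diff_commute: "\<lbrakk>x \<in> car V; y \<in> car V\<rbrakk> \<Longrightarrow> \<parallel>x \<ominus> y\<parallel> = \<parallel>y \<ominus> x\<parallel>"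
  by (metis minus_diff norm_minus diff_closed)

lemma norm_diff_triangle:
  "\<lbrakk>x \<in> car V; y \<in> car V; z \<in> car V\<rbrakk> \<Longrightarrow> \<parallel>x \<ominus> z\<parallel> \<le> \<parallel>x \<ominus> y\<parallel> + \<parallel>y \<ominus> z\<parallel>"
  by (metis diff_add_diff norm_triangle diff_closed)

lemma norm_le_add_norm_diff: "\<lbrakk>x \<in> car V; y \<in> car V\<rbrakk> \<Longrightarrow> \<parallel>x\<parallel> \<le> \<parallel>y\<parallel> + \<parallel>x \<ominus> y\<parallel>"
  by (metis diff_add_cancel norm_triangle diff_closed)

lemma normalize_in_unit_ball:
  "\<lbrakk>x \<in> car V; x \<noteq> \<zero>\<rbrakk> \<Longrightarrow> of_real (inverse \<parallel>x\<parallel>) \<odot> x \<in> unit_ball V"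
  using norm_nonneg norm_definite
  by (auto simp: unit_ball_def scale_closed norm_scale norm_inverse)

lemma zero_in_unit_ball: "\<zero> \<in> unit_ball V"
  by (simp add: unit_ball_def zero_closed)

lemma limit_unique:
  assumes "\<And>n. \<sigma> n \<in> car V" "x \<in> car V" "(\<lambda>n. \<parallel>\<sigma> n \<ominus> x\<parallel>) \<longlonglongrightarrow> 0"
    and "y \<in> car V" "(\<lambda>n. \<parallel>\<sigma> n \<ominus> y\<parallel>) \<longlonglongrightarrow> 0"
  shows "x = y"
proof -
  have "\<parallel>x \<ominus> y\<parallel> \<le> \<parallel>\<sigma> n \<ominus> x\<parallel> + \<parallel>\<sigma> n \<ominus> y\<parallel>" for n
    using norm_diff_triangle[of x "\<sigma> n" y] norm_diff_commute[of x "\<sigma> n"] assms by simp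
  then have "\<parallel>x \<ominus> y\<parallel> \<le> 0 + 0"
    by (intro LIMSEQ_le_const[OF tendsto_add[OF assms(3,5)]]) blast
  then have "\<parallel>x \<ominus> y\<parallel> = 0"
    using norm_nonneg[OF diff_closed[OF assms(2,4)]] by simp
  then show ?thesis
    using assms(2,4) by (simp add: diff_closed norm_definite diff_eq_zero_iff)
qed

lemma limit_add:
  assumes "\<And>n. \<sigma> n \<in> car V" "x \<in> car V" "\<And>n. \<tau> n \<in> car V" "y \<in> car V"
    and "(\<lambda>n. \<parallel>\<sigma> n \<ominus> x\<parallel>) \<longlonglongrightarrow> 0" "(\<lambda>n. \<parallel>\<tau> n \<ominus> y\<parallel>) \<longlonglongrightarrow> 0"
  shows "(\<lambda>n. \<parallel>(\<sigma> n \<oplus> \<tau> n) \<ominus> (x \<oplus> y)\<parallel>) \<longlonglongrightarrow> 0"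
  by (rule tendsto_sandwich[OF _ _ tendsto_const tendsto_add_zero[OF assms(5,6)]])
    (simp_all add: assms add_diff_add norm_nonneg norm_triangle add_closed diff_closed)

lemma limit_scale:
  assumes "\<And>n. \<sigma> n \<in> car V" "x \<in> car V" "(\<lambda>n. \<parallel>\<sigma> n \<ominus> x\<parallel>) \<longlonglongrightarrow> 0"
  shows "(\<lambda>n. \<parallel>c \<odot> \<sigma> n \<ominus> c \<odot> x\<parallel>) \<longlonglongrightarrow> 0"
  using tendsto_mult_right_zero[OF assms(3), of "cmod c"] assms(1,2)
  by (simp add: norm_scale diff_closed flip: scale_diff)

sublocale metric: Metric_space "car V" "vdist V"
proof
  show "vdist V x y = vdist V y x" for x y
    by (simp add: vdist_def norm_diff_commute)
qed (auto simp: vdist_def norm_nonneg diff_closed norm_definite diff_eq_zero_iff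
    norm_diff_triangle)

lemma mcomplete_iff:
  "metric.mcomplete \<longleftrightarrow> (\<forall>\<sigma>. range \<sigma> \<subseteq> car V \<and>
      (\<forall>\<epsilon>>0. \<exists>N. \<forall>m n. N \<le> m \<longrightarrow> N \<le> n \<longrightarrow> \<parallel>\<sigma> m \<ominus> \<sigma> n\<parallel> < \<epsilon>) \<longrightarrow>
      (\<exists>x \<in> car V. (\<lambda>n. \<parallel>\<sigma> n \<ominus> x\<parallel>) \<longlonglongrightarrow> 0))"
proof -
  have vd: "vdist V (\<sigma> m) (\<sigma> n) = \<parallel>\<sigma> m \<ominus> \<sigma> n\<parallel>" if "range \<sigma> \<subseteq> car V" for \<sigma> :: "nat \<Rightarrow> _" and m n
    using that by (auto simp: vdist_def)
  have C: "metric.MCauchy \<sigma> \<longleftrightarrow> range \<sigma> \<subseteq> car V \<and>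
      (\<forall>\<epsilon>>0. \<exists>N. \<forall>m n. N \<le> m \<longrightarrow> N \<le> n \<longrightarrow> \<parallel>\<sigma> m \<ominus> \<sigma> n\<parallel> < \<epsilon>)" for \<sigma>
    unfolding metric.MCauchy_def using vd[of \<sigma>] by (cases "range \<sigma> \<subseteq> car V") simp_all
  have L: "limitin metric.mtopology \<sigma> x sequentially \<longleftrightarrow>
      x \<in> car V \<and> (\<lambda>n. \<parallel>\<sigma> n \<ominus> x\<parallel>) \<longlonglongrightarrow> 0" if "range \<sigma> \<subseteq> car V" for \<sigma> x
  proof -
    have "(\<lambda>n. \<parallel>\<sigma> n \<ominus> x\<parallel>) \<longlonglongrightarrow> 0 \<longleftrightarrow> (\<forall>r>0. \<exists>N. \<forall>n\<ge>N. \<parallel>\<sigma> n \<ominus> x\<parallel> < r)" if "x \<in> car V"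
      unfolding LIMSEQ_iff using that \<open>range \<sigma> \<subseteq> car V\<close>
      by (simp add: norm_nonneg diff_closed range_subsetD)
    moreover have "\<sigma> n \<in> car V" for n
      using that by blast
    ultimately show ?thesis
      unfolding metric.limit_metric_sequentially vdist_def by auto
  qed
  show ?thesis
    unfolding metric.mcomplete_def C by (intro all_cong1 imp_cong refl) (simp add: L Bex_def)
qed

lemma complex_normed_space_subspace:
  assumes sub: "car U \<subseteq> car V" and ops: "vzero U = \<zero>" "vadd U = (\<oplus>)" "vscale U = (\<odot>)" "vnorm U = vnorm V"
    and "\<zero> \<in> car U" and add: "\<And>x y. \<lbrakk>x \<in> car U; y \<in> car U\<rbrakk> \<Longrightarrow> x \<oplus> y \<in> car U"
    and scale: "\<And>c x. x \<in> car U \<Longrightarrow> c \<odot> x \<in> car U"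
  shows "complex_normed_space U"
proof -
  have V: "x \<in> car V" if "x \<in> car U" for x
    using sub that by blast
  show ?thesis
  proof (unfold_locales, unfold ops)
    show "\<exists>y \<in> car U. x \<oplus> y = \<zero>" if "x \<in> car U" for x
      using that by (intro bexI[of _ "(- 1) \<odot> x"] add_minus scale V)
    show "x \<oplus> y = y \<oplus> x" if "x \<in> car U" "y \<in> car U" for x y
      using that by (intro add_comm V)
  qed (simp_all add: assms(6) add scale V add_assoc add_zero scale_add add_scale scale_scale
      scale_one norm_definite norm_triangle norm_scale)
qed

end

lemma (in complex_banach_space) complete_sequence:
  assumes "range \<sigma> \<subseteq> car V"
    and "\<And>\<epsilon>. \<epsilon> > 0 \<Longrightarrow> \<exists>N. \<forall>m n. N \<le> m \<longrightarrow> N \<le> n \<longrightarrow> \<parallel>\<sigma> m \<ominus> \<sigma> n\<parallel> < \<epsilon>"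
  obtains x where "x \<in> car V" "(\<lambda>n. \<parallel>\<sigma> n \<ominus> x\<parallel>) \<longlonglongrightarrow> 0"
  using complete assms unfolding mcomplete_iff by blast

lemma complex_line_simps [simp]:
  "car complex_line = UNIV" "vzero complex_line = 0" "vadd complex_line = (+)"
  "vscale complex_line = (*)" "vnorm complex_line = cmod"
  "vdiff complex_line = (-)"
  by (auto simp: complex_line_def vdiff_def fun_eq_iff)

lemma complex_banach_space_complex_line: "complex_banach_space complex_line"
proof -
  interpret complex_normed_space complex_line
    by unfold_locales (auto simp: algebra_simps norm_mult norm_triangle_ineq
        intro: exI[of _ "- x" for x])
  show ?thesis
  proof
    show "metric.mcomplete"
      unfolding mcomplete_iff
    proof (intro allI impI)
      fix \<sigma> :: "nat \<Rightarrow> complex"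
      assume "range \<sigma> \<subseteq> car complex_line \<and> (\<forall>\<epsilon>>0. \<exists>N. \<forall>m n. N \<le> m \<longrightarrow> N \<le> n \<longrightarrow>
        \<parallel>\<sigma> m \<ominus>\<^bsub>complex_line\<^esub> \<sigma> n\<parallel>\<^bsub>complex_line\<^esub> < \<epsilon>)"
      then have "Cauchy \<sigma>"
        by (force simp: Cauchy_iff)
      then obtain x where "\<sigma> \<longlonglongrightarrow> x"
        using Cauchy_convergent convergentD by blast
      then have "(\<lambda>n. cmod (\<sigma> n - x)) \<longlonglongrightarrow> 0"
        using LIM_zero tendsto_norm_zero by blast
      then show "\<exists>x \<in> car complex_line. (\<lambda>n. \<parallel>\<sigma> n \<ominus>\<^bsub>complex_line\<^esub> x\<parallel>\<^bsub>complex_line\<^esub>) \<longlonglongrightarrow> 0"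
        by auto
    qed
  qed
qed

section \<open>Bounded operators\<close>

lemma linear_mapI:
  assumes "\<And>x. x \<in> car V \<Longrightarrow> T x \<in> car W"
    and "\<And>x y. \<lbrakk>x \<in> car V; y \<in> car V\<rbrakk> \<Longrightarrow> T (x \<oplus>\<^bsub>V\<^esub> y) = T x \<oplus>\<^bsub>W\<^esub> T y"
    and "\<And>c x. x \<in> car V \<Longrightarrow> T (c \<odot>\<^bsub>V\<^esub> x) = c \<odot>\<^bsub>W\<^esub> T x"
  shows "linear_map V W T"
  using assms by (auto simp: linear_map_def)

lemma
  assumes "linear_map V W T"
  shows linear_map_closed: "x \<in> car V \<Longrightarrow> T x \<in> car W"
    and linear_map_add: "\<lbrakk>x \<in> car V; y \<in> car V\<rbrakk> \<Longrightarrow> T (x \<oplus>\<^bsub>V\<^esub> y) = T x \<oplus>\<^bsub>W\<^esub> T y"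
    and linear_map_scale: "x \<in> car V \<Longrightarrow> T (c \<odot>\<^bsub>V\<^esub> x) = c \<odot>\<^bsub>W\<^esub> T x"
  using assms by (auto simp: linear_map_def)

lemma bounded_linear_map_linear: "bounded_linear_map V W T \<Longrightarrow> linear_map V W T"
  by (simp add: bounded_linear_map_def)

lemma bounded_linear_map_closed: "\<lbrakk>bounded_linear_map V W T; x \<in> car V\<rbrakk> \<Longrightarrow> T x \<in> car W"
  by (meson bounded_linear_map_linear linear_map_closed)

locale normed_space_pair = V: complex_normed_space V + W: complex_normed_space W
  for V :: "('a, 'm) normed_vs_scheme" and W :: "('b, 'n) normed_vs_scheme" (structure)
begin

lemma linear_map_zero: "linear_map V W T \<Longrightarrow> T \<zero>\<^bsub>V\<^esub> = \<zero>"
  by (metis linear_map_closed linear_map_scale V.zero_closed V.scale_zero_left W.scale_zero_left)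

lemma linear_map_diff:
  "\<lbrakk>linear_map V W T; x \<in> car V; y \<in> car V\<rbrakk> \<Longrightarrow> T (x \<ominus>\<^bsub>V\<^esub> y) = T x \<ominus> T y"
  by (simp add: vdiff_def linear_map_add linear_map_scale V.scale_closed)

lemma norm_le_of_unit_ball:
  assumes T: "linear_map V W T" and x: "x \<in> car V"
    and K: "\<And>x. x \<in> unit_ball V \<Longrightarrow> \<parallel>T x\<parallel> \<le> K"
  shows "\<parallel>T x\<parallel> \<le> K * \<parallel>x\<parallel>\<^bsub>V\<^esub>"
proof (cases "x = \<zero>\<^bsub>V\<^esub>")
  case True
  then show ?thesis
    by (simp add: linear_map_zero[OF T])
next
  case False
  then have "\<parallel>T (of_real (inverse \<parallel>x\<parallel>\<^bsub>V\<^esub>) \<odot>\<^bsub>V\<^esub> x)\<parallel> \<le> K"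
    by (intro K V.normalize_in_unit_ball x)
  moreover have "\<parallel>x\<parallel>\<^bsub>V\<^esub> > 0"
    using False V.norm_definite V.norm_nonneg x by force
  ultimately show ?thesis
    by (simp add: linear_map_scale[OF T] x W.norm_scale linear_map_closed[OF T] norm_inverse
        norm_divide field_simps)
qed

lemma bounded_linear_map_iff_unit_ball:
  "bounded_linear_map V W T \<longleftrightarrow>
    linear_map V W T \<and> (\<exists>K. \<forall>x \<in> unit_ball V. \<parallel>T x\<parallel> \<le> K)"
proof
  assume "bounded_linear_map V W T"
  then obtain K where T: "linear_map V W T" and K: "\<And>x. x \<in> car V \<Longrightarrow> \<parallel>T x\<parallel> \<le> K * \<parallel>x\<parallel>\<^bsub>V\<^esub>"
    by (auto simp: bounded_linear_map_def)
  have "\<parallel>T x\<parallel> \<le> \<bar>K\<bar>" if "x \<in> unit_ball V" for x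
  proof -
    have "K * \<parallel>x\<parallel>\<^bsub>V\<^esub> \<le> \<bar>K\<bar> * 1"
      using that V.norm_nonneg by (intro mult_mono) (auto simp: unit_ball_def)
    then show ?thesis
      using K[of x] that by (simp add: unit_ball_def)
  qed
  then show "linear_map V W T \<and> (\<exists>K. \<forall>x \<in> unit_ball V. \<parallel>T x\<parallel> \<le> K)"
    using T by blast
next
  assume "linear_map V W T \<and> (\<exists>K. \<forall>x \<in> unit_ball V. \<parallel>T x\<parallel> \<le> K)"
  then show "bounded_linear_map V W T"
    using norm_le_of_unit_ball unfolding bounded_linear_map_def by blast
qed

lemma opnorm_le:
  assumes "\<And>x. x \<in> unit_ball V \<Longrightarrow> \<parallel>T x\<parallel> \<le> K"
  shows "opnorm V W T \<le> K"
  unfolding opnorm_def using assms V.zero_in_unit_ball by (intro cSUP_least) auto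

lemma opnorm_le_bound:
  assumes "\<And>x. x \<in> car V \<Longrightarrow> \<parallel>T x\<parallel> \<le> K * \<parallel>x\<parallel>\<^bsub>V\<^esub>" "0 \<le> K"
  shows "opnorm V W T \<le> K"
proof (rule opnorm_le)
  fix x assume x: "x \<in> unit_ball V"
  then have "K * \<parallel>x\<parallel>\<^bsub>V\<^esub> \<le> K * 1"
    using assms(2) by (intro mult_left_mono) (auto simp: unit_ball_def)
  then show "\<parallel>T x\<parallel> \<le> K"
    using assms(1)[of x] x by (simp add: unit_ball_def)
qed

lemma opnorm_unit_ball:
  assumes "bounded_linear_map V W T" "x \<in> unit_ball V"
  shows "\<parallel>T x\<parallel> \<le> opnorm V W T"
  unfolding opnorm_def using assms
  by (intro cSUP_upper) (auto simp: bounded_linear_map_iff_unit_ball bdd_above_def)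

lemma opnorm_bound:
  assumes "bounded_linear_map V W T" "x \<in> car V"
  shows "\<parallel>T x\<parallel> \<le> opnorm V W T * \<parallel>x\<parallel>\<^bsub>V\<^esub>"
  using assms norm_le_of_unit_ball opnorm_unit_ball by (auto simp: bounded_linear_map_def)

lemma opnorm_nonneg:
  assumes "bounded_linear_map V W T"
  shows "0 \<le> opnorm V W T"
proof -
  have "\<parallel>T \<zero>\<^bsub>V\<^esub>\<parallel> = 0"
    using assms linear_map_zero[of T] by (simp add: bounded_linear_map_def)
  then show ?thesis
    using opnorm_unit_ball[OF assms V.zero_in_unit_ball] by simp
qed

end

lemma operator_space_simps [simp]:
  "car (operator_space V W) = {T \<in> extensional (car V). bounded_linear_map V W T}"
  "vzero (operator_space V W) = (\<lambda>x \<in> car V. \<zero>\<^bsub>W\<^esub>)"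
  "vadd (operator_space V W) = (\<lambda>S T. \<lambda>x \<in> car V. S x \<oplus>\<^bsub>W\<^esub> T x)"
  "vscale (operator_space V W) = (\<lambda>c T. \<lambda>x \<in> car V. c \<odot>\<^bsub>W\<^esub> T x)"
  "vnorm (operator_space V W) = opnorm V W"
  "vdiff (operator_space V W) = (\<lambda>S T. \<lambda>x \<in> car V. S x \<ominus>\<^bsub>W\<^esub> T x)"
  by (auto simp: operator_space_def vdiff_def fun_eq_iff)

context normed_space_pair
begin

lemma bounded_linear_map_cong:
  assumes "\<And>x. x \<in> car V \<Longrightarrow> S x = T x"
  shows "bounded_linear_map V W S \<longleftrightarrow> bounded_linear_map V W T"
proof -
  have "linear_map V W S \<longleftrightarrow> linear_map V W T"
    using assms unfolding linear_map_def Pi_iff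
    by (simp add: V.add_closed V.scale_closed cong: ball_cong)
  then show ?thesis
    using assms unfolding bounded_linear_map_def by auto
qed

lemma opnorm_cong: "(\<And>x. x \<in> car V \<Longrightarrow> S x = T x) \<Longrightarrow> opnorm V W S = opnorm V W T"
  unfolding opnorm_def by (intro SUP_cong) (auto simp: unit_ball_def)

lemma bounded_linear_map_restrict [simp]:
  "bounded_linear_map V W (restrict T (car V)) \<longleftrightarrow> bounded_linear_map V W T"
  by (rule bounded_linear_map_cong) simp

lemma opnorm_restrict [simp]: "opnorm V W (restrict T (car V)) = opnorm V W T"
  by (rule opnorm_cong) simp

lemma bounded_linear_map_zero: "bounded_linear_map V W (\<lambda>x. \<zero>)"
  unfolding bounded_linear_map_def
  by (auto simp: linear_map_def W.zero_closed W.add_zero W.scale_zero_right intro: exI[of _ 0])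

lemma bounded_linear_map_add:
  assumes "bounded_linear_map V W S" "bounded_linear_map V W T"
  shows "bounded_linear_map V W (\<lambda>x. S x \<oplus> T x)"
proof -
  have S: "linear_map V W S" and T: "linear_map V W T"
    using assms by (auto simp: bounded_linear_map_def)
  note cl = linear_map_closed[OF S] linear_map_closed[OF T]
  have "\<parallel>S x \<oplus> T x\<parallel> \<le> (opnorm V W S + opnorm V W T) * \<parallel>x\<parallel>\<^bsub>V\<^esub>" if "x \<in> car V" for x
    using opnorm_bound[OF assms(1) that] opnorm_bound[OF assms(2) that] that
      W.norm_triangle[of "S x" "T x"] by (simp add: cl distrib_right)
  moreover have "linear_map V W (\<lambda>x. S x \<oplus> T x)"
    by (rule linear_mapI) (simp_all add: cl linear_map_add[OF S] linear_map_add[OF T]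
        linear_map_scale[OF S] linear_map_scale[OF T] W.scale_add W.add_closed W.add_assoc
        W.add_left_comm)
  ultimately show ?thesis
    by (auto simp: bounded_linear_map_def)
qed

lemma bounded_linear_map_scale:
  assumes "bounded_linear_map V W T"
  shows "bounded_linear_map V W (\<lambda>x. c \<odot> T x)"
proof -
  have T: "linear_map V W T"
    using assms by (auto simp: bounded_linear_map_def)
  note cl = linear_map_closed[OF T]
  have "\<parallel>c \<odot> T x\<parallel> \<le> (cmod c * opnorm V W T) * \<parallel>x\<parallel>\<^bsub>V\<^esub>" if "x \<in> car V" for x
    using opnorm_bound[OF assms that] that
    by (simp add: W.norm_scale cl mult.assoc mult_left_mono)
  moreover have "linear_map V W (\<lambda>x. c \<odot> T x)"
    by (rule linear_mapI) (simp_all add: cl linear_map_add[OF T] linear_map_scale[OF T]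
        W.scale_add W.scale_closed W.scale_scale mult.commute)
  ultimately show ?thesis
    by (auto simp: bounded_linear_map_def)
qed

lemma bounded_linear_map_diff:
  assumes "bounded_linear_map V W S" "bounded_linear_map V W T"
  shows "bounded_linear_map V W (\<lambda>x. S x \<ominus> T x)"
  unfolding vdiff_def by (intro bounded_linear_map_add bounded_linear_map_scale assms)

lemma complex_normed_space_operator_space: "complex_normed_space (operator_space V W)"
proof -
  let ?O = "operator_space V W"
  note cl = bounded_linear_map_closed
  show ?thesis
  proof
    fix S T assume "S \<in> car (?O)" "T \<in> car (?O)"
    then have S: "bounded_linear_map V W S" and T: "bounded_linear_map V W T"
      by simp_all
    show "\<parallel>S \<oplus>\<^bsub>?O\<^esub> T\<parallel>\<^bsub>?O\<^esub>
        \<le> \<parallel>S\<parallel>\<^bsub>?O\<^esub> + \<parallel>T\<parallel>\<^bsub>?O\<^esub>"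
      by simp (rule opnorm_le, smt (verit) S T cl opnorm_unit_ball W.norm_triangle unit_ball_def
          mem_Collect_eq)
  next
    fix c T assume "T \<in> car (?O)"
    then have T: "bounded_linear_map V W T"
      by simp
    have le: "opnorm V W (\<lambda>x. c \<odot> S x) \<le> cmod c * opnorm V W S"
      if "bounded_linear_map V W S" for c S
      by (rule opnorm_le) (use that in \<open>auto simp: W.norm_scale cl unit_ball_def opnorm_unit_ball
          intro!: mult_left_mono\<close>)
    have "cmod c * opnorm V W T \<le> opnorm V W (\<lambda>x. c \<odot> T x)"
    proof (cases "c = 0")
      case True
      then show ?thesis
        by (simp add: opnorm_nonneg bounded_linear_map_scale T)
    next
      case False
      have "opnorm V W T = opnorm V W (\<lambda>x. inverse c \<odot> c \<odot> T x)"
        using False by (intro opnorm_cong) (simp add: W.scale_scale W.scale_one cl[OF T])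
      also have "\<dots> \<le> inverse (cmod c) * opnorm V W (\<lambda>x. c \<odot> T x)"
        using le[OF bounded_linear_map_scale[OF T], of "inverse c"] by (simp add: norm_inverse)
      finally show ?thesis
        using False by (simp add: field_simps)
    qed
    then show "\<parallel>c \<odot>\<^bsub>?O\<^esub> T\<parallel>\<^bsub>?O\<^esub>
        = cmod c * \<parallel>T\<parallel>\<^bsub>?O\<^esub>"
      using le[OF T, of c] by simp
  next
    fix T assume "T \<in> car (?O)"
    then have T: "bounded_linear_map V W T" "T \<in> extensional (car V)"
      by simp_all
    show "\<exists>S \<in> car (?O). T \<oplus>\<^bsub>?O\<^esub> S = \<zero>\<^bsub>?O\<^esub>"
      using T by (intro bexI[of _ "(- 1) \<odot>\<^bsub>?O\<^esub> T"])
        (auto simp: fun_eq_iff W.add_minus cl bounded_linear_map_scale)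
    have "T = (\<lambda>x \<in> car V. \<zero>)" if "opnorm V W T = 0"
    proof (rule extensionalityI[OF T(2)])
      fix x assume x: "x \<in> car V"
      then show "T x = (\<lambda>x \<in> car V. \<zero>) x"
        using opnorm_bound[OF T(1) x] that W.norm_definite[OF cl[OF T(1) x]]
          W.norm_nonneg[OF cl[OF T(1) x]] by simp
    qed simp
    moreover have "opnorm V W (\<lambda>x. \<zero>) = 0"
      using opnorm_nonneg[OF bounded_linear_map_zero] opnorm_le[of "\<lambda>x. \<zero>" 0] by simp
    ultimately show "\<parallel>T\<parallel>\<^bsub>?O\<^esub> = 0 \<longleftrightarrow> T = \<zero>\<^bsub>?O\<^esub>"
      by auto
  qed (auto simp: bounded_linear_map_zero bounded_linear_map_add bounded_linear_map_scale
      fun_eq_iff extensional_def cl W.add_closed W.scale_closed W.add_assoc W.add_comm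
      W.add_left_comm W.add_zero W.scale_add W.add_scale W.scale_scale W.scale_one)
qed

end

text \<open>A Cauchy sequence of operators converges pointwise, and uniformly on the unit ball because the
  Cauchy condition is uniform there.\<close>

lemma complex_banach_space_operator_space:
  fixes W (structure)
  assumes "complex_normed_space V" and "complex_banach_space W"
  shows "complex_banach_space (operator_space V W)"
proof -
  let ?O = "operator_space V W"
  interpret W: complex_banach_space W by fact
  interpret normed_space_pair V W
    using assms by (simp add: normed_space_pair_def W.complex_normed_space_axioms)
  interpret O: complex_normed_space "?O"
    by (rule complex_normed_space_operator_space)
  note cl = bounded_linear_map_closed
  show ?thesis
  proof
    show "O.metric.mcomplete"
      unfolding O.mcomplete_iff
    proof (intro allI impI, elim conjE)
      fix \<sigma> :: "nat \<Rightarrow> _"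
      assume "range \<sigma> \<subseteq> car (?O)"
        and C: "\<forall>\<epsilon>>0. \<exists>N. \<forall>m n. N \<le> m \<longrightarrow> N \<le> n \<longrightarrow>
          \<parallel>\<sigma> m \<ominus>\<^bsub>?O\<^esub> \<sigma> n\<parallel>\<^bsub>?O\<^esub> < \<epsilon>"
      then have bl: "bounded_linear_map V W (\<sigma> n)" for n
        by (auto simp: subset_iff)
      note cl = bounded_linear_map_closed[OF bl]
      have lin: "linear_map V W (\<sigma> n)" for n
        using bl by (simp add: bounded_linear_map_def)
      have CB: "\<exists>N. \<forall>m n x. N \<le> m \<longrightarrow> N \<le> n \<longrightarrow> x \<in> car V \<longrightarrow>
          \<parallel>\<sigma> m x \<ominus> \<sigma> n x\<parallel> \<le> \<epsilon> * \<parallel>x\<parallel>\<^bsub>V\<^esub>" if "\<epsilon> > 0" for \<epsilon>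
      proof -
        obtain N where N: "\<And>m n. N \<le> m \<Longrightarrow> N \<le> n \<Longrightarrow> opnorm V W (\<lambda>x. \<sigma> m x \<ominus> \<sigma> n x) < \<epsilon>"
          using C[rule_format, OF \<open>\<epsilon> > 0\<close>] by auto
        show ?thesis
        proof (intro exI[of _ N] allI impI)
          fix m n x assume *: "N \<le> m" "N \<le> n" and x: "x \<in> car V"
          show "\<parallel>\<sigma> m x \<ominus> \<sigma> n x\<parallel> \<le> \<epsilon> * \<parallel>x\<parallel>\<^bsub>V\<^esub>"
            using opnorm_bound[OF bounded_linear_map_diff[OF bl bl] x, of m n]
              mult_right_mono[OF less_imp_le[OF N[OF *]] V.norm_nonneg[OF x]] by linarith
        qed
      qed
      have "\<exists>y. y \<in> car W \<and> (\<lambda>n. \<parallel>\<sigma> n x \<ominus> y\<parallel>) \<longlonglongrightarrow> 0" if x: "x \<in> car V" for x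
      proof -
        have Cauchy: "\<exists>N. \<forall>m n. N \<le> m \<longrightarrow> N \<le> n \<longrightarrow> \<parallel>\<sigma> m x \<ominus> \<sigma> n x\<parallel> < \<epsilon>" if "\<epsilon> > 0" for \<epsilon>
        proof -
          have pos: "0 < 1 + \<parallel>x\<parallel>\<^bsub>V\<^esub>"
            using V.norm_nonneg[OF x] by simp
          then have "\<epsilon> / (1 + \<parallel>x\<parallel>\<^bsub>V\<^esub>) * \<parallel>x\<parallel>\<^bsub>V\<^esub> < \<epsilon>"
            using that by (simp add: field_simps)
          moreover have "\<epsilon> / (1 + \<parallel>x\<parallel>\<^bsub>V\<^esub>) > 0"
            using pos that by simp
          ultimately show ?thesis
            using CB[of "\<epsilon> / (1 + \<parallel>x\<parallel>\<^bsub>V\<^esub>)"] x by (meson le_less_trans)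
        qed
        show ?thesis
          by (rule W.complete_sequence[of "\<lambda>n. \<sigma> n x", OF _ Cauchy]) (use cl[OF x] in auto)
      qed
      then obtain T where T: "\<And>x. x \<in> car V \<Longrightarrow> T x \<in> car W"
        and lim: "\<And>x. x \<in> car V \<Longrightarrow> (\<lambda>n. \<parallel>\<sigma> n x \<ominus> T x\<parallel>) \<longlonglongrightarrow> 0"
        by metis
      have T_lin: "linear_map V W T"
      proof (rule linear_mapI)
        fix x y assume xy: "x \<in> car V" "y \<in> car V"
        show "T (x \<oplus>\<^bsub>V\<^esub> y) = T x \<oplus> T y"
        proof (rule W.limit_unique[OF _ _ lim])
          show "(\<lambda>n. \<parallel>\<sigma> n (x \<oplus>\<^bsub>V\<^esub> y) \<ominus> (T x \<oplus> T y)\<parallel>) \<longlonglongrightarrow> 0"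
            using W.limit_add[OF cl T cl T lim lim, OF xy(1) xy(1) xy(2) xy(2) xy]
            by (simp add: linear_map_add[OF lin] xy)
        qed (simp_all add: T cl xy V.add_closed W.add_closed)
      next
        fix c x assume x: "x \<in> car V"
        show "T (c \<odot>\<^bsub>V\<^esub> x) = c \<odot> T x"
        proof (rule W.limit_unique[OF _ _ lim])
          show "(\<lambda>n. \<parallel>\<sigma> n (c \<odot>\<^bsub>V\<^esub> x) \<ominus> c \<odot> T x\<parallel>) \<longlonglongrightarrow> 0"
            using W.limit_scale[OF cl T lim, OF x x x, of c] by (simp add: linear_map_scale[OF lin] x)
        qed (simp_all add: T cl x V.scale_closed W.scale_closed)
      qed (rule T)
      have near: "\<exists>N. \<forall>n\<ge>N. \<forall>x \<in> car V. \<parallel>\<sigma> n x \<ominus> T x\<parallel> \<le> \<epsilon> * \<parallel>x\<parallel>\<^bsub>V\<^esub>" if "\<epsilon> > 0" for \<epsilon>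
      proof -
        obtain N where N: "\<And>m n x. N \<le> m \<Longrightarrow> N \<le> n \<Longrightarrow> x \<in> car V \<Longrightarrow>
            \<parallel>\<sigma> m x \<ominus> \<sigma> n x\<parallel> \<le> \<epsilon> * \<parallel>x\<parallel>\<^bsub>V\<^esub>"
          using CB[OF \<open>\<epsilon> > 0\<close>] by blast
        show ?thesis
        proof (intro exI[of _ N] allI impI ballI)
          fix n x assume n: "N \<le> n" and x: "x \<in> car V"
          have "(\<lambda>m. \<epsilon> * \<parallel>x\<parallel>\<^bsub>V\<^esub> + \<parallel>\<sigma> m x \<ominus> T x\<parallel>) \<longlonglongrightarrow> \<epsilon> * \<parallel>x\<parallel>\<^bsub>V\<^esub> + 0"
            by (intro tendsto_add tendsto_const lim x)
          moreover have "\<parallel>\<sigma> n x \<ominus> T x\<parallel> \<le> \<epsilon> * \<parallel>x\<parallel>\<^bsub>V\<^esub> + \<parallel>\<sigma> m x \<ominus> T x\<parallel>" if "m \<ge> N" for m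
            using N[OF n that x] W.norm_diff_triangle[OF cl cl T, of x x x n m] x by simp
          ultimately show "\<parallel>\<sigma> n x \<ominus> T x\<parallel> \<le> \<epsilon> * \<parallel>x\<parallel>\<^bsub>V\<^esub>"
            using LIMSEQ_le_const[where a = "\<parallel>\<sigma> n x \<ominus> T x\<parallel>"] by fastforce
        qed
      qed
      have T_bl: "bounded_linear_map V W T"
      proof -
        obtain n where n: "\<And>x. x \<in> car V \<Longrightarrow> \<parallel>\<sigma> n x \<ominus> T x\<parallel> \<le> 1 * \<parallel>x\<parallel>\<^bsub>V\<^esub>"
          using near[of 1] by auto
        have "\<parallel>T x\<parallel> \<le> (opnorm V W (\<sigma> n) + 1) * \<parallel>x\<parallel>\<^bsub>V\<^esub>" if x: "x \<in> car V" for x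
          using opnorm_bound[OF bl x, of n] n[OF x] W.norm_le_add_norm_diff[OF T[OF x] cl[OF x, of n]]
          by (simp add: W.norm_diff_commute[OF T[OF x] cl[OF x, of n]] distrib_right)
        then show ?thesis
          using T_lin by (auto simp: bounded_linear_map_def)
      qed
      show "\<exists>T \<in> car (?O).
          (\<lambda>n. \<parallel>\<sigma> n \<ominus>\<^bsub>?O\<^esub> T\<parallel>\<^bsub>?O\<^esub>) \<longlonglongrightarrow> 0"
      proof (rule bexI[of _ "restrict T (car V)"])
        have "(\<lambda>n. opnorm V W (\<lambda>x. \<sigma> n x \<ominus> T x)) \<longlonglongrightarrow> 0"
        proof (rule LIMSEQ_I)
          fix r :: real assume "r > 0"
          then obtain N where N: "\<And>n x. \<lbrakk>n \<ge> N; x \<in> car V\<rbrakk> \<Longrightarrow> \<parallel>\<sigma> n x \<ominus> T x\<parallel> \<le> r / 2 * \<parallel>x\<parallel>\<^bsub>V\<^esub>"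
            using near[of "r / 2"] by auto
          have "norm (opnorm V W (\<lambda>x. \<sigma> n x \<ominus> T x) - 0) < r" if "n \<ge> N" for n
          proof -
            have "opnorm V W (\<lambda>x. \<sigma> n x \<ominus> T x) \<le> r / 2"
              using N[OF that] \<open>r > 0\<close> by (intro opnorm_le_bound) auto
            then show ?thesis
              using \<open>r > 0\<close> opnorm_nonneg[OF bounded_linear_map_diff[OF bl T_bl], of n] by simp
          qed
          then show "\<exists>no. \<forall>n\<ge>no. norm (opnorm V W (\<lambda>x. \<sigma> n x \<ominus> T x) - 0) < r"
            by blast
        qed
        moreover have "\<sigma> n \<ominus>\<^bsub>?O\<^esub> restrict T (car V) = (\<lambda>x\<in>car V. \<sigma> n x \<ominus> T x)" for n
          by (auto simp: fun_eq_iff)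
        ultimately show "(\<lambda>n. \<parallel>\<sigma> n \<ominus>\<^bsub>?O\<^esub> restrict T (car V)\<parallel>\<^bsub>?O\<^esub>) \<longlonglongrightarrow> 0"
          by simp
      qed (simp add: T_bl)
    qed
  qed
qed

lemma complex_banach_space_dual:
  "complex_normed_space V \<Longrightarrow> complex_banach_space (dual V)"
  by (simp add: dual_def complex_banach_space_operator_space complex_banach_space_complex_line)

section \<open>The Hahn--Banach theorem\<close>

definition sublinear :: "('a, 'm) normed_vs_scheme \<Rightarrow> ('a \<Rightarrow> real) \<Rightarrow> bool"
  where "sublinear V p \<longleftrightarrow> (\<forall>x \<in> car V. \<forall>y \<in> car V. p (x \<oplus>\<^bsub>V\<^esub> y) \<le> p x + p y) \<and>
    (\<forall>x \<in> car V. \<forall>t \<ge> 0. p (of_real t \<odot>\<^bsub>V\<^esub> x) \<le> t * p x)"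

lemma le_Inf_add:
  fixes A B :: "real set"
  assumes "A \<noteq> {}" "B \<noteq> {}" "\<And>a b. a \<in> A \<Longrightarrow> b \<in> B \<Longrightarrow> c \<le> a + b"
  shows "c \<le> Inf A + Inf B"
proof -
  have "c - Inf A \<le> b" if "b \<in> B" for b
  proof -
    have "c - b \<le> Inf A"
      using assms(3) that by (intro cInf_greatest[OF assms(1)]) force
    then show ?thesis
      by simp
  qed
  then have "c - Inf A \<le> Inf B"
    by (rule cInf_greatest[OF assms(2)])
  then show ?thesis
    by simp
qed

lemma le_mult_Inf:
  fixes A :: "real set"
  assumes "A \<noteq> {}" "0 \<le> t" "\<And>a. a \<in> A \<Longrightarrow> c \<le> t * a"
  shows "c \<le> t * Inf A"
proof (cases "t = 0")
  case True
  then show ?thesis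
    using assms by auto
next
  case False
  then have "c / t \<le> Inf A"
    using assms by (intro cInf_greatest) (auto simp: field_simps)
  then show ?thesis
    using False assms(2) by (simp add: field_simps)
qed

context complex_normed_space
begin

context
  fixes p assumes p: "sublinear V p"
begin

lemma sublinear_add: "\<lbrakk>x \<in> car V; y \<in> car V\<rbrakk> \<Longrightarrow> p (x \<oplus> y) \<le> p x + p y"
  using p by (simp add: sublinear_def)

lemma sublinear_scale_le: "\<lbrakk>x \<in> car V; 0 \<le> t\<rbrakk> \<Longrightarrow> p (of_real t \<odot> x) \<le> t * p x"
  using p by (simp add: sublinear_def)

lemma sublinear_zero: "p \<zero> = 0"
  using sublinear_add[of \<zero> \<zero>] sublinear_scale_le[of \<zero> 0]
  by (simp add: zero_closed scale_zero_right add_zero)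

lemma sublinear_scale:
  assumes "x \<in> car V" "0 \<le> t"
  shows "p (of_real t \<odot> x) = t * p x"
proof (cases "t = 0")
  case True
  then show ?thesis
    by (simp add: assms scale_zero_left sublinear_zero)
next
  case False
  have "p (of_real (inverse t) \<odot> of_real t \<odot> x) \<le> inverse t * p (of_real t \<odot> x)"
    using assms by (intro sublinear_scale_le scale_closed) auto
  moreover have "of_real (inverse t) \<odot> of_real t \<odot> x = x"
    using False assms by (simp add: scale_scale scale_one)
  ultimately have "t * p x \<le> p (of_real t \<odot> x)"
    using False assms by (simp add: field_simps)
  then show ?thesis
    using sublinear_scale_le[OF assms] by simp
qed

text \<open>
  Take \<open>q x = inf\<^sub>t (p (x + t v) - t p v)\<close> over \<open>t \<ge> 0\<close>.  Then \<open>q (- v) \<le> - p v\<close>, which makes \<open>q\<close>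
  linear on the line through \<open>v\<close>.
\<close>

lemma sublinear_lower:
  assumes v: "v \<in> car V"
  obtains q where "sublinear V q" "\<And>x. x \<in> car V \<Longrightarrow> q x \<le> p x"
    "\<And>x. x \<in> car V \<Longrightarrow> q x \<le> p (x \<oplus> v) - p v"
proof -
  define B where "B x = (\<lambda>t. p (x \<oplus> of_real t \<odot> v) - t * p v) ` {0..}" for x
  have ne: "B x \<noteq> {}" for x
    by (auto simp: B_def)
  have bdd: "bdd_below (B x)" if x: "x \<in> car V" for x
  proof (rule bdd_belowI)
    fix b assume "b \<in> B x"
    then obtain t where t: "0 \<le> t" and b: "b = p (x \<oplus> of_real t \<odot> v) - t * p v"
      by (auto simp: B_def)
    have "p ((x \<oplus> of_real t \<odot> v) \<oplus> (- 1) \<odot> x) \<le> p (x \<oplus> of_real t \<odot> v) + p ((- 1) \<odot> x)"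
      by (intro sublinear_add) (simp_all add: x v scale_closed add_closed)
    moreover have "(x \<oplus> of_real t \<odot> v) \<oplus> (- 1) \<odot> x = of_real t \<odot> v"
      using x v by (metis add_comm add_closed diff_add_cancel scale_closed vdiff_def add_assoc)
    ultimately show "- p ((- 1) \<odot> x) \<le> b"
      using sublinear_scale[OF v t] b by simp
  qed
  have le: "Inf (B x) \<le> p (x \<oplus> of_real t \<odot> v) - t * p v" if "x \<in> car V" "0 \<le> t" for x t
    using that by (intro cInf_lower bdd) (auto simp: B_def)
  show ?thesis
  proof (rule that[of "\<lambda>x. Inf (B x)"])
    show "Inf (B x) \<le> p x" if "x \<in> car V" for x
      using le[OF that, of 0] that v by (simp add: scale_zero_left add_zero)
    show "Inf (B x) \<le> p (x \<oplus> v) - p v" if "x \<in> car V" for x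
      using le[OF that, of 1] that v by (simp add: scale_one)
    show "sublinear V (\<lambda>x. Inf (B x))"
      unfolding sublinear_def
    proof (intro conjI ballI allI impI)
      fix x y assume x: "x \<in> car V" and y: "y \<in> car V"
      show "Inf (B (x \<oplus> y)) \<le> Inf (B x) + Inf (B y)"
      proof (rule le_Inf_add[OF ne ne])
        fix a b assume "a \<in> B x" "b \<in> B y"
        then obtain s t where s: "0 \<le> s" "a = p (x \<oplus> of_real s \<odot> v) - s * p v"
          and t: "0 \<le> t" "b = p (y \<oplus> of_real t \<odot> v) - t * p v"
          by (auto simp: B_def)
        have "(x \<oplus> y) \<oplus> of_real (s + t) \<odot> v = (x \<oplus> of_real s \<odot> v) \<oplus> (y \<oplus> of_real t \<odot> v)"
          using x y v by (simp add: add_scale add_assoc add_left_comm add_closed scale_closed)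
        then have "Inf (B (x \<oplus> y)) \<le> p ((x \<oplus> of_real s \<odot> v) \<oplus> (y \<oplus> of_real t \<odot> v)) - (s + t) * p v"
          using le[of "x \<oplus> y" "s + t"] x y s t by (simp add: add_closed)
        also have "\<dots> \<le> p (x \<oplus> of_real s \<odot> v) + p (y \<oplus> of_real t \<odot> v) - (s + t) * p v"
          using x y v by (intro diff_right_mono sublinear_add add_closed scale_closed)
        finally show "Inf (B (x \<oplus> y)) \<le> a + b"
          using s t by (simp add: algebra_simps)
      qed
    next
      fix x and r :: real assume x: "x \<in> car V" and r: "0 \<le> r"
      show "Inf (B (of_real r \<odot> x)) \<le> r * Inf (B x)"
      proof (rule le_mult_Inf[OF ne r])
        fix a assume "a \<in> B x"
        then obtain t where t: "0 \<le> t" "a = p (x \<oplus> of_real t \<odot> v) - t * p v"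
          by (auto simp: B_def)
        have "of_real r \<odot> x \<oplus> of_real (r * t) \<odot> v = of_real r \<odot> (x \<oplus> of_real t \<odot> v)"
          using x v by (simp add: scale_add scale_scale scale_closed)
        then have "Inf (B (of_real r \<odot> x)) \<le> r * p (x \<oplus> of_real t \<odot> v) - (r * t) * p v"
          using le[of "of_real r \<odot> x" "r * t"] x v r t
          by (simp add: sublinear_scale add_closed scale_closed)
        then show "Inf (B (of_real r \<odot> x)) \<le> r * a"
          unfolding t(2) by (simp add: algebra_simps)
      qed
    qed
  qed
qed

end

text \<open>Sublinear functionals are bounded below, since \<open>- q (- x) \<le> q x\<close>; so the infimum of a chain
  of them is again sublinear and Zorn's lemma applies.\<close>

lemma minimal_sublinear_exists:
  assumes p: "sublinear V p"
  obtains m where "sublinear V m" "\<And>x. x \<in> car V \<Longrightarrow> m x \<le> p x"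
    "\<And>q x. \<lbrakk>sublinear V q; \<And>x. x \<in> car V \<Longrightarrow> q x \<le> m x; x \<in> car V\<rbrakk> \<Longrightarrow> q x = m x"
proof -
  \<comment> \<open>Off the carrier all functionals are made equal, so that the order is antisymmetric.\<close>
  define A where "A = {q. sublinear V q \<and> (\<forall>x. q x \<le> p x) \<and> (\<forall>x. x \<notin> car V \<longrightarrow> q x = p x)}"
  have po: "partial_order_on A (relation_of (\<lambda>a b. b \<le> a) A)"
    by (rule partial_order_on_relation_ofI) auto
  have "\<exists>m \<in> A. \<forall>a \<in> A. a \<le> m \<longrightarrow> a = m"
  proof (rule predicate_Zorn[OF po])
    fix C assume C: "C \<in> Chains (relation_of (\<lambda>a b. b \<le> a) A)"
    have CA: "C \<subseteq> A" and total: "a \<le> b \<or> b \<le> a" if "a \<in> C" "b \<in> C" for a b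
      using C that by (auto simp: Chains_def relation_of_def)
    have CA: "C \<subseteq> A"
      using CA by blast
    show "\<exists>u \<in> A. \<forall>a \<in> C. u \<le> a"
    proof (cases "C = {}")
      case True
      then show ?thesis
        using p by (auto simp: A_def)
    next
      case False
      let ?I = "\<lambda>x. (\<lambda>q. q x) ` C"
      have ne: "?I x \<noteq> {}" for x
        using False by simp
      have bdd: "bdd_below (?I x)" for x
      proof (cases "x \<in> car V")
        case True
        have "- p ((- 1) \<odot> x) \<le> q x" if "q \<in> C" for q
        proof -
          have q: "sublinear V q" and "q ((- 1) \<odot> x) \<le> p ((- 1) \<odot> x)"
            using CA that by (auto simp: A_def)
          moreover have "- q ((- 1) \<odot> x) \<le> q x"
            using sublinear_add[OF q True scale_closed[OF True, of "- 1"]]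
            by (simp add: add_minus True sublinear_zero[OF q])
          ultimately show ?thesis
            by simp
        qed
        then show ?thesis
          by (auto intro!: bdd_belowI[of _ "- p ((- 1) \<odot> x)"])
      next
        case False
        then show ?thesis
          using CA by (auto simp: A_def intro!: bdd_belowI[of _ "p x"])
      qed
      have le: "Inf (?I x) \<le> q x" if "q \<in> C" for q x
        using bdd that by (auto intro: cInf_lower)
      have "sublinear V (\<lambda>x. Inf (?I x))"
        unfolding sublinear_def
      proof (intro conjI ballI allI impI)
        fix x y assume x: "x \<in> car V" and y: "y \<in> car V"
        show "Inf (?I (x \<oplus> y)) \<le> Inf (?I x) + Inf (?I y)"
        proof (rule le_Inf_add[OF ne ne])
          fix a b assume "a \<in> ?I x" "b \<in> ?I y"
          then obtain q r where q: "q \<in> C" "a = q x" and r: "r \<in> C" "b = r y"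
            by auto
          obtain s where s: "s \<in> C" "s \<le> q" "s \<le> r"
            using total[OF q(1) r(1)] q r by blast
          have "Inf (?I (x \<oplus> y)) \<le> s x + s y"
            using le[OF s(1), of "x \<oplus> y"] CA s(1) x y by (force simp: A_def sublinear_def)
          then show "Inf (?I (x \<oplus> y)) \<le> a + b"
            using s(2,3) q r by (smt (verit) le_funD)
        qed
      next
        fix x and t :: real assume x: "x \<in> car V" and t: "0 \<le> t"
        show "Inf (?I (of_real t \<odot> x)) \<le> t * Inf (?I x)"
        proof (rule le_mult_Inf[OF ne t])
          fix a assume "a \<in> ?I x"
          then obtain q where q: "q \<in> C" "a = q x"
            by auto
          then have "q (of_real t \<odot> x) \<le> t * q x"
            using CA x t by (auto simp: A_def sublinear_def)
          then show "Inf (?I (of_real t \<odot> x)) \<le> t * a"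
            using le[OF q(1), of "of_real t \<odot> x"] q by simp
        qed
      qed
      moreover have "Inf (?I x) \<le> p x" for x
      proof -
        obtain q where "q \<in> C"
          using False by blast
        then show ?thesis
          using le[of q x] CA by (force simp: A_def intro: order_trans)
      qed
      moreover have "Inf (?I x) = p x" if "x \<notin> car V" for x
      proof -
        have "?I x = (\<lambda>q. p x) ` C"
          using CA that by (intro image_cong) (auto simp: A_def)
        then show ?thesis
          using False by simp
      qed
      ultimately have "(\<lambda>x. Inf (?I x)) \<in> A"
        by (simp add: A_def)
      then show ?thesis
        using le by (intro bexI[of _ "\<lambda>x. Inf (?I x)"]) (auto simp: le_fun_def)
    qed
  qed
  then obtain m where m: "m \<in> A" and min: "\<And>a. \<lbrakk>a \<in> A; a \<le> m\<rbrakk> \<Longrightarrow> a = m"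
    by blast
  show ?thesis
  proof (rule that[of m])
    show "sublinear V m" "\<And>x. x \<in> car V \<Longrightarrow> m x \<le> p x"
      using m by (auto simp: A_def)
    fix q x assume q: "sublinear V q" and le: "\<And>x. x \<in> car V \<Longrightarrow> q x \<le> m x" and x: "x \<in> car V"
    let ?q = "\<lambda>x. if x \<in> car V then q x else p x"
    have "sublinear V ?q"
      using q by (simp add: sublinear_def add_closed scale_closed)
    then have "?q \<in> A"
      using m le by (auto simp: A_def intro: order_trans)
    then have "?q = m"
      using m le by (intro min) (auto simp: A_def le_fun_def)
    then have "?q x = m x"
      by (rule fun_cong)
    then show "q x = m x"
      using x by simp
  qed
qed

text \<open>
  A minimal sublinear functional cannot be lowered in any direction, hence is additive.  Lowering
  \<open>p\<close> in the direction \<open>v\<close> beforehand makes it agree with \<open>p\<close> at \<open>v\<close>.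
\<close>

lemma hahn_banach_real:
  assumes p: "sublinear V p" and v: "v \<in> car V"
  obtains \<phi> where "\<And>x y. \<lbrakk>x \<in> car V; y \<in> car V\<rbrakk> \<Longrightarrow> \<phi> (x \<oplus> y) = \<phi> x + \<phi> y"
    "\<And>t x. x \<in> car V \<Longrightarrow> \<phi> (of_real t \<odot> x) = t * \<phi> x"
    "\<And>x. x \<in> car V \<Longrightarrow> \<phi> x \<le> p x" "\<phi> v = p v"
proof -
  obtain p' where p': "sublinear V p'" and p'_le: "\<And>x. x \<in> car V \<Longrightarrow> p' x \<le> p x"
    and p'_v: "\<And>x. x \<in> car V \<Longrightarrow> p' x \<le> p (x \<oplus> v) - p v"
    using sublinear_lower[OF p v] by blast
  obtain m where m: "sublinear V m" and m_le: "\<And>x. x \<in> car V \<Longrightarrow> m x \<le> p' x"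
    and min: "\<And>q x. \<lbrakk>sublinear V q; \<And>x. x \<in> car V \<Longrightarrow> q x \<le> m x; x \<in> car V\<rbrakk> \<Longrightarrow> q x = m x"
    using minimal_sublinear_exists[OF p'] by blast
  have add: "m (x \<oplus> y) = m x + m y" if x: "x \<in> car V" and y: "y \<in> car V" for x y
  proof -
    obtain q where q: "sublinear V q" "\<And>x. x \<in> car V \<Longrightarrow> q x \<le> m x"
      "\<And>x. x \<in> car V \<Longrightarrow> q x \<le> m (x \<oplus> y) - m y"
      using sublinear_lower[OF m y] by blast
    then have "m x \<le> m (x \<oplus> y) - m y"
      using min[OF q(1,2) x] q(3)[OF x] by simp
    then show ?thesis
      using sublinear_add[OF m x y] by simp
  qed
  have minus: "m ((- 1) \<odot> x) = - m x" if "x \<in> car V" for x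
    using add[of x "(- 1) \<odot> x"] that by (simp add: scale_closed add_minus sublinear_zero[OF m])
  show ?thesis
  proof (rule that[of m])
    fix t :: real and x assume x: "x \<in> car V"
    show "m (of_real t \<odot> x) = t * m x"
    proof (cases "0 \<le> t")
      case True
      then show ?thesis
        by (simp add: sublinear_scale[OF m] x)
    next
      case False
      have "of_real t \<odot> x = (- 1) \<odot> of_real (- t) \<odot> x"
        using x by (simp add: scale_scale)
      then show ?thesis
        using False sublinear_scale[OF m x, of "- t"] x minus by (simp add: scale_closed)
    qed
  next
    show "m x \<le> p x" if "x \<in> car V" for x
      using m_le[OF that] p'_le[OF that] by simp
    have "m ((- 1) \<odot> v) \<le> p ((- 1) \<odot> v \<oplus> v) - p v"
      using m_le p'_v v scale_closed order_trans by blast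
    moreover have "(- 1) \<odot> v \<oplus> v = \<zero>"
      using v by (simp add: add_comm scale_closed add_minus)
    ultimately have "p v \<le> m v"
      by (simp add: minus v sublinear_zero[OF p])
    then show "m v = p v"
      using m_le p'_le v by fastforce
  qed (simp add: add)
qed

text \<open>A real-linear functional \<open>\<phi>\<close> is the real part of the complex-linear functional
  \<open>x \<mapsto> \<phi> x - \<i> \<phi> (\<i> x)\<close>.\<close>

lemma hahn_banach_complex:
  assumes p: "sublinear V p" and v: "v \<in> car V"
  obtains \<psi> where "linear_map V complex_line \<psi>" "\<And>x. x \<in> car V \<Longrightarrow> Re (\<psi> x) \<le> p x"
    "Re (\<psi> v) = p v"
proof -
  obtain \<phi> where add: "\<And>x y. \<lbrakk>x \<in> car V; y \<in> car V\<rbrakk> \<Longrightarrow> \<phi> (x \<oplus> y) = \<phi> x + \<phi> y"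
    and scale: "\<And>t x. x \<in> car V \<Longrightarrow> \<phi> (of_real t \<odot> x) = t * \<phi> x"
    and le: "\<And>x. x \<in> car V \<Longrightarrow> \<phi> x \<le> p x" and eq: "\<phi> v = p v"
    using hahn_banach_real[OF p v] by blast
  define \<psi> where "\<psi> x = Complex (\<phi> x) (- \<phi> (\<i> \<odot> x))" for x
  have "linear_map V complex_line \<psi>"
  proof (rule linear_mapI)
    fix c x assume x: "x \<in> car V"
    have "c = of_real (Re c) + of_real (Im c) * \<i>"
      by (simp add: complex_eq_iff)
    then have "c \<odot> x = of_real (Re c) \<odot> x \<oplus> of_real (Im c) \<odot> \<i> \<odot> x"
      using x by (metis add_scale scale_scale)
    moreover have "\<i> * c = of_real (- Im c) + of_real (Re c) * \<i>"
      by (simp add: complex_eq_iff)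
    then have "\<i> \<odot> c \<odot> x = of_real (- Im c) \<odot> x \<oplus> of_real (Re c) \<odot> \<i> \<odot> x"
      using x by (simp only: scale_scale add_scale)
    ultimately show "\<psi> (c \<odot>\<^bsub>V\<^esub> x) = c \<odot>\<^bsub>complex_line\<^esub> \<psi> x"
      using x by (simp add: \<psi>_def add scale scale_closed complex_eq_iff del: of_real_minus)
  qed (simp_all add: \<psi>_def add scale_add scale_closed complex_eq_iff)
  moreover have "Re (\<psi> x) = \<phi> x" for x
    by (simp add: \<psi>_def)
  ultimately show ?thesis
    using that[of \<psi>] le eq by simp
qed

text \<open>Rotating \<open>x\<close> makes the value of the functional real and nonnegative.\<close>

lemma norm_le_of_Re_le:
  assumes \<psi>: "linear_map V complex_line \<psi>" and le: "\<And>x. x \<in> car V \<Longrightarrow> Re (\<psi> x) \<le> K * \<parallel>x\<parallel>"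
    and x: "x \<in> car V"
  shows "cmod (\<psi> x) \<le> K * \<parallel>x\<parallel>"
proof -
  define c where "c = (if \<psi> x = 0 then 1 else of_real (cmod (\<psi> x)) / \<psi> x)"
  have c: "cmod c = 1" "c * \<psi> x = of_real (cmod (\<psi> x))"
    by (auto simp: c_def norm_divide)
  have "cmod (\<psi> x) = Re (\<psi> (c \<odot> x))"
    using linear_map_scale[OF \<psi> x, of c] c(2) by simp
  also have "\<dots> \<le> K * \<parallel>x\<parallel>"
    using le[of "c \<odot> x"] x c(1) by (simp add: scale_closed norm_scale)
  finally show ?thesis .
qed

end

text \<open>
  The separation form of the Hahn--Banach theorem for the distance from \<open>y\<close> to the image of \<open>L\<close>,
  penalised by the norm of the argument: the functional is obtained from the seminorm
  \<open>z \<mapsto> inf\<^sub>s (\<alpha> \<parallel>z - L s\<parallel> + \<beta> \<parallel>s\<parallel>)\<close>.  For \<open>L = 0\<close> it gives norming functionals, for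
  \<open>\<beta> = 0\<close> functionals vanishing on a subspace.
\<close>

lemma (in normed_space_pair) hahn_banach_distance:
  assumes L: "linear_map V W L" and y: "y \<in> car W" and \<alpha>: "0 \<le> \<alpha>" and \<beta>: "0 \<le> \<beta>"
    and t: "\<And>s. s \<in> car V \<Longrightarrow> t \<le> \<alpha> * \<parallel>y \<ominus> L s\<parallel> + \<beta> * \<parallel>s\<parallel>\<^bsub>V\<^esub>"
  obtains \<psi> where "linear_map W complex_line \<psi>"
    "\<And>z. z \<in> car W \<Longrightarrow> cmod (\<psi> z) \<le> \<alpha> * \<parallel>z\<parallel>"
    "\<And>s. s \<in> car V \<Longrightarrow> cmod (\<psi> (L s)) \<le> \<beta> * \<parallel>s\<parallel>\<^bsub>V\<^esub>" "t \<le> cmod (\<psi> y)"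
proof -
  define B where "B z = (\<lambda>s. \<alpha> * \<parallel>z \<ominus> L s\<parallel> + \<beta> * \<parallel>s\<parallel>\<^bsub>V\<^esub>) ` car V" for z
  note Lcl = linear_map_closed[OF L]
  have ne: "B z \<noteq> {}" for z
    using V.zero_closed by (auto simp: B_def)
  have le: "Inf (B z) \<le> \<alpha> * \<parallel>z \<ominus> L s\<parallel> + \<beta> * \<parallel>s\<parallel>\<^bsub>V\<^esub>" if "z \<in> car W" "s \<in> car V" for z s
    using that \<alpha> \<beta> by (intro cInf_lower bdd_belowI[of _ 0])
      (auto simp: B_def W.norm_nonneg V.norm_nonneg W.diff_closed Lcl)
  have "sublinear W (\<lambda>z. Inf (B z))"
    unfolding sublinear_def
  proof (intro conjI ballI allI impI)
    fix z w assume z: "z \<in> car W" and w: "w \<in> car W"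
    show "Inf (B (z \<oplus> w)) \<le> Inf (B z) + Inf (B w)"
    proof (rule le_Inf_add[OF ne ne])
      fix a b assume "a \<in> B z" "b \<in> B w"
      then obtain s r where s: "s \<in> car V" "a = \<alpha> * \<parallel>z \<ominus> L s\<parallel> + \<beta> * \<parallel>s\<parallel>\<^bsub>V\<^esub>"
        and r: "r \<in> car V" "b = \<alpha> * \<parallel>w \<ominus> L r\<parallel> + \<beta> * \<parallel>r\<parallel>\<^bsub>V\<^esub>"
        by (auto simp: B_def)
      have "\<parallel>(z \<oplus> w) \<ominus> L (s \<oplus>\<^bsub>V\<^esub> r)\<parallel> \<le> \<parallel>z \<ominus> L s\<parallel> + \<parallel>w \<ominus> L r\<parallel>"
        using s(1) r(1) z w
        by (simp add: linear_map_add[OF L] W.add_diff_add Lcl W.norm_triangle W.diff_closed)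
      then have "\<alpha> * \<parallel>(z \<oplus> w) \<ominus> L (s \<oplus>\<^bsub>V\<^esub> r)\<parallel> + \<beta> * \<parallel>s \<oplus>\<^bsub>V\<^esub> r\<parallel>\<^bsub>V\<^esub> \<le>
          \<alpha> * (\<parallel>z \<ominus> L s\<parallel> + \<parallel>w \<ominus> L r\<parallel>) + \<beta> * (\<parallel>s\<parallel>\<^bsub>V\<^esub> + \<parallel>r\<parallel>\<^bsub>V\<^esub>)"
        using \<alpha> \<beta> s(1) r(1) by (intro add_mono mult_left_mono V.norm_triangle)
      then show "Inf (B (z \<oplus> w)) \<le> a + b"
        using le[of "z \<oplus> w" "s \<oplus>\<^bsub>V\<^esub> r"] s r z w by (simp add: W.add_closed V.add_closed algebra_simps)
    qed
  next
    fix z and r :: real assume z: "z \<in> car W" and r: "0 \<le> r"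
    show "Inf (B (of_real r \<odot> z)) \<le> r * Inf (B z)"
    proof (rule le_mult_Inf[OF ne r])
      fix a assume "a \<in> B z"
      then obtain s where s: "s \<in> car V" "a = \<alpha> * \<parallel>z \<ominus> L s\<parallel> + \<beta> * \<parallel>s\<parallel>\<^bsub>V\<^esub>"
        by (auto simp: B_def)
      have "\<parallel>of_real r \<odot> z \<ominus> L (of_real r \<odot>\<^bsub>V\<^esub> s)\<parallel> = r * \<parallel>z \<ominus> L s\<parallel>"
        using s(1) z r
        by (simp add: linear_map_scale[OF L] Lcl W.norm_scale W.diff_closed flip: W.scale_diff)
      then show "Inf (B (of_real r \<odot> z)) \<le> r * a"
        using le[of "of_real r \<odot> z" "of_real r \<odot>\<^bsub>V\<^esub> s"] s z r
        by (simp add: W.scale_closed V.scale_closed V.norm_scale algebra_simps)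
    qed
  qed
  then obtain \<psi> where \<psi>: "linear_map W complex_line \<psi>" and \<psi>_le: "\<And>z. z \<in> car W \<Longrightarrow> Re (\<psi> z) \<le> Inf (B z)"
    and eq: "Re (\<psi> y) = Inf (B y)"
    using W.hahn_banach_complex y by blast
  show ?thesis
  proof (rule that[OF \<psi>])
    fix z assume "z \<in> car W"
    then show "cmod (\<psi> z) \<le> \<alpha> * \<parallel>z\<parallel>"
    proof (rule W.norm_le_of_Re_le[OF \<psi>, rotated])
      fix z assume z: "z \<in> car W"
      then show "Re (\<psi> z) \<le> \<alpha> * \<parallel>z\<parallel>"
        using \<psi>_le[OF z] le[OF z V.zero_closed] by (simp add: linear_map_zero[OF L] W.diff_zero)
    qed
  next
    fix s assume "s \<in> car V"
    then show "cmod (\<psi> (L s)) \<le> \<beta> * \<parallel>s\<parallel>\<^bsub>V\<^esub>"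
    proof (rule V.norm_le_of_Re_le[rotated 2])
      show "linear_map V complex_line (\<lambda>s. \<psi> (L s))"
        using \<psi> L unfolding linear_map_def by (auto simp: Pi_iff)
      fix s assume s: "s \<in> car V"
      then show "Re (\<psi> (L s)) \<le> \<beta> * \<parallel>s\<parallel>\<^bsub>V\<^esub>"
        using \<psi>_le[OF Lcl[OF s]] le[OF Lcl[OF s] s] by (simp add: W.diff_self Lcl)
    qed
  next
    have "t \<le> Inf (B y)"
      using t by (intro cInf_greatest[OF ne]) (auto simp: B_def)
    then show "t \<le> cmod (\<psi> y)"
      using eq complex_Re_le_cmod[of "\<psi> y"] by simp
  qed
qed

section \<open>Dual spaces\<close>

lemma dual_simps [simp]:
  "car (dual V) = {T \<in> extensional (car V). bounded_linear_map V complex_line T}"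
  "vzero (dual V) = (\<lambda>x \<in> car V. 0)"
  "vadd (dual V) = (\<lambda>S T. \<lambda>x \<in> car V. S x + T x)"
  "vscale (dual V) = (\<lambda>c T. \<lambda>x \<in> car V. c * T x)"
  "vnorm (dual V) = opnorm V complex_line"
  "vdiff (dual V) = (\<lambda>S T. \<lambda>x \<in> car V. S x - T x)"
  by (simp_all add: dual_def)

interpretation complex_line: complex_banach_space complex_line
  by (rule complex_banach_space_complex_line)

context complex_normed_space
begin

sublocale functional: normed_space_pair V complex_line
  by unfold_locales

lemma norming_functional:
  assumes x: "x \<in> car V"
  obtains f where "f \<in> unit_ball (dual V)" "\<parallel>x\<parallel> \<le> cmod (f x)"
proof -
  interpret P: normed_space_pair V V
    by unfold_locales
  have "linear_map V V (\<lambda>x. \<zero>)"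
    using P.bounded_linear_map_zero by (simp add: bounded_linear_map_def)
  then show ?thesis
  proof (rule P.hahn_banach_distance[of "\<lambda>x. \<zero>" x 1 0 "\<parallel>x\<parallel>"])
    fix \<psi> assume \<psi>: "linear_map V complex_line \<psi>" "\<And>z. z \<in> car V \<Longrightarrow> cmod (\<psi> z) \<le> 1 * \<parallel>z\<parallel>"
      "\<parallel>x\<parallel> \<le> cmod (\<psi> x)"
    have "bounded_linear_map V complex_line \<psi>"
      using \<psi>(1,2) unfolding bounded_linear_map_def by (auto intro!: exI[of _ 1])
    moreover have "opnorm V complex_line \<psi> \<le> 1"
      using \<psi>(2) by (intro functional.opnorm_le_bound) auto
    ultimately show ?thesis
      using \<psi>(3) x by (intro that[of "restrict \<psi> (car V)"]) (auto simp: unit_ball_def)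
  qed (use x in \<open>auto simp: diff_zero\<close>)
qed

lemma norm_le_iff_functionals:
  assumes x: "x \<in> car V" and r: "0 \<le> r"
  shows "\<parallel>x\<parallel> \<le> r \<longleftrightarrow> (\<forall>f \<in> unit_ball (dual V). cmod (f x) \<le> r)"
proof
  assume *: "\<parallel>x\<parallel> \<le> r"
  show "\<forall>f \<in> unit_ball (dual V). cmod (f x) \<le> r"
  proof
    fix f assume "f \<in> unit_ball (dual V)"
    then have f: "bounded_linear_map V complex_line f" "opnorm V complex_line f \<le> 1"
      by (auto simp: unit_ball_def)
    then have "cmod (f x) \<le> opnorm V complex_line f * \<parallel>x\<parallel>"
      using functional.opnorm_bound[OF f(1) x] by simp
    also have "\<dots> \<le> 1 * \<parallel>x\<parallel>"
      using f(2) norm_nonneg[OF x] by (rule mult_right_mono)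
    finally show "cmod (f x) \<le> r"
      using * by simp
  qed
qed (meson norming_functional[OF x] order_trans)

lemma functionals_separate:
  assumes "x \<in> car V" "y \<in> car V" "\<And>f. f \<in> car (dual V) \<Longrightarrow> f x = f y"
  shows "x = y"
proof -
  obtain f where f: "f \<in> unit_ball (dual V)" "\<parallel>x \<ominus> y\<parallel> \<le> cmod (f (x \<ominus> y))"
    using norming_functional assms diff_closed by blast
  moreover have "f (x \<ominus> y) = f x - f y"
    using f(1) assms functional.linear_map_diff[of f x y]
    by (simp add: unit_ball_def bounded_linear_map_def)
  ultimately have "\<parallel>x \<ominus> y\<parallel> \<le> 0"
    using assms(3)[of f] by (simp add: unit_ball_def)
  then have "\<parallel>x \<ominus> y\<parallel> = 0"
    using norm_nonneg[OF diff_closed[OF assms(1,2)]] by simp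
  then show ?thesis
    using assms(1,2) by (simp add: diff_closed norm_definite diff_eq_zero_iff)
qed

end

text \<open>
  A bounded net of functionals has a generalized limit in the dual, which has the right value
  wherever the net converges pointwise.  The upper limit of the real parts is a sublinear functional,
  and a linear functional below it cannot differ from a limit that exists.
\<close>

lemma (in complex_normed_space) generalized_limit:
  assumes I: "I \<noteq> {}" "\<And>i. i \<in> I \<Longrightarrow> le i i"
    and directed: "\<And>i j. \<lbrakk>i \<in> I; j \<in> I\<rbrakk> \<Longrightarrow> \<exists>k \<in> I. le i k \<and> le j k"
    and trans: "\<And>i j k. \<lbrakk>i \<in> I; j \<in> I; k \<in> I; le i j; le j k\<rbrakk> \<Longrightarrow> le i k"
    and g: "\<And>i. i \<in> I \<Longrightarrow> linear_map V complex_line (g i)"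
    and K: "\<And>i z. \<lbrakk>i \<in> I; z \<in> car V\<rbrakk> \<Longrightarrow> cmod (g i z) \<le> K * \<parallel>z\<parallel>"
  obtains \<psi> where "\<psi> \<in> car (dual V)"
    "\<And>z c. \<lbrakk>z \<in> car V; \<And>\<epsilon>. \<epsilon> > 0 \<Longrightarrow> \<exists>i \<in> I. \<forall>j \<in> I. le i j \<longrightarrow> cmod (g j z - c) < \<epsilon>\<rbrakk> \<Longrightarrow> \<psi> z = c"
proof -
  define B where "B z = {r. \<exists>i \<in> I. \<forall>j \<in> I. le i j \<longrightarrow> Re (g j z) \<le> r}" for z
  have KB: "K * \<parallel>z\<parallel> \<in> B z" if "z \<in> car V" for z
  proof -
    have "Re (g i z) \<le> K * \<parallel>z\<parallel>" if "i \<in> I" for i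
      using K[OF that \<open>z \<in> car V\<close>] complex_Re_le_cmod[of "g i z"] by linarith
    then show ?thesis
      using I by (auto simp: B_def)
  qed
  have le: "Inf (B z) \<le> r" if "z \<in> car V" "r \<in> B z" for z r
  proof (rule cInf_lower[OF that(2)], rule bdd_belowI)
    fix r assume "r \<in> B z"
    then obtain i where "i \<in> I" "Re (g i z) \<le> r"
      using I by (auto simp: B_def)
    then show "- (K * \<parallel>z\<parallel>) \<le> r"
      using K[OF \<open>i \<in> I\<close> that(1)] abs_Re_le_cmod[of "g i z"] by linarith
  qed
  have "sublinear V (\<lambda>z. Inf (B z))"
    unfolding sublinear_def
  proof (intro conjI ballI allI impI)
    fix z w assume z: "z \<in> car V" and w: "w \<in> car V"
    show "Inf (B (z \<oplus> w)) \<le> Inf (B z) + Inf (B w)"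
    proof (rule le_Inf_add)
      fix r s assume "r \<in> B z" "s \<in> B w"
      then obtain i j where i: "i \<in> I" "\<And>k. k \<in> I \<Longrightarrow> le i k \<Longrightarrow> Re (g k z) \<le> r"
        and j: "j \<in> I" "\<And>k. k \<in> I \<Longrightarrow> le j k \<Longrightarrow> Re (g k w) \<le> s"
        by (auto simp: B_def)
      obtain k where k: "k \<in> I" "le i k" "le j k"
        using directed i j by blast
      have "Re (g l (z \<oplus> w)) \<le> r + s" if "l \<in> I" "le k l" for l
      proof -
        have "le i l" "le j l"
          using trans[OF _ k(1) that(1) _ that(2)] i j k by blast+
        then have "Re (g l z) + Re (g l w) \<le> r + s"
          using i j that by (intro add_mono) auto
        then show ?thesis
          by (simp add: linear_map_add[OF g[OF that(1)] z w])
      qed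
      then have "r + s \<in> B (z \<oplus> w)"
        using k by (auto simp: B_def)
      then show "Inf (B (z \<oplus> w)) \<le> r + s"
        using le z w add_closed by blast
    qed (use KB z w in blast)+
  next
    fix z and t :: real assume z: "z \<in> car V" and t: "0 \<le> t"
    show "Inf (B (of_real t \<odot> z)) \<le> t * Inf (B z)"
    proof (rule le_mult_Inf)
      fix r assume "r \<in> B z"
      then obtain i where i: "i \<in> I" "\<And>k. k \<in> I \<Longrightarrow> le i k \<Longrightarrow> Re (g k z) \<le> r"
        by (auto simp: B_def)
      have "Re (g k (of_real t \<odot> z)) \<le> t * r" if "k \<in> I" "le i k" for k
        using linear_map_scale[OF g[OF that(1)] z, of t] i(2)[OF that] t by (simp add: mult_left_mono)
      then have "t * r \<in> B (of_real t \<odot> z)"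
        using i by (auto simp: B_def)
      then show "Inf (B (of_real t \<odot> z)) \<le> t * r"
        using le z scale_closed by blast
    qed (use KB z t in auto)
  qed
  then obtain \<psi> where \<psi>: "linear_map V complex_line \<psi>" and \<psi>_le: "\<And>z. z \<in> car V \<Longrightarrow> Re (\<psi> z) \<le> Inf (B z)"
    using hahn_banach_complex zero_closed by blast
  have "Re (\<psi> z) \<le> K * \<parallel>z\<parallel>" if "z \<in> car V" for z
    using \<psi>_le[OF that] le[OF that KB[OF that]] by simp
  then have bl: "bounded_linear_map V complex_line \<psi>"
    using \<psi> norm_le_of_Re_le[OF \<psi>] unfolding bounded_linear_map_def by auto
  have Re_le: "Re (\<psi> z) \<le> Re c" if z: "z \<in> car V"
    and lim: "\<And>\<epsilon>. \<epsilon> > 0 \<Longrightarrow> \<exists>i \<in> I. \<forall>j \<in> I. le i j \<longrightarrow> cmod (g j z - c) < \<epsilon>" for z c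
  proof (rule field_le_epsilon)
    fix \<epsilon> :: real assume "\<epsilon> > 0"
    then obtain i where i: "i \<in> I" "\<And>j. j \<in> I \<Longrightarrow> le i j \<Longrightarrow> cmod (g j z - c) < \<epsilon>"
      using lim by blast
    have "Re (g j z) \<le> Re c + \<epsilon>" if "j \<in> I" "le i j" for j
      using i(2)[OF that] complex_Re_le_cmod[of "g j z - c"] by simp
    then have "Re c + \<epsilon> \<in> B z"
      using i(1) by (auto simp: B_def)
    then show "Re (\<psi> z) \<le> Re c + \<epsilon>"
      using le[OF z] \<psi>_le[OF z] by fastforce
  qed
  have scale_lim: "\<exists>i \<in> I. \<forall>j \<in> I. le i j \<longrightarrow> cmod (g j (a \<odot> z) - a * c) < \<epsilon>" if z: "z \<in> car V"
    and lim: "\<And>\<epsilon>. \<epsilon> > 0 \<Longrightarrow> \<exists>i \<in> I. \<forall>j \<in> I. le i j \<longrightarrow> cmod (g j z - c) < \<epsilon>"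
    and a: "cmod a = 1" and "\<epsilon> > 0" for z c a \<epsilon>
  proof -
    have "cmod (g j (a \<odot> z) - a * c) = cmod (g j z - c)" if "j \<in> I" for j
      using linear_map_scale[OF g[OF that] z, of a] a
      by (simp add: norm_mult flip: right_diff_distrib)
    then show ?thesis
      using lim[OF \<open>\<epsilon> > 0\<close>] by simp
  qed
  show ?thesis
  proof (rule that[of "restrict \<psi> (car V)"])
    fix z c assume z: "z \<in> car V"
      and lim: "\<And>\<epsilon>. \<epsilon> > 0 \<Longrightarrow> \<exists>i \<in> I. \<forall>j \<in> I. le i j \<longrightarrow> cmod (g j z - c) < \<epsilon>"
    \<comment> \<open>Rotations of \<open>z\<close> by the four units determine the real and the imaginary part.\<close>
    have *: "Re (a * \<psi> z) \<le> Re (a * c)" if "cmod a = 1" for a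
      using Re_le[OF scale_closed[OF z] scale_lim[OF z lim that]] linear_map_scale[OF \<psi> z, of a]
      by simp
    have "\<psi> z = c"
      using *[of 1] *[of "- 1"] *[of "\<i>"] *[of "- \<i>"] by (simp add: complex_eq_iff)
    then show "restrict \<psi> (car V) z = c"
      using z by simp
  qed (simp add: bl)
qed

section \<open>Total boundedness\<close>

text \<open>
  Compactness of an operator is handled through finite covers of the unit ball by sets on which the
  operator is nearly constant.  Unlike finite nets, such covers can be intersected.
\<close>

definition small_cover :: "'p set \<Rightarrow> ('p \<Rightarrow> 'p \<Rightarrow> bool) \<Rightarrow> bool"
  where "small_cover P d \<longleftrightarrow>
    (\<exists>\<U>. finite \<U> \<and> P \<subseteq> \<Union>\<U> \<and> (\<forall>U \<in> \<U>. \<forall>x \<in> U \<inter> P. \<forall>y \<in> U \<inter> P. d x y))"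

lemma small_cover_mono:
  assumes "small_cover P d" "\<And>x y. \<lbrakk>x \<in> P; y \<in> P; d x y\<rbrakk> \<Longrightarrow> d' x y"
  shows "small_cover P d'"
  using assms unfolding small_cover_def by (meson IntD2)

lemma small_cover_conj:
  assumes "small_cover P d" "small_cover P d'"
  shows "small_cover P (\<lambda>x y. d x y \<and> d' x y)"
proof -
  obtain \<U> where \<U>: "finite \<U>" "P \<subseteq> \<Union>\<U>" "\<forall>U \<in> \<U>. \<forall>x \<in> U \<inter> P. \<forall>y \<in> U \<inter> P. d x y"
    using assms(1) unfolding small_cover_def by (elim exE conjE)
  obtain \<V> where \<V>: "finite \<V>" "P \<subseteq> \<Union>\<V>" "\<forall>U \<in> \<V>. \<forall>x \<in> U \<inter> P. \<forall>y \<in> U \<inter> P. d' x y"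
    using assms(2) unfolding small_cover_def by (elim exE conjE)
  show ?thesis
    unfolding small_cover_def
  proof (intro exI[of _ "(\<lambda>(U, U'). U \<inter> U') ` (\<U> \<times> \<V>)"] conjI)
    show "P \<subseteq> \<Union>((\<lambda>(U, U'). U \<inter> U') ` (\<U> \<times> \<V>))"
    proof
      fix x assume "x \<in> P"
      then obtain U U' where "U \<in> \<U>" "x \<in> U" "U' \<in> \<V>" "x \<in> U'"
        using \<U>(2) \<V>(2) by blast
      then show "x \<in> \<Union>((\<lambda>(U, U'). U \<inter> U') ` (\<U> \<times> \<V>))"
        by (intro UnionI[of "U \<inter> U'"]) auto
    qed
    show "\<forall>U \<in> (\<lambda>(U, U'). U \<inter> U') ` (\<U> \<times> \<V>). \<forall>x \<in> U \<inter> P. \<forall>y \<in> U \<inter> P. d x y \<and> d' x y"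
      using \<U>(3) \<V>(3) by auto
  qed (simp add: \<U>(1) \<V>(1))
qed

lemma small_cover_Ball:
  assumes "finite F" "\<And>q. q \<in> F \<Longrightarrow> small_cover P (d q)"
  shows "small_cover P (\<lambda>x y. \<forall>q \<in> F. d q x y)"
  using assms
proof (induction F)
  case empty
  then show ?case
    by (auto simp: small_cover_def intro!: exI[of _ "{P}"])
next
  case (insert q F)
  then have "small_cover P (\<lambda>x y. d q x y \<and> (\<forall>q \<in> F. d q x y))"
    by (intro small_cover_conj) auto
  then show ?case
    by simp
qed

lemma small_cover_net:
  assumes "small_cover P d"
  obtains F where "finite F" "F \<subseteq> P" "\<And>x. x \<in> P \<Longrightarrow> \<exists>y \<in> F. d x y"
proof -
  obtain \<U> where \<U>: "finite \<U>" "P \<subseteq> \<Union>\<U>" "\<forall>U \<in> \<U>. \<forall>x \<in> U \<inter> P. \<forall>y \<in> U \<inter> P. d x y"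
    using assms unfolding small_cover_def by (elim exE conjE)
  define c where "c U = (SOME x. x \<in> U \<inter> P)" for U
  have c: "c U \<in> U \<inter> P" if "x \<in> U" "x \<in> P" for x U
    unfolding c_def by (rule someI[of _ x]) (use that in simp)
  show ?thesis
  proof (rule that[of "c ` {U \<in> \<U>. U \<inter> P \<noteq> {}}"])
    show "c ` {U \<in> \<U>. U \<inter> P \<noteq> {}} \<subseteq> P"
      using c by blast
    show "\<exists>y \<in> c ` {U \<in> \<U>. U \<inter> P \<noteq> {}}. d x y" if x: "x \<in> P" for x
    proof -
      obtain U where "U \<in> \<U>" "x \<in> U"
        using \<U>(2) x by blast
      then show ?thesis
        using \<U>(3) c[of x U] x by blast
    qed
  qed (use \<U>(1) in simp)
qed

lemma small_cover_of_net:
  assumes "finite F" "\<And>x. x \<in> P \<Longrightarrow> \<exists>z \<in> F. d x z"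
  shows "small_cover P (\<lambda>x y. \<exists>z \<in> F. d x z \<and> d y z)"
  unfolding small_cover_def
  using assms by (intro exI[of _ "(\<lambda>z. {x. d x z}) ` F"]) blast

lemma small_cover_bounded_complex:
  assumes "\<And>x. x \<in> P \<Longrightarrow> cmod (f x) \<le> M" "\<epsilon> > 0"
  shows "small_cover P (\<lambda>x y. cmod (f x - f y) \<le> \<epsilon>)"
proof -
  have "compact (cball 0 M :: complex set)"
    by simp
  then obtain K where K: "finite K" "cball 0 M \<subseteq> (\<Union>k \<in> K. ball (k :: complex) (\<epsilon> / 2))"
    using assms(2) unfolding compact_eq_totally_bounded by (meson half_gt_zero)
  have "small_cover P (\<lambda>x y. \<exists>z \<in> K. dist z (f x) < \<epsilon> / 2 \<and> dist z (f y) < \<epsilon> / 2)"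
    using K assms(1) by (intro small_cover_of_net) (force simp: subset_iff)+
  then show ?thesis
  proof (rule small_cover_mono)
    fix x y assume "\<exists>z \<in> K. dist z (f x) < \<epsilon> / 2 \<and> dist z (f y) < \<epsilon> / 2"
    then obtain z where "dist z (f x) < \<epsilon> / 2" "dist z (f y) < \<epsilon> / 2"
      by blast
    then show "cmod (f x - f y) \<le> \<epsilon>"
      using dist_triangle2[of "f x" "f y" z] by (simp add: dist_commute dist_norm)
  qed
qed

text \<open>
  The combinatorial core of Schauder's theorem: a function of two variables whose family of columns
  is totally bounded in the supremum norm has a totally bounded family of rows.  Finitely many
  columns determine the others up to a small error, and finitely many bounded values are easily
  covered.
\<close>

lemma small_cover_swap:
  fixes b :: "'p \<Rightarrow> 'q \<Rightarrow> complex"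
  assumes bounded: "\<And>x y. \<lbrakk>x \<in> P; y \<in> Q\<rbrakk> \<Longrightarrow> cmod (b x y) \<le> M" and \<epsilon>: "\<epsilon> > 0"
    and Q: "\<And>\<epsilon>. \<epsilon> > 0 \<Longrightarrow> small_cover Q (\<lambda>y y'. \<forall>x \<in> P. cmod (b x y - b x y') \<le> \<epsilon>)"
  shows "small_cover P (\<lambda>x x'. \<forall>y \<in> Q. cmod (b x y - b x' y) \<le> \<epsilon>)"
proof -
  obtain F where F: "finite F" "F \<subseteq> Q"
    and net: "\<And>y. y \<in> Q \<Longrightarrow> \<exists>z \<in> F. \<forall>x \<in> P. cmod (b x y - b x z) \<le> \<epsilon> / 3"
    using small_cover_net[OF Q[of "\<epsilon> / 3"]] \<epsilon> by auto
  have "small_cover P (\<lambda>x x'. \<forall>z \<in> F. cmod (b x z - b x' z) \<le> \<epsilon> / 3)"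
    using F \<epsilon> bounded by (intro small_cover_Ball small_cover_bounded_complex) auto
  then show ?thesis
  proof (rule small_cover_mono, intro ballI)
    fix x x' y
    assume x: "x \<in> P" "x' \<in> P" and z: "\<forall>z \<in> F. cmod (b x z - b x' z) \<le> \<epsilon> / 3" and y: "y \<in> Q"
    obtain z where "z \<in> F" "cmod (b x y - b x z) \<le> \<epsilon> / 3" "cmod (b x' y - b x' z) \<le> \<epsilon> / 3"
      using net[OF y] x by blast
    moreover have "b x y - b x' y = (b x y - b x z) + (b x z - b x' z) - (b x' y - b x' z)"
      by simp
    ultimately show "cmod (b x y - b x' y) \<le> \<epsilon>"
      using z norm_triangle_ineq4[of "(b x y - b x z) + (b x z - b x' z)" "b x' y - b x' z"]
        norm_triangle_ineq[of "b x y - b x z" "b x z - b x' z"] by fastforce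
  qed
qed

section \<open>Compact operators\<close>

text \<open>Nets in the image of the unit ball correspond to covers of the ball itself, up to a factor \<open>2\<close>
  in the error.\<close>

lemma compact_operator_iff:
  fixes W (structure)
  assumes "complex_normed_space V" and "complex_banach_space W"
  shows "compact_operator V W T \<longleftrightarrow> linear_map V W T \<and>
    (\<forall>\<epsilon>>0. small_cover (unit_ball V) (\<lambda>x y. \<parallel>T x \<ominus> T y\<parallel> \<le> \<epsilon>))"
proof (cases "linear_map V W T")
  case True
  interpret V: complex_normed_space V by fact
  interpret W: complex_banach_space W by fact
  have cl: "T x \<in> car W" if "x \<in> unit_ball V" for x
    using that linear_map_closed[OF True] by (simp add: unit_ball_def)
  have "compact_operator V W T \<longleftrightarrow> W.metric.mtotally_bounded (T ` unit_ball V)"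
    unfolding compact_operator_def vtopology_def
      W.metric.mtotally_bounded_eq_compact_closure_of[OF W.complete]
    using True cl by blast
  also have "\<dots> \<longleftrightarrow> (\<forall>\<epsilon>>0. small_cover (unit_ball V) (\<lambda>x y. \<parallel>T x \<ominus> T y\<parallel> \<le> \<epsilon>))"
  proof (intro iffI allI impI)
    fix \<epsilon> :: real assume "W.metric.mtotally_bounded (T ` unit_ball V)" and \<epsilon>: "\<epsilon> > 0"
    then obtain K where K: "finite K" "K \<subseteq> T ` unit_ball V"
      "T ` unit_ball V \<subseteq> (\<Union>k \<in> K. W.metric.mball k (\<epsilon> / 2))"
      unfolding W.metric.mtotally_bounded_def by (meson half_gt_zero)
    have Kcl: "k \<in> car W" if "k \<in> K" for k
      using that K(2) cl by blast
    have "small_cover (unit_ball V)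
        (\<lambda>x y. \<exists>k \<in> K. \<parallel>T x \<ominus> k\<parallel> < \<epsilon> / 2 \<and> \<parallel>T y \<ominus> k\<parallel> < \<epsilon> / 2)"
    proof (rule small_cover_of_net[OF K(1)])
      fix x assume "x \<in> unit_ball V"
      then obtain k where "k \<in> K" "vdist W k (T x) < \<epsilon> / 2"
        using K(3) by auto
      then show "\<exists>k \<in> K. \<parallel>T x \<ominus> k\<parallel> < \<epsilon> / 2"
        using cl[OF \<open>x \<in> unit_ball V\<close>] Kcl by (auto simp: vdist_def W.norm_diff_commute)
    qed
    then show "small_cover (unit_ball V) (\<lambda>x y. \<parallel>T x \<ominus> T y\<parallel> \<le> \<epsilon>)"
    proof (rule small_cover_mono)
      fix x y assume "x \<in> unit_ball V" "y \<in> unit_ball V"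
        and "\<exists>k \<in> K. \<parallel>T x \<ominus> k\<parallel> < \<epsilon> / 2 \<and> \<parallel>T y \<ominus> k\<parallel> < \<epsilon> / 2"
      then show "\<parallel>T x \<ominus> T y\<parallel> \<le> \<epsilon>"
        using cl Kcl W.norm_diff_triangle W.norm_diff_commute by (smt (verit) field_sum_of_halves)
    qed
  next
    assume R: "\<forall>\<epsilon>>0. small_cover (unit_ball V) (\<lambda>x y. \<parallel>T x \<ominus> T y\<parallel> \<le> \<epsilon>)"
    show "W.metric.mtotally_bounded (T ` unit_ball V)"
      unfolding W.metric.mtotally_bounded_def
    proof (intro allI impI)
      fix \<epsilon> :: real assume "\<epsilon> > 0"
      then have "small_cover (unit_ball V) (\<lambda>x y. \<parallel>T x \<ominus> T y\<parallel> \<le> \<epsilon> / 2)"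
        using R half_gt_zero by blast
      then obtain F where F: "finite F" "F \<subseteq> unit_ball V"
        and net: "\<And>x. x \<in> unit_ball V \<Longrightarrow> \<exists>y \<in> F. \<parallel>T x \<ominus> T y\<parallel> \<le> \<epsilon> / 2"
        by (rule small_cover_net) (rule that, assumption+)
      have "\<exists>y \<in> F. T x \<in> W.metric.mball (T y) \<epsilon>" if x: "x \<in> unit_ball V" for x
      proof -
        obtain y where "y \<in> F" "\<parallel>T x \<ominus> T y\<parallel> \<le> \<epsilon> / 2"
          using net x by blast
        then show ?thesis
          using cl x F(2) \<open>\<epsilon> > 0\<close> W.norm_diff_commute[of "T x" "T y"]
          by (intro bexI[of _ y]) (auto simp: vdist_def subset_iff)
      qed
      then show "\<exists>K. finite K \<and> K \<subseteq> T ` unit_ball V \<and>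
          T ` unit_ball V \<subseteq> (\<Union>x \<in> K. W.metric.mball x \<epsilon>)"
        using F by (intro exI[of _ "T ` F"]) blast
    qed
  qed
  finally show ?thesis
    using True by simp
qed (simp add: compact_operator_def)

locale banach_space_pair = V: complex_normed_space V + W: complex_banach_space W
  for V :: "('a, 'm) normed_vs_scheme" and W :: "('b, 'n) normed_vs_scheme" (structure)
begin

sublocale normed_space_pair V W
  by unfold_locales

lemma compact_operatorI:
  assumes "linear_map V W T"
    and "\<And>\<epsilon>. \<epsilon> > 0 \<Longrightarrow> small_cover (unit_ball V) (\<lambda>x y. \<parallel>T x \<ominus> T y\<parallel> \<le> \<epsilon>)"
  shows "compact_operator V W T"
  using assms by (simp add: compact_operator_iff V.complex_normed_space_axioms
      W.complex_banach_space_axioms)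

lemma compact_operator_linear: "compact_operator V W T \<Longrightarrow> linear_map V W T"
  by (simp add: compact_operator_def)

lemma compact_operator_small_cover:
  "\<lbrakk>compact_operator V W T; \<epsilon> > 0\<rbrakk> \<Longrightarrow>
    small_cover (unit_ball V) (\<lambda>x y. \<parallel>T x \<ominus> T y\<parallel> \<le> \<epsilon>)"
  by (simp add: compact_operator_iff V.complex_normed_space_axioms W.complex_banach_space_axioms)

lemma compact_operator_bounded:
  assumes "compact_operator V W T"
  shows "bounded_linear_map V W T"
proof -
  note T = compact_operator_linear[OF assms]
  have cl: "T x \<in> car W" if "x \<in> unit_ball V" for x
    using that linear_map_closed[OF T] by (simp add: unit_ball_def)
  obtain F where F: "finite F" "F \<subseteq> unit_ball V"
    and net: "\<And>x. x \<in> unit_ball V \<Longrightarrow> \<exists>y \<in> F. \<parallel>T x \<ominus> T y\<parallel> \<le> 1"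
    using small_cover_net[OF compact_operator_small_cover[OF assms zero_less_one]] by auto
  have "\<parallel>T x\<parallel> \<le> (\<Sum>y \<in> F. \<parallel>T y\<parallel>) + 1" if x: "x \<in> unit_ball V" for x
  proof -
    obtain y where y: "y \<in> F" "\<parallel>T x \<ominus> T y\<parallel> \<le> 1"
      using net x by blast
    have "\<parallel>T y\<parallel> \<le> (\<Sum>y \<in> F. \<parallel>T y\<parallel>)"
      using F y(1) by (intro member_le_sum) (auto intro: W.norm_nonneg cl)
    then show ?thesis
      using y W.norm_le_add_norm_diff[of "T x" "T y"] cl x F(2) by fastforce
  qed
  then show ?thesis
    using T unfolding bounded_linear_map_iff_unit_ball by blast
qed

lemma compact_operator_cong:
  assumes "\<And>x. x \<in> car V \<Longrightarrow> S x = T x" "compact_operator V W S"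
  shows "compact_operator V W T"
proof (rule compact_operatorI)
  show "linear_map V W T"
    using assms bounded_linear_map_cong[of S T] compact_operator_bounded bounded_linear_map_linear
    by blast
  fix \<epsilon> :: real assume "\<epsilon> > 0"
  then show "small_cover (unit_ball V) (\<lambda>x y. \<parallel>T x \<ominus> T y\<parallel> \<le> \<epsilon>)"
    using small_cover_mono[OF compact_operator_small_cover[OF assms(2)]] assms(1)
    by (auto simp: unit_ball_def)
qed

lemma compact_operator_restrict [simp]:
  "compact_operator V W (restrict T (car V)) \<longleftrightarrow> compact_operator V W T"
  using compact_operator_cong[of T "restrict T (car V)"]
    compact_operator_cong[of "restrict T (car V)" T] by auto

lemma compact_operator_add:
  assumes "compact_operator V W S" "compact_operator V W T"
  shows "compact_operator V W (\<lambda>x. S x \<oplus> T x)"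
proof (rule compact_operatorI)
  have S: "bounded_linear_map V W S" and T: "bounded_linear_map V W T"
    using assms by (simp_all add: compact_operator_bounded)
  note cl = bounded_linear_map_closed[OF S] bounded_linear_map_closed[OF T]
  show "linear_map V W (\<lambda>x. S x \<oplus> T x)"
    by (rule bounded_linear_map_linear, rule bounded_linear_map_add[OF S T])
  fix \<epsilon> :: real assume "\<epsilon> > 0"
  then have "small_cover (unit_ball V) (\<lambda>x y. \<parallel>S x \<ominus> S y\<parallel> \<le> \<epsilon> / 2 \<and> \<parallel>T x \<ominus> T y\<parallel> \<le> \<epsilon> / 2)"
    by (intro small_cover_conj compact_operator_small_cover assms) auto
  then show "small_cover (unit_ball V) (\<lambda>x y. \<parallel>(S x \<oplus> T x) \<ominus> (S y \<oplus> T y)\<parallel> \<le> \<epsilon>)"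
  proof (rule small_cover_mono)
    fix x y assume x: "x \<in> unit_ball V" and y: "y \<in> unit_ball V"
      and *: "\<parallel>S x \<ominus> S y\<parallel> \<le> \<epsilon> / 2 \<and> \<parallel>T x \<ominus> T y\<parallel> \<le> \<epsilon> / 2"
    have "\<parallel>(S x \<oplus> T x) \<ominus> (S y \<oplus> T y)\<parallel> \<le> \<parallel>S x \<ominus> S y\<parallel> + \<parallel>T x \<ominus> T y\<parallel>"
      using x y by (simp add: unit_ball_def W.add_diff_add cl W.norm_triangle W.diff_closed)
    then show "\<parallel>(S x \<oplus> T x) \<ominus> (S y \<oplus> T y)\<parallel> \<le> \<epsilon>"
      using * by simp
  qed
qed

lemma compact_operator_limit:
  assumes T: "bounded_linear_map V W T"
    and approx: "\<And>\<epsilon>. \<epsilon> > 0 \<Longrightarrow> \<exists>S. compact_operator V W S \<and> opnorm V W (\<lambda>x. S x \<ominus> T x) \<le> \<epsilon>"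
  shows "compact_operator V W T"
proof (rule compact_operatorI[OF bounded_linear_map_linear[OF T]])
  fix \<epsilon> :: real assume "\<epsilon> > 0"
  then obtain S where S: "compact_operator V W S" and le: "opnorm V W (\<lambda>x. S x \<ominus> T x) \<le> \<epsilon> / 3"
    using approx[of "\<epsilon> / 3"] by auto
  note S_bl = compact_operator_bounded[OF S]
  have near: "\<parallel>S x \<ominus> T x\<parallel> \<le> \<epsilon> / 3" if "x \<in> unit_ball V" for x
    using opnorm_unit_ball[OF bounded_linear_map_diff[OF S_bl T] that] le by simp
  have "small_cover (unit_ball V) (\<lambda>x y. \<parallel>S x \<ominus> S y\<parallel> \<le> \<epsilon> / 3)"
    using S \<open>\<epsilon> > 0\<close> by (intro compact_operator_small_cover) auto
  then show "small_cover (unit_ball V) (\<lambda>x y. \<parallel>T x \<ominus> T y\<parallel> \<le> \<epsilon>)"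
  proof (rule small_cover_mono)
    fix x y assume x: "x \<in> unit_ball V" and y: "y \<in> unit_ball V" and *: "\<parallel>S x \<ominus> S y\<parallel> \<le> \<epsilon> / 3"
    then have cl: "S x \<in> car W" "S y \<in> car W" "T x \<in> car W" "T y \<in> car W"
      using bounded_linear_map_closed S_bl T by (auto simp: unit_ball_def)
    show "\<parallel>T x \<ominus> T y\<parallel> \<le> \<epsilon>"
      using W.norm_diff_triangle[OF cl(3,1,4)] W.norm_diff_triangle[OF cl(1,2,4)] near[OF x] near[OF y]
        W.norm_diff_commute[OF cl(1,3)] * by linarith
  qed
qed

end

lemma compact_operator_compose:
  assumes "complex_normed_space U" "complex_banach_space V" "complex_banach_space W"
    and S: "compact_operator U V S" and T: "bounded_linear_map V W T"
  shows "compact_operator U W (\<lambda>x. T (S x))"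
proof -
  interpret UV: banach_space_pair U V
    using assms by (simp add: banach_space_pair_def)
  interpret UW: banach_space_pair U W
    using assms by (simp add: banach_space_pair_def)
  interpret VW: banach_space_pair V W
    using assms by (simp add: banach_space_pair_def complex_banach_space.axioms(1))
  note S_lin = UV.compact_operator_linear[OF S] and T_lin = bounded_linear_map_linear[OF T]
  note cl = linear_map_closed[OF S_lin]
  show ?thesis
  proof (rule UW.compact_operatorI)
    show "linear_map U W (\<lambda>x. T (S x))"
      using S_lin T_lin unfolding linear_map_def by (auto simp: Pi_iff)
    fix \<epsilon> :: real assume \<epsilon>: "\<epsilon> > 0"
    define K where "K = opnorm V W T + 1"
    have K: "K > 0"
      using VW.opnorm_nonneg[OF T] by (simp add: K_def)
    have "small_cover (unit_ball U) (\<lambda>x y. \<parallel>S x \<ominus>\<^bsub>V\<^esub> S y\<parallel>\<^bsub>V\<^esub> \<le> \<epsilon> / K)"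
      using S \<epsilon> K by (intro UV.compact_operator_small_cover) auto
    then show "small_cover (unit_ball U) (\<lambda>x y. \<parallel>T (S x) \<ominus>\<^bsub>W\<^esub> T (S y)\<parallel>\<^bsub>W\<^esub> \<le> \<epsilon>)"
    proof (rule small_cover_mono)
      fix x y assume "x \<in> unit_ball U" "y \<in> unit_ball U" and *: "\<parallel>S x \<ominus>\<^bsub>V\<^esub> S y\<parallel>\<^bsub>V\<^esub> \<le> \<epsilon> / K"
      then have xy: "S x \<in> car V" "S y \<in> car V"
        using cl by (auto simp: unit_ball_def)
      have "\<parallel>T (S x) \<ominus>\<^bsub>W\<^esub> T (S y)\<parallel>\<^bsub>W\<^esub> = \<parallel>T (S x \<ominus>\<^bsub>V\<^esub> S y)\<parallel>\<^bsub>W\<^esub>"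
        by (simp add: VW.linear_map_diff[OF T_lin] xy)
      also have "\<dots> \<le> opnorm V W T * \<parallel>S x \<ominus>\<^bsub>V\<^esub> S y\<parallel>\<^bsub>V\<^esub>"
        by (rule VW.opnorm_bound[OF T UV.W.diff_closed[OF xy]])
      also have "\<dots> \<le> K * (\<epsilon> / K)"
        using * K VW.opnorm_nonneg[OF T] UV.W.norm_nonneg[OF UV.W.diff_closed[OF xy]]
        by (intro mult_mono) (auto simp: K_def)
      finally show "\<parallel>T (S x) \<ominus>\<^bsub>W\<^esub> T (S y)\<parallel>\<^bsub>W\<^esub> \<le> \<epsilon>"
        using K by simp
    qed
  qed
qed

lemma compact_operators_simps [simp]:
  "car (compact_operators V) = {T \<in> extensional (car V). compact_operator V V T}"
  "vzero (compact_operators V) = (\<lambda>x \<in> car V. \<zero>\<^bsub>V\<^esub>)"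
  "vadd (compact_operators V) = (\<lambda>S T. \<lambda>x \<in> car V. S x \<oplus>\<^bsub>V\<^esub> T x)"
  "vscale (compact_operators V) = (\<lambda>c T. \<lambda>x \<in> car V. c \<odot>\<^bsub>V\<^esub> T x)"
  "vnorm (compact_operators V) = opnorm V V"
  "vmult (compact_operators V) = compose (car V)"
  "vdiff (compact_operators V) = (\<lambda>S T. \<lambda>x \<in> car V. S x \<ominus>\<^bsub>V\<^esub> T x)"
  by (auto simp: compact_operators_def vdiff_def fun_eq_iff)

lemma complex_banach_algebra_compact_operators:
  fixes V :: "('a, 'm) normed_vs_scheme" (structure)
  assumes "complex_banach_space V"
  shows "complex_banach_algebra (compact_operators V)"
proof -
  let ?K = "compact_operators V" and ?O = "operator_space V V"
  interpret V: complex_banach_space V by fact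
  interpret P: banach_space_pair V V
    by unfold_locales
  interpret O: complex_banach_space "?O"
    by (rule complex_banach_space_operator_space) unfold_locales
  note bl = P.compact_operator_bounded
  note cl = bounded_linear_map_closed[OF bl]
  have sub: "T \<in> car (?O)" if "T \<in> car (?K)" for T
    using that bl by simp
  have zero: "compact_operator V V (\<lambda>x. \<zero>)"
    by (rule P.compact_operatorI)
      (auto simp: bounded_linear_map_linear[OF P.bounded_linear_map_zero] V.diff_self V.zero_closed
        small_cover_def intro!: exI[of _ "{unit_ball V}"])
  have scale: "compact_operator V V (\<lambda>x. c \<odot> T x)" if "compact_operator V V T" for c T
  proof (rule compact_operator_compose[OF _ _ _ that])
    have "bounded_linear_map V V (\<lambda>x. x)"
      by (auto simp: bounded_linear_map_def linear_map_def intro!: exI[of _ 1])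
    then show "bounded_linear_map V V (\<lambda>x. c \<odot> x)"
      by (rule P.bounded_linear_map_scale)
  qed unfold_locales
  have mult: "compact_operator V V (\<lambda>x. S (T x))"
    if "compact_operator V V S" "compact_operator V V T" for S T
    by (rule compact_operator_compose[OF _ _ _ that(2) bl[OF that(1)]]) unfold_locales
  have ops: "\<zero>\<^bsub>?K\<^esub> = \<zero>\<^bsub>?O\<^esub>" "(\<oplus>\<^bsub>?K\<^esub>) = (\<oplus>\<^bsub>?O\<^esub>)" "(\<odot>\<^bsub>?K\<^esub>) = (\<odot>\<^bsub>?O\<^esub>)"
    "vnorm (?K) = vnorm (?O)"
    by (simp_all add: compact_operators_def)
  interpret K: complex_normed_space ?K
  proof (rule O.complex_normed_space_subspace[OF _ ops])
    show "car ?K \<subseteq> car ?O"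
      using sub by blast
  qed (simp_all add: zero scale P.compact_operator_add)
  show ?thesis
  proof
    show "K.metric.mcomplete"
      unfolding K.mcomplete_iff
    proof (intro allI impI, elim conjE)
      fix \<sigma> :: "nat \<Rightarrow> _"
      assume \<sigma>: "range \<sigma> \<subseteq> car (?K)"
        and C: "\<forall>\<epsilon>>0. \<exists>N. \<forall>m n. N \<le> m \<longrightarrow> N \<le> n \<longrightarrow>
          \<parallel>\<sigma> m \<ominus>\<^bsub>?K\<^esub> \<sigma> n\<parallel>\<^bsub>?K\<^esub> < \<epsilon>"
      have range: "range \<sigma> \<subseteq> car (?O)"
        using \<sigma> sub by blast
      obtain T where T: "T \<in> car (?O)"
        "(\<lambda>n. \<parallel>\<sigma> n \<ominus>\<^bsub>?O\<^esub> T\<parallel>\<^bsub>?O\<^esub>) \<longlonglongrightarrow> 0"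
        by (rule O.complete_sequence[OF range]) (use C in auto)
      have "compact_operator V V T"
      proof (rule P.compact_operator_limit)
        fix \<epsilon> :: real assume "\<epsilon> > 0"
        then obtain n where
          "norm (\<parallel>\<sigma> n \<ominus>\<^bsub>?O\<^esub> T\<parallel>\<^bsub>?O\<^esub> - 0) < \<epsilon>"
          using LIMSEQ_D[OF T(2)] by blast
        then show "\<exists>S. compact_operator V V S \<and> opnorm V V (\<lambda>x. S x \<ominus> T x) \<le> \<epsilon>"
          using \<sigma> by (intro exI[of _ "\<sigma> n"]) auto
      qed (use T in simp)
      then show "\<exists>T \<in> car (?K).
          (\<lambda>n. \<parallel>\<sigma> n \<ominus>\<^bsub>?K\<^esub> T\<parallel>\<^bsub>?K\<^esub>) \<longlonglongrightarrow> 0"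
        using T by auto
    qed
  next
    fix S T assume ST: "S \<in> car (?K)" "T \<in> car (?K)"
    have S: "bounded_linear_map V V S" and T: "bounded_linear_map V V T"
      using ST bl by auto
    have "\<parallel>S (T x)\<parallel> \<le> opnorm V V S * opnorm V V T" if x: "x \<in> unit_ball V" for x
    proof -
      have "\<parallel>S (T x)\<parallel> \<le> opnorm V V S * \<parallel>T x\<parallel>"
        using P.opnorm_bound[OF S] bounded_linear_map_closed[OF T] x by (simp add: unit_ball_def)
      also have "\<dots> \<le> opnorm V V S * opnorm V V T"
        by (intro mult_left_mono P.opnorm_unit_ball[OF T x] P.opnorm_nonneg[OF S])
      finally show ?thesis .
    qed
    then have "opnorm V V (\<lambda>x. S (T x)) \<le> opnorm V V S * opnorm V V T"
      by (rule P.opnorm_le)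
    then show "\<parallel>S \<otimes>\<^bsub>?K\<^esub> T\<parallel>\<^bsub>?K\<^esub>
        \<le> \<parallel>S\<parallel>\<^bsub>?K\<^esub> * \<parallel>T\<parallel>\<^bsub>?K\<^esub>"
      by (simp add: compose_def)
  qed (auto simp: compose_def mult fun_eq_iff cl linear_map_add[OF P.compact_operator_linear]
      linear_map_scale[OF P.compact_operator_linear])
qed

section \<open>Amenability\<close>

lemma amenableD:
  assumes "amenable TYPE('z) A" and "banach_bimodule A (Z :: 'z normed_vs) lact ract"
    and "continuous_dual_derivation A Z lact ract D"
  obtains \<phi> where "\<phi> \<in> car (dual Z)"
    "\<And>a z. \<lbrakk>a \<in> car A; z \<in> car Z\<rbrakk> \<Longrightarrow> D a z = \<phi> (ract z a) - \<phi> (lact a z)"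
proof -
  have "inner_dual_derivation A Z lact ract D"
    using assms unfolding amenable_def by blast
  then obtain \<phi> where "\<phi> \<in> car (dual Z)"
    and "\<And>a. a \<in> car A \<Longrightarrow> D a = dual_lact Z ract a \<phi> \<ominus>\<^bsub>dual Z\<^esub> dual_ract Z lact \<phi> a"
    unfolding inner_dual_derivation_def by blast
  then show ?thesis
    using that by (simp add: dual_lact_def dual_ract_def)
qed

definition transport_vs :: "('w \<Rightarrow> 'u) \<Rightarrow> 'w normed_vs \<Rightarrow> 'u normed_vs"
  where "transport_vs \<iota> Z =
    \<lparr>car = \<iota> ` car Z, vzero = \<iota> (vzero Z),
     vadd = (\<lambda>x y. \<iota> (vadd Z (inv \<iota> x) (inv \<iota> y))),
     vscale = (\<lambda>c x. \<iota> (vscale Z c (inv \<iota> x))),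
     vnorm = (\<lambda>x. vnorm Z (inv \<iota> x))\<rparr>"

lemma complex_banach_space_transport:
  assumes \<iota>: "inj \<iota>" and "complex_banach_space Z"
  shows "complex_banach_space (transport_vs \<iota> Z)"
proof -
  let ?T = "transport_vs \<iota> Z"
  interpret Z: complex_banach_space Z by fact
  interpret T: complex_normed_space "?T"
  proof
    fix x assume "x \<in> car (?T)"
    then obtain z where z: "z \<in> car Z" "x = \<iota> z"
      by (auto simp: transport_vs_def)
    then show "\<exists>y \<in> car (?T). x \<oplus>\<^bsub>?T\<^esub> y = \<zero>\<^bsub>?T\<^esub>"
      using Z.add_inverse[OF z(1)] \<iota> by (auto simp: transport_vs_def inj_eq)
  qed (use \<iota> in \<open>auto simp: transport_vs_def inj_eq Z.zero_closed Z.add_closed Z.scale_closed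
      Z.add_assoc Z.add_zero Z.scale_add Z.add_scale Z.scale_scale Z.scale_one
      Z.norm_definite Z.norm_triangle Z.norm_scale intro: Z.add_comm\<close>)
  have diff: "\<parallel>\<iota> x \<ominus>\<^bsub>?T\<^esub> \<iota> y\<parallel>\<^bsub>?T\<^esub> = \<parallel>x \<ominus>\<^bsub>Z\<^esub> y\<parallel>\<^bsub>Z\<^esub>" for x y
    using \<iota> by (simp add: transport_vs_def vdiff_def)
  show ?thesis
  proof
    show "T.metric.mcomplete"
      unfolding T.mcomplete_iff
    proof (intro allI impI, elim conjE)
      fix \<sigma> :: "nat \<Rightarrow> _"
      assume \<sigma>: "range \<sigma> \<subseteq> car (?T)"
        and C: "\<forall>\<epsilon>>0. \<exists>N. \<forall>m n. N \<le> m \<longrightarrow> N \<le> n \<longrightarrow>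
          \<parallel>\<sigma> m \<ominus>\<^bsub>?T\<^esub> \<sigma> n\<parallel>\<^bsub>?T\<^esub> < \<epsilon>"
      have "\<forall>n. \<exists>z. z \<in> car Z \<and> \<sigma> n = \<iota> z"
        using \<sigma> by (auto simp: transport_vs_def)
      then obtain \<tau> where \<tau>: "\<And>n. \<tau> n \<in> car Z" "\<And>n. \<sigma> n = \<iota> (\<tau> n)"
        by metis
      obtain z where "z \<in> car Z" "(\<lambda>n. \<parallel>\<tau> n \<ominus>\<^bsub>Z\<^esub> z\<parallel>\<^bsub>Z\<^esub>) \<longlonglongrightarrow> 0"
        by (rule Z.complete_sequence[of \<tau>]) (use \<tau> C diff in auto)
      then show "\<exists>x \<in> car (?T).
          (\<lambda>n. \<parallel>\<sigma> n \<ominus>\<^bsub>?T\<^esub> x\<parallel>\<^bsub>?T\<^esub>) \<longlonglongrightarrow> 0"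
        using \<tau>(2) diff by (intro bexI[of _ "\<iota> z"]) (auto simp: transport_vs_def)
    qed
  qed
qed

text \<open>Amenability at a type passes to every type that embeds into it: transport the bimodules.\<close>

lemma amenable_transfer:
  fixes \<iota> :: "'w \<Rightarrow> 'u"
  assumes \<iota>: "inj \<iota>" and amenable: "amenable TYPE('u) A"
  shows "amenable TYPE('w) A"
  unfolding amenable_def
proof (intro conjI allI impI, goal_cases)
  case 1
  then show ?case
    using amenable by (simp add: amenable_def)
next
  case (2 Z lact ract D)
  then interpret Z: banach_bimodule A Z lact ract
    by blast
  have D: "continuous_dual_derivation A Z lact ract D"
    using 2 by blast
  then have D_lin: "linear_map A (dual Z) D"
    by (simp add: continuous_dual_derivation_def bounded_linear_map_def)
  have D_cl: "D a \<in> car (dual Z)" if "a \<in> car A" for a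
    using linear_map_closed[OF D_lin that] .
  let ?Z = "transport_vs \<iota> Z"
  let ?lact = "\<lambda>a x. \<iota> (lact a (inv \<iota> x))" and ?ract = "\<lambda>x a. \<iota> (ract (inv \<iota> x) a)"
  let ?D = "\<lambda>a. \<lambda>x \<in> car ?Z. D a (inv \<iota> x)"
  have [simp]: "inv \<iota> (\<iota> z) = z" for z
    using \<iota> by simp
  interpret T: complex_banach_space ?Z
    by (rule complex_banach_space_transport[OF \<iota>]) unfold_locales
  have car: "car ?Z = \<iota> ` car Z" "vadd ?Z = (\<lambda>x y. \<iota> (vadd Z (inv \<iota> x) (inv \<iota> y)))"
    "vscale ?Z = (\<lambda>c x. \<iota> (vscale Z c (inv \<iota> x)))" "vnorm ?Z = (\<lambda>x. vnorm Z (inv \<iota> x))"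
    by (simp_all add: transport_vs_def)
  have "banach_bimodule A ?Z ?lact ?ract"
  proof
    show "\<exists>K. \<forall>a \<in> car A. \<forall>z \<in> car ?Z. \<parallel>?lact a z\<parallel>\<^bsub>?Z\<^esub> \<le> K * \<parallel>a\<parallel>\<^bsub>A\<^esub> * \<parallel>z\<parallel>\<^bsub>?Z\<^esub>"
      using Z.lact_bounded by (simp add: car)
    show "\<exists>K. \<forall>a \<in> car A. \<forall>z \<in> car ?Z. \<parallel>?ract z a\<parallel>\<^bsub>?Z\<^esub> \<le> K * \<parallel>a\<parallel>\<^bsub>A\<^esub> * \<parallel>z\<parallel>\<^bsub>?Z\<^esub>"
      using Z.ract_bounded by (simp add: car)
  qed (auto simp: car Z.lact_closed Z.ract_closed Z.lact_add_left Z.lact_add_right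
      Z.lact_scale_left Z.lact_scale_right Z.ract_add_left Z.ract_add_right Z.ract_scale_left
      Z.ract_scale_right Z.lact_mult Z.ract_mult Z.lact_ract)
  moreover have "continuous_dual_derivation A ?Z ?lact ?ract ?D"
    unfolding continuous_dual_derivation_def
  proof (intro conjI ballI)
    have opn: "opnorm ?Z complex_line (\<lambda>x. f (inv \<iota> x)) = opnorm Z complex_line f" for f
    proof -
      have "unit_ball ?Z = \<iota> ` unit_ball Z"
        by (auto simp: unit_ball_def car)
      then show ?thesis
        by (simp add: opnorm_def image_image)
    qed
    have bl: "bounded_linear_map ?Z complex_line (\<lambda>x. f (inv \<iota> x))"
      if "bounded_linear_map Z complex_line f" for f
      using that unfolding bounded_linear_map_def linear_map_def
      by (simp add: car Z.Z.add_closed Z.Z.scale_closed)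
    have "linear_map A (dual ?Z) ?D"
    proof (rule linear_mapI)
      fix a assume "a \<in> car A"
      then show "?D a \<in> car (dual ?Z)"
        using bl D_cl by (simp add: T.functional.bounded_linear_map_restrict)
    next
      fix a b assume "a \<in> car A" "b \<in> car A"
      then show "?D (a \<oplus>\<^bsub>A\<^esub> b) = ?D a \<oplus>\<^bsub>dual ?Z\<^esub> ?D b"
        by (auto simp: linear_map_add[OF D_lin] fun_eq_iff car)
    next
      fix c a assume "a \<in> car A"
      then show "?D (c \<odot>\<^bsub>A\<^esub> a) = c \<odot>\<^bsub>dual ?Z\<^esub> ?D a"
        by (auto simp: linear_map_scale[OF D_lin] fun_eq_iff car)
    qed
    moreover have "\<exists>K. \<forall>a \<in> car A. \<parallel>?D a\<parallel>\<^bsub>dual ?Z\<^esub> \<le> K * \<parallel>a\<parallel>\<^bsub>A\<^esub>"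
      using D by (simp add: opn continuous_dual_derivation_def bounded_linear_map_def)
    ultimately show "bounded_linear_map A (dual ?Z) ?D"
      by (simp add: bounded_linear_map_def)
    fix a b assume a: "a \<in> car A" and b: "b \<in> car A"
    then have "D (a \<otimes>\<^bsub>A\<^esub> b) = dual_lact Z ract a (D b) \<oplus>\<^bsub>dual Z\<^esub> dual_ract Z lact (D a) b"
      using D by (simp add: continuous_dual_derivation_def)
    then show "?D (a \<otimes>\<^bsub>A\<^esub> b) = dual_lact ?Z ?ract a (?D b) \<oplus>\<^bsub>dual ?Z\<^esub> dual_ract ?Z ?lact (?D a) b"
      using a b by (auto simp: fun_eq_iff car dual_lact_def dual_ract_def Z.lact_closed Z.ract_closed)
  qed
  ultimately obtain \<phi> where \<phi>: "\<phi> \<in> car (dual ?Z)"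
    and eq: "\<And>a x. \<lbrakk>a \<in> car A; x \<in> car ?Z\<rbrakk> \<Longrightarrow> ?D a x = \<phi> (?ract x a) - \<phi> (?lact a x)"
    using amenableD[OF amenable] by blast
  have eq': "D a z = \<phi> (\<iota> (ract z a)) - \<phi> (\<iota> (lact a z))" if "a \<in> car A" "z \<in> car Z" for a z
    using eq[of a "\<iota> z"] that by (simp add: car)
  show ?case
    unfolding inner_dual_derivation_def
  proof (intro bexI[of _ "\<lambda>z \<in> car Z. \<phi> (\<iota> z)"] ballI)
    fix a assume a: "a \<in> car A"
    show "D a = dual_lact Z ract a (\<lambda>z \<in> car Z. \<phi> (\<iota> z))
        \<ominus>\<^bsub>dual Z\<^esub> dual_ract Z lact (\<lambda>z \<in> car Z. \<phi> (\<iota> z)) a"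
      by (rule extensionalityI[of _ "car Z"])
        (use D_cl a in \<open>auto simp: dual_lact_def dual_ract_def eq' Z.lact_closed Z.ract_closed\<close>)
  next
    have "bounded_linear_map Z complex_line (\<lambda>z. \<phi> (\<iota> z))"
      using \<phi> unfolding dual_simps bounded_linear_map_def linear_map_def by (simp add: car)
    then show "(\<lambda>z \<in> car Z. \<phi> (\<iota> z)) \<in> car (dual Z)"
      by simp
  qed
qed

text \<open>
  An amenable algebra has bounded approximate units on the right.  Let \<open>A\<close> act on its dual trivially
  from the left.  Then the canonical embedding into the bidual is a derivation, and an element \<open>E\<close> of
  the bidual that makes it inner satisfies \<open>E (f \<cdot> a) = f a\<close>: it is a right identity for \<open>A\<close> in a weak
  sense.  If no \<open>u\<close> with \<open>\<parallel>u\<parallel> \<le> \<parallel>E\<parallel> + 1\<close> brought \<open>v u\<close> close to \<open>v\<close>, the Hahn--Banach theorem would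
  separate \<open>v\<close> from these products by a functional contradicting the norm of \<open>E\<close>.
\<close>

lemma amenable_bounded_approximate_units:
  fixes A :: "('a, 'm) normed_alg_scheme" (structure)
  assumes amenable: "amenable TYPE('a \<Rightarrow> complex) A"
  obtains M where
    "\<And>v \<epsilon>. \<lbrakk>v \<in> car A; \<epsilon> > 0\<rbrakk> \<Longrightarrow> \<exists>u \<in> car A. \<parallel>u\<parallel> \<le> M \<and> \<parallel>v \<ominus> v \<otimes> u\<parallel> < \<epsilon>"
proof -
  interpret A: complex_banach_algebra A
    using amenable by (simp add: amenable_def)
  interpret dA: complex_banach_space "dual A"
    by (rule complex_banach_space_dual) unfold_locales
  interpret ddA: complex_banach_space "dual (dual A)"
    by (rule complex_banach_space_dual) unfold_locales
  have shift: "bounded_linear_map A complex_line (\<lambda>b. f (a \<otimes> b))"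
    "opnorm A complex_line (\<lambda>b. f (a \<otimes> b)) \<le> opnorm A complex_line f * \<parallel>a\<parallel>"
    if f: "bounded_linear_map A complex_line f" and a: "a \<in> car A" for f a
  proof -
    have le: "cmod (f (a \<otimes> b)) \<le> opnorm A complex_line f * \<parallel>a\<parallel> * \<parallel>b\<parallel>" if b: "b \<in> car A" for b
    proof -
      have "cmod (f (a \<otimes> b)) \<le> opnorm A complex_line f * \<parallel>a \<otimes> b\<parallel>"
        using A.functional.opnorm_bound[OF f A.mult_closed[OF a b]] by simp
      also have "\<dots> \<le> opnorm A complex_line f * (\<parallel>a\<parallel> * \<parallel>b\<parallel>)"
        by (intro mult_left_mono A.norm_mult_le a b A.functional.opnorm_nonneg f)
      finally show ?thesis
        by (simp add: mult.assoc)
    qed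
    note f_lin = bounded_linear_map_linear[OF f]
    have "linear_map A complex_line (\<lambda>b. f (a \<otimes> b))"
      using a linear_map_add[OF f_lin] linear_map_scale[OF f_lin]
      by (intro linear_mapI) (simp_all add: A.mult_add_right A.mult_scale_right A.mult_closed)
    then show "bounded_linear_map A complex_line (\<lambda>b. f (a \<otimes> b))"
      unfolding bounded_linear_map_def using le by auto
    show "opnorm A complex_line (\<lambda>b. f (a \<otimes> b)) \<le> opnorm A complex_line f * \<parallel>a\<parallel>"
      using le by (intro A.functional.opnorm_le_bound)
        (auto intro!: mult_nonneg_nonneg A.functional.opnorm_nonneg f A.norm_nonneg a)
  qed
  let ?lact = "\<lambda>a f. \<zero>\<^bsub>dual A\<^esub>" and ?ract = "\<lambda>f a. \<lambda>b \<in> car A. f (a \<otimes> b)"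
  let ?D = "\<lambda>a. \<lambda>f \<in> car (dual A). f a"
  have bimodule: "banach_bimodule A (dual A) ?lact ?ract"
  proof
    fix a assume "a \<in> car A"
    fix b assume "b \<in> car A"
    fix f assume "f \<in> car (dual A)"
    show "?ract f (a \<oplus> b) = ?ract f a \<oplus>\<^bsub>dual A\<^esub> ?ract f b"
      using \<open>a \<in> car A\<close> \<open>b \<in> car A\<close> \<open>f \<in> car (dual A)\<close>
      by (auto simp: fun_eq_iff A.mult_add_left A.mult_closed 
          linear_map_add[OF bounded_linear_map_linear])
    show "?ract f (a \<otimes> b) = ?ract (?ract f a) b"
      using \<open>a \<in> car A\<close> \<open>b \<in> car A\<close> by (auto simp: fun_eq_iff A.mult_assoc A.mult_closed)
    show "?ract (?lact a f) b = ?lact a (?ract f b)"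
      using \<open>b \<in> car A\<close> by (auto simp: fun_eq_iff A.mult_closed)
  next
    fix a f c assume "a \<in> car A" "f \<in> car (dual A)"
    then show "?ract f (c \<odot> a) = c \<odot>\<^bsub>dual A\<^esub> ?ract f a"
      by (auto simp: fun_eq_iff A.mult_scale_left A.mult_closed
          linear_map_scale[OF bounded_linear_map_linear])
    show "?ract f a \<in> car (dual A)"
      using \<open>a \<in> car A\<close> \<open>f \<in> car (dual A)\<close> by (simp add: shift)
    show "?ract (c \<odot>\<^bsub>dual A\<^esub> f) a = c \<odot>\<^bsub>dual A\<^esub> ?ract f a"
      using \<open>a \<in> car A\<close> by (auto simp: fun_eq_iff A.mult_closed)
  next
    fix a f g assume "a \<in> car A" "f \<in> car (dual A)" "g \<in> car (dual A)"
    then show "?ract (f \<oplus>\<^bsub>dual A\<^esub> g) a = ?ract f a \<oplus>\<^bsub>dual A\<^esub> ?ract g a"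
      by (auto simp: fun_eq_iff A.mult_closed)
  next
    show "\<exists>K. \<forall>a \<in> car A. \<forall>f \<in> car (dual A). \<parallel>?ract f a\<parallel>\<^bsub>dual A\<^esub> \<le> K * \<parallel>a\<parallel> * \<parallel>f\<parallel>\<^bsub>dual A\<^esub>"
      using shift(2) by (intro exI[of _ 1]) (simp add: mult.commute)
    show "\<exists>K. \<forall>a \<in> car A. \<forall>f \<in> car (dual A). \<parallel>?lact a f\<parallel>\<^bsub>dual A\<^esub> \<le> K * \<parallel>a\<parallel> * \<parallel>f\<parallel>\<^bsub>dual A\<^esub>"
      by (intro exI[of _ 0]) (simp add: dA.norm_zero del: dual_simps)
  qed (auto simp only: dA.zero_closed dA.add_zero dA.scale_zero_right)
  have D_cl: "?D a \<in> car (dual (dual A))" and D_norm: "opnorm (dual A) complex_line (?D a) \<le> 1 * \<parallel>a\<parallel>"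
    if a: "a \<in> car A" for a
  proof -
    have le: "cmod (f a) \<le> \<parallel>a\<parallel> * \<parallel>f\<parallel>\<^bsub>dual A\<^esub>" if "f \<in> car (dual A)" for f
      using A.functional.opnorm_bound[of f a] that a by (simp add: mult.commute)
    have "linear_map (dual A) complex_line (\<lambda>f. f a)"
      by (rule linear_mapI) (use a in auto)
    then show "?D a \<in> car (dual (dual A))"
      using le dA.functional.bounded_linear_map_restrict[of "\<lambda>f. f a"]
      unfolding dual_simps(1)[of "dual A"] bounded_linear_map_def by auto
    show "opnorm (dual A) complex_line (?D a) \<le> 1 * \<parallel>a\<parallel>"
      unfolding dA.functional.opnorm_restrict
      using le A.norm_nonneg[OF a] by (intro dA.functional.opnorm_le_bound) auto
  qed
  have "continuous_dual_derivation A (dual A) ?lact ?ract ?D"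
    unfolding continuous_dual_derivation_def
  proof (intro conjI ballI)
    have "linear_map A (dual (dual A)) ?D"
    proof (rule linear_mapI)
      fix a b assume "a \<in> car A" "b \<in> car A"
      then show "?D (a \<oplus> b) = ?D a \<oplus>\<^bsub>dual (dual A)\<^esub> ?D b"
        by (auto simp: fun_eq_iff linear_map_add[OF bounded_linear_map_linear])
    next
      fix c a assume "a \<in> car A"
      then show "?D (c \<odot> a) = c \<odot>\<^bsub>dual (dual A)\<^esub> ?D a"
        by (auto simp: fun_eq_iff linear_map_scale[OF bounded_linear_map_linear])
    qed (rule D_cl)
    then show "bounded_linear_map A (dual (dual A)) ?D"
      unfolding bounded_linear_map_def dual_simps(5) using D_norm by blast
    fix a b assume ab: "a \<in> car A" "b \<in> car A"
    have "?D a \<zero>\<^bsub>dual A\<^esub> = 0"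
      using dA.functional.linear_map_zero[OF bounded_linear_map_linear, of "?D a"] D_cl[OF ab(1)] by simp
    then show "?D (a \<otimes> b) = dual_lact (dual A) ?ract a (?D b) \<oplus>\<^bsub>dual (dual A)\<^esub>
        dual_ract (dual A) ?lact (?D a) b"
      using ab shift by (auto simp: fun_eq_iff dual_lact_def dual_ract_def)
  qed
  then obtain E where E: "E \<in> car (dual (dual A))"
    and eq: "\<And>a f. \<lbrakk>a \<in> car A; f \<in> car (dual A)\<rbrakk> \<Longrightarrow> ?D a f = E (?ract f a) - E \<zero>\<^bsub>dual A\<^esub>"
    using amenableD[OF amenable bimodule] by blast
  have E_bl: "bounded_linear_map (dual A) complex_line E"
    using E by simp
  have "E \<zero>\<^bsub>dual A\<^esub> = 0"
    using dA.functional.linear_map_zero[OF bounded_linear_map_linear[OF E_bl]] by simp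
  with eq have eq: "E (\<lambda>b \<in> car A. f (a \<otimes> b)) = f a"
    if "a \<in> car A" "bounded_linear_map A complex_line f" "f \<in> extensional (car A)" for a f
    using that by simp
  define M where "M = opnorm (dual A) complex_line E + 1"
  have E_nonneg: "0 \<le> opnorm (dual A) complex_line E"
    by (rule dA.functional.opnorm_nonneg[OF E_bl])
  interpret AA: normed_space_pair A A
    by unfold_locales
  show ?thesis
  proof (rule that[of M], rule ccontr)
    fix v and \<epsilon> :: real assume v: "v \<in> car A" and \<epsilon>: "\<epsilon> > 0"
    assume no: "\<not> (\<exists>u \<in> car A. \<parallel>u\<parallel> \<le> M \<and> \<parallel>v \<ominus> v \<otimes> u\<parallel> < \<epsilon>)"
    have M: "M > 0"
      using E_nonneg by (simp add: M_def)
    have far: "1 \<le> 1 / \<epsilon> * \<parallel>v \<ominus> v \<otimes> u\<parallel> + 1 / M * \<parallel>u\<parallel>" if u: "u \<in> car A" for u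
    proof (cases "\<parallel>u\<parallel> \<le> M")
      case True
      then have "\<epsilon> \<le> \<parallel>v \<ominus> v \<otimes> u\<parallel>"
        using no u by force
      then have "1 \<le> 1 / \<epsilon> * \<parallel>v \<ominus> v \<otimes> u\<parallel>"
        using \<epsilon> by (simp add: field_simps)
      moreover have "0 \<le> 1 / M * \<parallel>u\<parallel>"
        using M A.norm_nonneg[OF u] by simp
      ultimately show ?thesis
        by simp
    next
      case False
      then have "1 \<le> 1 / M * \<parallel>u\<parallel>"
        using M by (simp add: field_simps)
      moreover have "0 \<le> 1 / \<epsilon> * \<parallel>v \<ominus> v \<otimes> u\<parallel>"
        using \<epsilon> A.norm_nonneg[OF A.diff_closed[OF v A.mult_closed[OF v u]]] by simp
      ultimately show ?thesis
        by simp
    qed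
    have "linear_map A A (\<lambda>u. v \<otimes> u)"
      by (rule linear_mapI) (simp_all add: v A.mult_closed A.mult_add_right A.mult_scale_right)
    then obtain \<psi> where \<psi>: "linear_map A complex_line \<psi>"
      and \<psi>_le: "\<And>z. z \<in> car A \<Longrightarrow> cmod (\<psi> z) \<le> 1 / \<epsilon> * \<parallel>z\<parallel>"
      and \<psi>_v: "\<And>u. u \<in> car A \<Longrightarrow> cmod (\<psi> (v \<otimes> u)) \<le> 1 / M * \<parallel>u\<parallel>" and ge: "1 \<le> cmod (\<psi> v)"
      using AA.hahn_banach_distance[of "\<lambda>u. v \<otimes> u" v "1 / \<epsilon>" "1 / M" 1] v \<epsilon> M far
      by (metis less_eq_real_def zero_less_divide_1_iff)
    have "bounded_linear_map A complex_line \<psi>"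
      unfolding bounded_linear_map_def complex_line_simps using \<psi> \<psi>_le by blast
    then have bl: "bounded_linear_map A complex_line (restrict \<psi> (car A))"
      by simp
    let ?f = "\<lambda>b \<in> car A. restrict \<psi> (car A) (v \<otimes> b)"
    have f: "?f \<in> car (dual A)"
      using shift(1)[OF bl v] by simp
    have "E ?f = \<psi> v"
      using eq[OF v bl] v by simp
    then have "cmod (\<psi> v) \<le> opnorm (dual A) complex_line E * opnorm A complex_line ?f"
      using dA.functional.opnorm_bound[OF E_bl f] unfolding complex_line_simps dual_simps by simp
    also have "\<dots> \<le> opnorm (dual A) complex_line E * (1 / M)"
      using \<psi>_v M v by (intro mult_left_mono[OF _ E_nonneg] A.functional.opnorm_le_bound)
        (auto simp: A.mult_closed)
    also have "\<dots> < 1"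
      using M by (simp add: M_def)
    finally show False
      using ge by simp
  qed
qed

section \<open>Adjoints of compact operators\<close>

definition adjoint_op :: "('a, 'm) normed_vs_scheme \<Rightarrow> ('a \<Rightarrow> 'a) \<Rightarrow> ('a \<Rightarrow> complex) \<Rightarrow> ('a \<Rightarrow> complex)"
  where "adjoint_op V T = (\<lambda>f \<in> car (dual V). \<lambda>x \<in> car V. f (T x))"

lemma adjoint_apply: "\<lbrakk>f \<in> car (dual V); x \<in> car V\<rbrakk> \<Longrightarrow> adjoint_op V T f x = f (T x)"
  unfolding adjoint_op_def by (simp only: restrict_apply' if_True)

context complex_normed_space
begin

lemma dual_linear: "f \<in> car (dual V) \<Longrightarrow> linear_map V complex_line f"
  by (simp add: bounded_linear_map_linear)

lemma
  assumes "f \<in> car (dual V)"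
  shows dual_add: "\<lbrakk>x \<in> car V; y \<in> car V\<rbrakk> \<Longrightarrow> f (x \<oplus> y) = f x + f y"
    and dual_scale: "x \<in> car V \<Longrightarrow> f (c \<odot> x) = c * f x"
    and dual_zero: "f \<zero> = 0"
    and dual_diff: "\<lbrakk>x \<in> car V; y \<in> car V\<rbrakk> \<Longrightarrow> f (x \<ominus> y) = f x - f y"
  using dual_linear[OF assms] functional.linear_map_zero functional.linear_map_diff
  by (simp_all add: linear_map_add linear_map_scale)

lemma dual_bound: "\<lbrakk>f \<in> car (dual V); x \<in> car V\<rbrakk> \<Longrightarrow> cmod (f x) \<le> \<parallel>f\<parallel>\<^bsub>dual V\<^esub> * \<parallel>x\<parallel>"
  using functional.opnorm_bound[of f x] by simp

lemma dual_bound_unit_ball: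
  assumes f: "f \<in> car (dual V)" and x: "x \<in> unit_ball V"
  shows "cmod (f x) \<le> \<parallel>f\<parallel>\<^bsub>dual V\<^esub>"
  using functional.opnorm_unit_ball[of f x] assms by simp

lemma dual_norm_le:
  assumes "\<And>x. x \<in> unit_ball V \<Longrightarrow> cmod (f x) \<le> K"
  shows "\<parallel>f\<parallel>\<^bsub>dual V\<^esub> \<le> K"
  using functional.opnorm_le[of f K] assms by simp

lemma dual_norm_nonneg: "f \<in> car (dual V) \<Longrightarrow> 0 \<le> \<parallel>f\<parallel>\<^bsub>dual V\<^esub>"
  by (simp add: functional.opnorm_nonneg)

lemma dualI:
  assumes "linear_map V complex_line f" "f \<in> extensional (car V)"
    and "\<And>x. x \<in> car V \<Longrightarrow> cmod (f x) \<le> K * \<parallel>x\<parallel>"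
  shows "f \<in> car (dual V)"
  using assms by (auto simp: bounded_linear_map_def)

end

context complex_banach_space
begin

interpretation dV: complex_banach_space "dual V"
  by (rule complex_banach_space_dual) unfold_locales

interpretation VV: banach_space_pair V V
  by unfold_locales

interpretation dVdV: banach_space_pair "dual V" "dual V"
  by unfold_locales

lemma adjoint_closed:
  assumes T: "bounded_linear_map V V T" and f: "f \<in> car (dual V)"
  shows "adjoint_op V T f \<in> car (dual V)"
proof (rule dualI)
  note T_lin = bounded_linear_map_linear[OF T]
  note cl = linear_map_closed[OF T_lin]
  show "linear_map V complex_line (adjoint_op V T f)"
    by (rule linear_mapI)
      (simp_all add: adjoint_apply[OF f] add_closed scale_closed linear_map_add[OF T_lin] dual_add[OF f]
        linear_map_scale[OF T_lin] dual_scale[OF f] cl del: dual_simps)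
  show "adjoint_op V T f \<in> extensional (car V)"
    using f unfolding adjoint_op_def by (simp del: dual_simps)
  fix x assume x: "x \<in> car V"
  have "cmod (f (T x)) \<le> \<parallel>f\<parallel>\<^bsub>dual V\<^esub> * \<parallel>T x\<parallel>"
    by (rule dual_bound[OF f cl[OF x]])
  also have "\<dots> \<le> \<parallel>f\<parallel>\<^bsub>dual V\<^esub> * (opnorm V V T * \<parallel>x\<parallel>)"
    by (intro mult_left_mono VV.opnorm_bound T x dV.norm_nonneg f)
  finally show "cmod (adjoint_op V T f x) \<le> (\<parallel>f\<parallel>\<^bsub>dual V\<^esub> * opnorm V V T) * \<parallel>x\<parallel>"
    by (simp add: adjoint_apply[OF f x] mult.assoc del: dual_simps)
qed

lemma adjoint_norm_le:
  assumes T: "bounded_linear_map V V T" and f: "f \<in> car (dual V)"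
  shows "\<parallel>adjoint_op V T f\<parallel>\<^bsub>dual V\<^esub> \<le> opnorm V V T * \<parallel>f\<parallel>\<^bsub>dual V\<^esub>"
proof (rule dual_norm_le)
  fix x assume x: "x \<in> unit_ball V"
  then have xV: "x \<in> car V"
    by (simp add: unit_ball_def)
  have "cmod (f (T x)) \<le> \<parallel>f\<parallel>\<^bsub>dual V\<^esub> * \<parallel>T x\<parallel>"
    by (rule dual_bound[OF f bounded_linear_map_closed[OF T xV]])
  also have "\<dots> \<le> \<parallel>f\<parallel>\<^bsub>dual V\<^esub> * opnorm V V T"
    by (intro mult_left_mono VV.opnorm_unit_ball T x dV.norm_nonneg f)
  finally show "cmod (adjoint_op V T f x) \<le> opnorm V V T * \<parallel>f\<parallel>\<^bsub>dual V\<^esub>"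
    by (simp add: adjoint_apply[OF f xV] mult.commute del: dual_simps)
qed

lemma bounded_linear_map_adjoint:
  assumes T: "bounded_linear_map V V T"
  shows "bounded_linear_map (dual V) (dual V) (adjoint_op V T)"
proof -
  have "linear_map (dual V) (dual V) (adjoint_op V T)"
  proof (rule linear_mapI)
    fix f g assume fg: "f \<in> car (dual V)" "g \<in> car (dual V)"
    show "adjoint_op V T (f \<oplus>\<^bsub>dual V\<^esub> g) = adjoint_op V T f \<oplus>\<^bsub>dual V\<^esub> adjoint_op V T g"
      using fg dV.add_closed[OF fg] bounded_linear_map_closed[OF T]
      unfolding adjoint_op_def by (simp add: fun_eq_iff)
  next
    fix c f assume f: "f \<in> car (dual V)"
    show "adjoint_op V T (c \<odot>\<^bsub>dual V\<^esub> f) = c \<odot>\<^bsub>dual V\<^esub> adjoint_op V T f"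
      using f dV.scale_closed[OF f] bounded_linear_map_closed[OF T]
      unfolding adjoint_op_def by (simp add: fun_eq_iff)
  qed (rule adjoint_closed[OF T])
  then show ?thesis
    unfolding bounded_linear_map_def using adjoint_norm_le[OF T] by blast
qed

lemma opnorm_adjoint_le:
  "bounded_linear_map V V T \<Longrightarrow> opnorm (dual V) (dual V) (adjoint_op V T) \<le> opnorm V V T"
  by (intro dVdV.opnorm_le_bound adjoint_norm_le VV.opnorm_nonneg)

lemma adjoint_compose:
  assumes "bounded_linear_map V V S" "bounded_linear_map V V T"
  shows "adjoint_op V (compose (car V) S T) = compose (car (dual V)) (adjoint_op V T) (adjoint_op V S)"
proof
  fix f
  show "adjoint_op V (compose (car V) S T) f = compose (car (dual V)) (adjoint_op V T) (adjoint_op V S) f"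
  proof (cases "f \<in> car (dual V)")
    case True
    have "adjoint_op V (compose (car V) S T) f x = adjoint_op V T (adjoint_op V S f) x" for x
    proof (cases "x \<in> car V")
      case x: True
      show ?thesis
        by (simp only: adjoint_apply adjoint_closed[OF assms(1) True] True x
            bounded_linear_map_closed[OF assms(2) x] compose_eq)
    next
      case False
      then show ?thesis
        using adjoint_closed[OF assms(1) True] True unfolding adjoint_op_def by simp
    qed
    then show ?thesis
      using True by (simp add: compose_eq fun_eq_iff del: dual_simps)
  next
    case False
    then show ?thesis
      unfolding adjoint_op_def compose_def by (simp only: restrict_apply if_False)
  qed
qed

text \<open>Schauder's theorem, in both directions: view \<open>f (T x)\<close> as a function of \<open>x\<close> and \<open>f\<close> in the
  two unit balls and exchange the variables.\<close>

lemma compact_operator_adjoint_iff: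
  assumes T: "bounded_linear_map V V T"
  shows "compact_operator (dual V) (dual V) (adjoint_op V T) \<longleftrightarrow> compact_operator V V T"
proof -
  let ?P = "unit_ball V" and ?Q = "unit_ball (dual V)"
  have ball: "x \<in> car V" if "x \<in> ?P" for x
    using that by (simp add: unit_ball_def)
  have dball: "f \<in> car (dual V)" if "f \<in> ?Q" for f
    using that by (simp add: unit_ball_def del: dual_simps)
  note T_lin = bounded_linear_map_linear[OF T] and cl = bounded_linear_map_closed[OF T]
  have bounded: "cmod (f (T x)) \<le> opnorm V V T" if "x \<in> ?P" "f \<in> ?Q" for x f
  proof -
    have "cmod (f (T x)) \<le> \<parallel>T x\<parallel>"
      using norm_le_iff_functionals[OF cl[OF ball[OF that(1)]] norm_nonneg[OF cl[OF ball[OF that(1)]]]]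
        that(2) by blast
    then show ?thesis
      using VV.opnorm_unit_ball[OF T that(1)] by simp
  qed
  have P: "(\<parallel>T x \<ominus> T y\<parallel> \<le> \<epsilon>) \<longleftrightarrow> (\<forall>f \<in> ?Q. cmod (f (T x) - f (T y)) \<le> \<epsilon>)"
    if "x \<in> ?P" "y \<in> ?P" "\<epsilon> > 0" for x y \<epsilon>
  proof -
    have xy: "T x \<in> car V" "T y \<in> car V"
      using that cl ball by auto
    show ?thesis
      using norm_le_iff_functionals[OF diff_closed[OF xy], of \<epsilon>] that(3) dball dual_diff[OF _ xy]
      by simp
  qed
  have Q: "(\<parallel>adjoint_op V T f \<ominus>\<^bsub>dual V\<^esub> adjoint_op V T g\<parallel>\<^bsub>dual V\<^esub> \<le> \<epsilon>) \<longleftrightarrow>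
      (\<forall>x \<in> ?P. cmod (f (T x) - g (T x)) \<le> \<epsilon>)" if "f \<in> ?Q" "g \<in> ?Q" for f g \<epsilon>
  proof -
    have fg: "f \<in> car (dual V)" "g \<in> car (dual V)"
      using that dball by auto
    have cl': "adjoint_op V T f \<ominus>\<^bsub>dual V\<^esub> adjoint_op V T g \<in> car (dual V)"
      by (intro dV.diff_closed adjoint_closed T fg)
    have eq: "(adjoint_op V T f \<ominus>\<^bsub>dual V\<^esub> adjoint_op V T g) x = f (T x) - g (T x)" if "x \<in> ?P" for x
      using ball[OF that] adjoint_apply[OF fg(1)] adjoint_apply[OF fg(2)] by simp
    show ?thesis
    proof
      assume *: "\<parallel>adjoint_op V T f \<ominus>\<^bsub>dual V\<^esub> adjoint_op V T g\<parallel>\<^bsub>dual V\<^esub> \<le> \<epsilon>"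
      show "\<forall>x \<in> ?P. cmod (f (T x) - g (T x)) \<le> \<epsilon>"
      proof
        fix x assume x: "x \<in> ?P"
        show "cmod (f (T x) - g (T x)) \<le> \<epsilon>"
          using dual_bound_unit_ball[OF cl' x] * unfolding eq[OF x] by simp
      qed
    next
      assume "\<forall>x \<in> ?P. cmod (f (T x) - g (T x)) \<le> \<epsilon>"
      then show "\<parallel>adjoint_op V T f \<ominus>\<^bsub>dual V\<^esub> adjoint_op V T g\<parallel>\<^bsub>dual V\<^esub> \<le> \<epsilon>"
        using eq by (intro dual_norm_le) simp
    qed
  qed
  show ?thesis
  proof
    assume C: "compact_operator V V T"
    show "compact_operator (dual V) (dual V) (adjoint_op V T)"
    proof (rule dVdV.compact_operatorI)
      show "linear_map (dual V) (dual V) (adjoint_op V T)"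
        by (rule bounded_linear_map_linear, rule bounded_linear_map_adjoint[OF T])
      fix \<epsilon> :: real assume \<epsilon>: "\<epsilon> > 0"
      have "small_cover ?Q (\<lambda>f g. \<forall>x \<in> ?P. cmod (f (T x) - g (T x)) \<le> \<epsilon>)"
      proof (rule small_cover_swap[OF _ \<epsilon>])
        show "small_cover ?P (\<lambda>x y. \<forall>f \<in> ?Q. cmod (f (T x) - f (T y)) \<le> \<epsilon>)" if "\<epsilon> > 0" for \<epsilon>
          using VV.compact_operator_small_cover[OF C that] by (rule small_cover_mono) (use P that in blast)
      qed (use bounded in blast)
      then show "small_cover ?Q (\<lambda>f g. \<parallel>adjoint_op V T f \<ominus>\<^bsub>dual V\<^esub> adjoint_op V T g\<parallel>\<^bsub>dual V\<^esub> \<le> \<epsilon>)"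
        by (rule small_cover_mono) (use Q in blast)
    qed
  next
    assume C: "compact_operator (dual V) (dual V) (adjoint_op V T)"
    show "compact_operator V V T"
    proof (rule VV.compact_operatorI[OF T_lin])
      fix \<epsilon> :: real assume \<epsilon>: "\<epsilon> > 0"
      have "small_cover ?P (\<lambda>x y. \<forall>f \<in> ?Q. cmod (f (T x) - f (T y)) \<le> \<epsilon>)"
      proof (rule small_cover_swap[OF _ \<epsilon>])
        show "small_cover ?Q (\<lambda>f g. \<forall>x \<in> ?P. cmod (f (T x) - g (T x)) \<le> \<epsilon>)" if "\<epsilon> > 0" for \<epsilon>
          using dVdV.compact_operator_small_cover[OF C that] by (rule small_cover_mono) (use Q in blast)
      qed (use bounded in blast)
      then show "small_cover ?P (\<lambda>x y. \<parallel>T x \<ominus> T y\<parallel> \<le> \<epsilon>)"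
        by (rule small_cover_mono) (use P \<epsilon> in blast)
    qed
  qed
qed

lemma adjoint_in_compact_operators:
  assumes "T \<in> car (compact_operators V)"
  shows "adjoint_op V T \<in> car (compact_operators (dual V))"
proof -
  have "bounded_linear_map V V T"
    using assms VV.compact_operator_bounded by simp
  moreover have "adjoint_op V T \<in> extensional (car (dual V))"
    unfolding adjoint_op_def by (rule restrict_extensional)
  ultimately show ?thesis
    using assms by (simp add: compact_operator_adjoint_iff del: dual_simps)
qed

lemma compact_operator_rank_one:
  assumes h: "h \<in> car (dual V)" and v: "v \<in> car V"
  shows "compact_operator V V (\<lambda>x. h x \<odot> v)"
proof (rule VV.compact_operatorI)
  show "linear_map V V (\<lambda>x. h x \<odot> v)"
    by (rule linear_mapI) (simp_all add: v scale_closed dual_add[OF h] dual_scale[OF h] add_scale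
        scale_scale del: dual_simps)
  fix \<epsilon> :: real assume "\<epsilon> > 0"
  define K where "K = \<parallel>v\<parallel> + 1"
  have K: "K > 0"
    using norm_nonneg[OF v] by (simp add: K_def)
  have "small_cover (unit_ball V) (\<lambda>x y. cmod (h x - h y) \<le> \<epsilon> / K)"
    using dual_bound_unit_ball[OF h] K \<open>\<epsilon> > 0\<close> by (intro small_cover_bounded_complex) auto
  then show "small_cover (unit_ball V) (\<lambda>x y. \<parallel>h x \<odot> v \<ominus> h y \<odot> v\<parallel> \<le> \<epsilon>)"
  proof (rule small_cover_mono)
    fix x y assume *: "cmod (h x - h y) \<le> \<epsilon> / K"
    have "h x \<odot> v \<ominus> h y \<odot> v = (h x - h y) \<odot> v"
      using v add_scale[OF v, of "h x" "- h y"] by (simp add: vdiff_def scale_scale)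
    then have "\<parallel>h x \<odot> v \<ominus> h y \<odot> v\<parallel> = cmod (h x - h y) * \<parallel>v\<parallel>"
      by (simp add: norm_scale v)
    also have "\<dots> \<le> \<epsilon> / K * K"
      using * norm_nonneg[OF v] K \<open>\<epsilon> > 0\<close> by (intro mult_mono) (auto simp: K_def)
    finally show "\<parallel>h x \<odot> v \<ominus> h y \<odot> v\<parallel> \<le> \<epsilon>"
      using K by simp
  qed
qed

text \<open>
  The operator is built with finite rank, which makes its second adjoint map the bidual into the space
  itself; the last conclusion records this.  A further functional \<open>g\<close> is added by correcting \<open>U\<close> with
  a rank-one operator \<open>W\<close> whose adjoint fixes \<open>g - U\<^sup>* g\<close>: for \<open>N = U + W - U W\<close> one has
  \<open>1 - N\<^sup>* = (1 - W\<^sup>*) (1 - U\<^sup>*)\<close>.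
\<close>

lemma finite_functionals_fixed:
  assumes "finite F" "F \<subseteq> car (dual V)"
  obtains U where "U \<in> car (compact_operators V)" "\<And>f x. \<lbrakk>f \<in> F; x \<in> car V\<rbrakk> \<Longrightarrow> f (U x) = f x"
    "\<And>\<Xi>. \<Xi> \<in> car (dual (dual V)) \<Longrightarrow> \<exists>x \<in> car V. \<forall>f \<in> car (dual V). \<Xi> (adjoint_op V U f) = f x"
proof -
  let ?K = "compact_operators V"
  interpret K: complex_banach_algebra "?K"
    by (rule complex_banach_algebra_compact_operators) unfold_locales
  have bl: "bounded_linear_map V V T" if "T \<in> car (?K)" for T
    using that VV.compact_operator_bounded by simp
  have "\<exists>U \<in> car (?K). (\<forall>f \<in> F. \<forall>x \<in> car V. f (U x) = f x) \<and>
      (\<forall>\<Xi> \<in> car (dual (dual V)). \<exists>x \<in> car V. \<forall>f \<in> car (dual V). \<Xi> (adjoint_op V U f) = f x)"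
    using assms
  proof (induction F)
    case empty
    show ?case
    proof (intro bexI[of _ "\<zero>\<^bsub>?K\<^esub>"] conjI ballI K.zero_closed)
      fix \<Xi> assume \<Xi>: "\<Xi> \<in> car (dual (dual V))"
      have "adjoint_op V \<zero>\<^bsub>?K\<^esub> f = \<zero>\<^bsub>dual V\<^esub>" if f: "f \<in> car (dual V)" for f
        using f dual_zero[OF f] unfolding adjoint_op_def by (auto simp: fun_eq_iff)
      then show "\<exists>x \<in> car V. \<forall>f \<in> car (dual V). \<Xi> (adjoint_op V \<zero>\<^bsub>?K\<^esub> f) = f x"
        using zero_closed dual_zero dV.dual_zero[OF \<Xi>] by (metis (no_types))
    qed simp
  next
    case (insert g F)
    then obtain U where U: "U \<in> car (?K)"
      and U_fix: "\<And>f x. \<lbrakk>f \<in> F; x \<in> car V\<rbrakk> \<Longrightarrow> f (U x) = f x"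
      and U_bidual: "\<And>\<Xi>. \<Xi> \<in> car (dual (dual V)) \<Longrightarrow>
        \<exists>x \<in> car V. \<forall>f \<in> car (dual V). \<Xi> (adjoint_op V U f) = f x"
      by blast
    have g: "g \<in> car (dual V)" and F: "\<And>f. f \<in> F \<Longrightarrow> f \<in> car (dual V)"
      using insert.prems by auto
    note Ucl = bounded_linear_map_closed[OF bl[OF U]]
    show ?case
    proof (cases "\<forall>x \<in> car V. g (U x) = g x")
      case True
      then show ?thesis
        using U U_fix U_bidual by blast
    next
      case False
      then obtain x0 where x0: "x0 \<in> car V" "g x0 - g (U x0) \<noteq> 0"
        by auto
      define h where "h = g \<ominus>\<^bsub>dual V\<^esub> adjoint_op V U g"
      have h: "h \<in> car (dual V)"
        unfolding h_def by (intro dV.diff_closed adjoint_closed bl U g)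
      have h_eq: "h x = g x - g (U x)" if "x \<in> car V" for x
        using that by (simp add: h_def adjoint_apply[OF g])
      define v where "v = inverse (h x0) \<odot> x0"
      have v: "v \<in> car V"
        unfolding v_def by (rule scale_closed[OF x0(1)])
      have hv: "h v = 1"
        using x0(2) unfolding v_def dual_scale[OF h x0(1)] h_eq[OF x0(1)] by simp
      define W where "W = (\<lambda>x \<in> car V. h x \<odot> v)"
      have W: "W \<in> car (?K)"
        using compact_operator_rank_one[OF h v] by (simp add: W_def)
      have W_eq: "W x = h x \<odot> v" if "x \<in> car V" for x
        using that by (simp add: W_def)
      have Wcl: "W x \<in> car V" if "x \<in> car V" for x
        using that by (simp add: W_eq scale_closed v)
      define N where "N = (U \<oplus>\<^bsub>?K\<^esub> W) \<ominus>\<^bsub>?K\<^esub> U \<otimes>\<^bsub>?K\<^esub> W"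
      have N: "N \<in> car (?K)"
        unfolding N_def by (intro K.diff_closed K.add_closed K.mult_closed U W)
      have N_eq: "f (N x) = f (U x) + f (W x) - f (U (W x))" if "f \<in> car (dual V)" "x \<in> car V" for f x
      proof -
        have "N x = (U x \<oplus> W x) \<ominus> U (W x)"
          using that(2) by (simp add: N_def compose_eq)
        then show ?thesis
          using that(2) by (simp add: dual_diff[OF that(1)] dual_add[OF that(1)] Ucl Wcl add_closed)
      qed
      have N_adj: "adjoint_op V N f = (adjoint_op V U f \<oplus>\<^bsub>dual V\<^esub> adjoint_op V W f)
          \<ominus>\<^bsub>dual V\<^esub> adjoint_op V W (adjoint_op V U f)" if f: "f \<in> car (dual V)" for f
      proof
        fix x
        show "adjoint_op V N f x = ((adjoint_op V U f \<oplus>\<^bsub>dual V\<^esub> adjoint_op V W f)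
          \<ominus>\<^bsub>dual V\<^esub> adjoint_op V W (adjoint_op V U f)) x"
        proof (cases "x \<in> car V")
          case True
          then show ?thesis
            using adjoint_apply[OF f] adjoint_apply[OF adjoint_closed[OF bl[OF U] f]] Wcl N_eq[OF f]
            by simp
        next
          case False
          then show ?thesis
            using f by (simp add: adjoint_op_def)
        qed
      qed
      show ?thesis
      proof (intro bexI[of _ N] conjI ballI N)
        fix f x assume f: "f \<in> insert g F" and x: "x \<in> car V"
        show "f (N x) = f x"
        proof (cases "f = g")
          case True
          have "f (N x) = f (U x) + h (W x)"
            using N_eq[OF g x] True h_eq[OF Wcl[OF x]] by simp
          also have "h (W x) = h x"
            by (simp add: W_eq[OF x] dual_scale[OF h v] hv)
          finally show ?thesis
            using True h_eq[OF x] by simp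
        next
          case False
          then show ?thesis
            using f N_eq[OF F x, of f] U_fix[of f, OF _ x] U_fix[of f, OF _ Wcl[OF x]] by simp
        qed
      next
        fix \<Xi> assume \<Xi>: "\<Xi> \<in> car (dual (dual V))"
        obtain xU where xU: "xU \<in> car V" "\<And>f. f \<in> car (dual V) \<Longrightarrow> \<Xi> (adjoint_op V U f) = f xU"
          using U_bidual[OF \<Xi>] by blast
        define xW where "xW = \<Xi> h \<odot> v"
        have xW: "xW \<in> car V"
          by (simp add: xW_def scale_closed v)
        have W_adj: "\<Xi> (adjoint_op V W f) = f xW" if f: "f \<in> car (dual V)" for f
        proof -
          have "adjoint_op V W f = f v \<odot>\<^bsub>dual V\<^esub> h"
            using f by (auto simp: adjoint_op_def fun_eq_iff W_eq dual_scale[OF f v])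
          then show ?thesis
            by (simp only: dV.dual_scale[OF \<Xi> h] xW_def dual_scale[OF f v] mult.commute)
        qed
        have "\<Xi> (adjoint_op V N f) = f ((xU \<oplus> xW) \<ominus> U xW)" if f: "f \<in> car (dual V)" for f
        proof -
          note adj = adjoint_closed[OF bl]
          have "\<Xi> (adjoint_op V N f) = \<Xi> (adjoint_op V U f) + \<Xi> (adjoint_op V W f)
              - \<Xi> (adjoint_op V W (adjoint_op V U f))"
            by (simp only: N_adj[OF f] dV.dual_diff[OF \<Xi>] dV.dual_add[OF \<Xi>] adj U W f dV.add_closed)
          also have "\<dots> = f xU + f xW - f (U xW)"
            by (simp only: xU(2) W_adj adj U f adjoint_apply xW)
          also have "\<dots> = f ((xU \<oplus> xW) \<ominus> U xW)"
            by (simp only: dual_diff[OF f] dual_add[OF f] xU(1) xW Ucl add_closed)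
          finally show ?thesis .
        qed
        then show "\<exists>x \<in> car V. \<forall>f \<in> car (dual V). \<Xi> (adjoint_op V N f) = f x"
          by (intro bexI[of _ "(xU \<oplus> xW) \<ominus> U xW"] ballI) (simp_all only: diff_closed add_closed xU(1) xW Ucl)
      qed
    qed
  qed
  then show ?thesis
    using that by blast
qed

text \<open>
  With \<open>U\<close> from \<open>finite_functionals_fixed\<close>, \<open>x = U\<^sup>*\<^sup>* \<Xi>\<close> has the right values on \<open>F\<close>; it remains to
  lower its norm without changing them.
  A functional vanishing on the range of \<open>1 - U\<close> is fixed by \<open>U\<^sup>*\<close>, so its value at \<open>x\<close> is that of \<open>\<Xi>\<close>;
  hence the distance of \<open>x\<close> from that range, where all given functionals vanish, is at most \<open>\<parallel>\<Xi>\<parallel>\<close>.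
\<close>

lemma helly:
  assumes "finite F" "F \<subseteq> car (dual V)" and \<Xi>: "\<Xi> \<in> car (dual (dual V))"
  obtains x where "x \<in> car V" "\<parallel>x\<parallel> \<le> \<parallel>\<Xi>\<parallel>\<^bsub>dual (dual V)\<^esub> + 1" "\<And>f. f \<in> F \<Longrightarrow> \<Xi> f = f x"
proof -
  obtain U where U: "U \<in> car (compact_operators V)"
    and fix_F: "\<And>f x. \<lbrakk>f \<in> F; x \<in> car V\<rbrakk> \<Longrightarrow> f (U x) = f x"
    and "\<exists>x \<in> car V. \<forall>f \<in> car (dual V). \<Xi> (adjoint_op V U f) = f x"
    using finite_functionals_fixed[OF assms(1,2)] \<Xi> by metis
  then obtain x where x: "x \<in> car V" "\<And>f. f \<in> car (dual V) \<Longrightarrow> \<Xi> (adjoint_op V U f) = f x"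
    by blast
  have bl: "bounded_linear_map V V U"
    using U VV.compact_operator_bounded by simp
  note U_lin = bounded_linear_map_linear[OF bl] and Ucl = bounded_linear_map_closed[OF bl]
  have fixed: "\<Xi> f = f x" if f: "f \<in> car (dual V)" and *: "\<And>z. z \<in> car V \<Longrightarrow> f (U z) = f z" for f
  proof -
    have "adjoint_op V U f = f"
      by (rule extensionalityI[of _ "car V"]) (use f * in \<open>simp_all add: adjoint_op_def\<close>)
    then show ?thesis
      using x(2)[OF f] by simp
  qed
  have "\<exists>w \<in> car V. \<parallel>x \<ominus> (w \<ominus> U w)\<parallel> < \<parallel>\<Xi>\<parallel>\<^bsub>dual (dual V)\<^esub> + 1"
  proof (rule ccontr)
    assume far: "\<not> (\<exists>w \<in> car V. \<parallel>x \<ominus> (w \<ominus> U w)\<parallel> < \<parallel>\<Xi>\<parallel>\<^bsub>dual (dual V)\<^esub> + 1)"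
    have "linear_map V V (\<lambda>w. w \<ominus> U w)"
      by (rule linear_mapI) (simp_all add: Ucl diff_closed linear_map_add[OF U_lin] add_diff_add
          linear_map_scale[OF U_lin] scale_diff)
    then show False
    proof (rule VV.hahn_banach_distance[of "\<lambda>w. w \<ominus> U w" x 1 0 "\<parallel>\<Xi>\<parallel>\<^bsub>dual (dual V)\<^esub> + 1"])
      fix \<psi> assume \<psi>: "linear_map V complex_line \<psi>" and le: "\<And>z. z \<in> car V \<Longrightarrow> cmod (\<psi> z) \<le> 1 * \<parallel>z\<parallel>"
        and zero: "\<And>w. w \<in> car V \<Longrightarrow> cmod (\<psi> (w \<ominus> U w)) \<le> 0 * \<parallel>w\<parallel>"
        and ge: "\<parallel>\<Xi>\<parallel>\<^bsub>dual (dual V)\<^esub> + 1 \<le> cmod (\<psi> x)"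
      let ?\<psi> = "restrict \<psi> (car V)"
      have "bounded_linear_map V complex_line \<psi>"
        unfolding bounded_linear_map_def using \<psi> le by (auto intro!: exI[of _ 1])
      then have cl: "?\<psi> \<in> car (dual V)"
        by simp
      have "\<psi> (U w) = \<psi> w" if "w \<in> car V" for w
        using zero[OF that] functional.linear_map_diff[OF \<psi> that Ucl[OF that]] by simp
      then have "\<Xi> ?\<psi> = \<psi> x"
        using fixed[OF cl] Ucl x(1) by simp
      moreover have "cmod (\<Xi> ?\<psi>) \<le> \<parallel>\<Xi>\<parallel>\<^bsub>dual (dual V)\<^esub> * \<parallel>?\<psi>\<parallel>\<^bsub>dual V\<^esub>"
        by (rule dV.dual_bound[OF \<Xi> cl])
      moreover have "\<parallel>?\<psi>\<parallel>\<^bsub>dual V\<^esub> \<le> 1"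
        using le functional.opnorm_le_bound[of \<psi> 1] by simp
      then have "\<parallel>\<Xi>\<parallel>\<^bsub>dual (dual V)\<^esub> * \<parallel>?\<psi>\<parallel>\<^bsub>dual V\<^esub> \<le> \<parallel>\<Xi>\<parallel>\<^bsub>dual (dual V)\<^esub> * 1"
        using dV.dual_norm_nonneg \<Xi> by (intro mult_left_mono) blast+
      ultimately show False
        using ge by simp
    qed (use far x(1) in force)+
  qed
  then obtain w where w: "w \<in> car V" "\<parallel>x \<ominus> (w \<ominus> U w)\<parallel> < \<parallel>\<Xi>\<parallel>\<^bsub>dual (dual V)\<^esub> + 1"
    by blast
  show ?thesis
  proof (rule that[of "x \<ominus> (w \<ominus> U w)"])
    fix f assume f: "f \<in> F"
    then have fV: "f \<in> car (dual V)"
      using assms(2) by blast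
    show "\<Xi> f = f (x \<ominus> (w \<ominus> U w))"
      using fixed[OF fV fix_F[OF f]] fix_F[OF f w(1)]
      by (simp add: dual_diff[OF fV] x(1) w(1) Ucl diff_closed del: dual_simps)
  qed (use x(1) w Ucl diff_closed in auto)
qed

text \<open>
  The second adjoint of a compact operator maps the bidual into the space.  By Helly's lemma the
  element \<open>\<Xi> \<circ> T\<^sup>*\<close> is a norm limit of vectors \<open>T x\<close> with bounded \<open>x\<close>: it suffices to control the
  finitely many functionals of a net in the image of the dual unit ball under \<open>T\<^sup>*\<close>.
\<close>

lemma compact_second_adjoint:
  assumes T: "T \<in> car (compact_operators V)" and \<Xi>: "\<Xi> \<in> car (dual (dual V))"
  obtains z where "z \<in> car V" "\<And>f. f \<in> car (dual V) \<Longrightarrow> \<Xi> (adjoint_op V T f) = f z"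
proof -
  let ?k = "\<parallel>\<Xi>\<parallel>\<^bsub>dual (dual V)\<^esub>"
  have k: "0 \<le> ?k"
    by (rule dV.dual_norm_nonneg[OF \<Xi>])
  have T_bl: "bounded_linear_map V V T"
    using T VV.compact_operator_bounded by simp
  note T_lin = bounded_linear_map_linear[OF T_bl] and Tcl = bounded_linear_map_closed[OF T_bl]
  note adj = adjoint_closed[OF T_bl]
  have T_adj: "compact_operator (dual V) (dual V) (adjoint_op V T)"
    using adjoint_in_compact_operators[OF T] by simp
  have approx: "\<exists>z \<in> car V. \<forall>f \<in> car (dual V). cmod (\<Xi> (adjoint_op V T f) - f z) \<le> \<epsilon> * \<parallel>f\<parallel>\<^bsub>dual V\<^esub>"
    if \<epsilon>: "\<epsilon> > 0" for \<epsilon>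
  proof -
    \<comment> \<open>An error \<open>\<delta>\<close> in \<open>T\<^sup>* f\<close> costs \<open>?k * \<delta>\<close> under \<open>\<Xi>\<close> and \<open>(?k + 1) * \<delta>\<close> at the vector \<open>x\<close> below.\<close>
    define \<delta> where "\<delta> = \<epsilon> / (2 * ?k + 1)"
    have \<delta>: "\<delta> > 0" "\<delta> * (2 * ?k + 1) = \<epsilon>"
      using \<epsilon> k by (simp_all add: \<delta>_def)
    obtain G where G: "finite G" "G \<subseteq> unit_ball (dual V)"
      and net: "\<And>f. f \<in> unit_ball (dual V) \<Longrightarrow>
        \<exists>g \<in> G. \<parallel>adjoint_op V T f \<ominus>\<^bsub>dual V\<^esub> adjoint_op V T g\<parallel>\<^bsub>dual V\<^esub> \<le> \<delta>"
      using small_cover_net[OF dVdV.compact_operator_small_cover[OF T_adj \<delta>(1)]] by blast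
    have Gcl: "g \<in> car (dual V)" if "g \<in> G" for g
      using G(2) that unfolding unit_ball_def by blast
    obtain x where x: "x \<in> car V" "\<parallel>x\<parallel> \<le> ?k + 1"
      and agree: "\<And>f. f \<in> adjoint_op V T ` G \<Longrightarrow> \<Xi> f = f x"
      by (rule helly[of "adjoint_op V T ` G", OF _ _ \<Xi>]) (use G(1) adj Gcl in blast)+
    have ball: "cmod (\<Xi> (adjoint_op V T f) - f (T x)) \<le> \<epsilon>" if f: "f \<in> unit_ball (dual V)" for f
    proof -
      obtain g where g: "g \<in> G" and near: "\<parallel>adjoint_op V T f \<ominus>\<^bsub>dual V\<^esub> adjoint_op V T g\<parallel>\<^bsub>dual V\<^esub> \<le> \<delta>"
        using net[OF f] by blast
      have fV: "f \<in> car (dual V)"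
        using f unfolding unit_ball_def by blast
      let ?d = "adjoint_op V T f \<ominus>\<^bsub>dual V\<^esub> adjoint_op V T g"
      have d: "?d \<in> car (dual V)"
        by (intro dV.diff_closed adj fV Gcl g)
      have "\<Xi> ?d - ?d x = (\<Xi> (adjoint_op V T f) - \<Xi> (adjoint_op V T g))
          - (adjoint_op V T f x - adjoint_op V T g x)"
        using x(1) by (simp add: dV.dual_diff[OF \<Xi> adj[OF fV] adj[OF Gcl[OF g]], simplified])
      also have "\<dots> = \<Xi> (adjoint_op V T f) - f (T x)"
        using agree g adjoint_apply[OF fV x(1)] by simp
      finally have "cmod (\<Xi> (adjoint_op V T f) - f (T x)) \<le> cmod (\<Xi> ?d) + cmod (?d x)"
        by (metis norm_triangle_ineq4)
      also have "\<dots> \<le> ?k * \<parallel>?d\<parallel>\<^bsub>dual V\<^esub> + \<parallel>?d\<parallel>\<^bsub>dual V\<^esub> * \<parallel>x\<parallel>"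
        by (intro add_mono dV.dual_bound[OF \<Xi> d] dual_bound[OF d x(1)])
      also have "\<dots> \<le> ?k * \<delta> + \<delta> * (?k + 1)"
        using near x(2) k \<delta>(1) norm_nonneg[OF x(1)] dual_norm_nonneg[OF d]
        by (intro add_mono mult_mono) simp_all
      also have "\<dots> = \<epsilon>"
        using \<delta>(2) by (simp add: algebra_simps)
      finally show ?thesis .
    qed
    let ?r = "\<lambda>f. \<Xi> (adjoint_op V T f) - f (T x)"
    have "linear_map (dual V) complex_line ?r"
    proof (rule linear_mapI)
      note lin = bounded_linear_map_linear[OF bounded_linear_map_adjoint[OF T_bl]]
      fix f g assume fg: "f \<in> car (dual V)" "g \<in> car (dual V)"
      have "(f \<oplus>\<^bsub>dual V\<^esub> g) (T x) = f (T x) + g (T x)"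
        using Tcl[OF x(1)] by simp
      then show "?r (f \<oplus>\<^bsub>dual V\<^esub> g) = ?r f \<oplus>\<^bsub>complex_line\<^esub> ?r g"
        by (simp only: linear_map_add[OF lin fg] dV.dual_add[OF \<Xi> adj[OF fg(1)] adj[OF fg(2)]]
            complex_line_simps) simp
    next
      note lin = bounded_linear_map_linear[OF bounded_linear_map_adjoint[OF T_bl]]
      fix c f assume f: "f \<in> car (dual V)"
      have "(c \<odot>\<^bsub>dual V\<^esub> f) (T x) = c * f (T x)"
        using Tcl[OF x(1)] by simp
      then show "?r (c \<odot>\<^bsub>dual V\<^esub> f) = c \<odot>\<^bsub>complex_line\<^esub> ?r f"
        by (simp only: linear_map_scale[OF lin f] dV.dual_scale[OF \<Xi> adj[OF f]]
            complex_line_simps right_diff_distrib)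
    qed simp
    then show ?thesis
      using dV.functional.norm_le_of_unit_ball[of ?r _ \<epsilon>] ball Tcl[OF x(1)]
      by (intro bexI[of _ "T x"] ballI) (simp_all del: dual_simps)
  qed
  have "\<exists>z. \<forall>n. z n \<in> car V \<and>
      (\<forall>f \<in> car (dual V). cmod (\<Xi> (adjoint_op V T f) - f (z n)) \<le> inverse (Suc n) * \<parallel>f\<parallel>\<^bsub>dual V\<^esub>)"
    using approx[of "inverse (real (Suc n))" for n] by (intro choice allI) (force simp del: dual_simps)
  then obtain z where z: "\<And>n. z n \<in> car V"
    and z_le: "\<And>n f. f \<in> car (dual V) \<Longrightarrow>
      cmod (\<Xi> (adjoint_op V T f) - f (z n)) \<le> inverse (Suc n) * \<parallel>f\<parallel>\<^bsub>dual V\<^esub>"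
    by blast
  have z_diff: "\<parallel>z m \<ominus> z n\<parallel> \<le> inverse (Suc m) + inverse (Suc n)" for m n
  proof -
    have "cmod (f (z m \<ominus> z n)) \<le> inverse (Suc m) + inverse (Suc n)" if "f \<in> unit_ball (dual V)" for f
    proof -
      have f: "f \<in> car (dual V)" "\<parallel>f\<parallel>\<^bsub>dual V\<^esub> \<le> 1"
        using that unfolding unit_ball_def by blast+
      have le: "cmod (\<Xi> (adjoint_op V T f) - f (z n)) \<le> inverse (Suc n)" for n
      proof -
        have "inverse (real (Suc n)) * \<parallel>f\<parallel>\<^bsub>dual V\<^esub> \<le> inverse (real (Suc n)) * 1"
          by (intro mult_left_mono f(2)) simp
        then show ?thesis
          using z_le[OF f(1), of n] by linarith
      qed
      have "f (z m \<ominus> z n) = (\<Xi> (adjoint_op V T f) - f (z n)) - (\<Xi> (adjoint_op V T f) - f (z m))"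
        by (simp add: dual_diff[OF f(1) z z])
      then show ?thesis
        using le[of m] le[of n]
          norm_triangle_ineq4[of "\<Xi> (adjoint_op V T f) - f (z n)" "\<Xi> (adjoint_op V T f) - f (z m)"] by simp
    qed
    then show ?thesis
      using norm_le_iff_functionals[OF diff_closed[OF z z]] by simp
  qed
  obtain y where y: "y \<in> car V" "(\<lambda>n. \<parallel>z n \<ominus> y\<parallel>) \<longlonglongrightarrow> 0"
  proof (rule complete_sequence[of z])
    fix \<epsilon> :: real assume "\<epsilon> > 0"
    then obtain N where N: "inverse (real (Suc N)) < \<epsilon> / 2"
      using reals_Archimedean[of "\<epsilon> / 2"] by auto
    have "\<parallel>z m \<ominus> z n\<parallel> < \<epsilon>" if "N \<le> m" "N \<le> n" for m n
    proof -
      have "inverse (real (Suc m)) \<le> inverse (real (Suc N))" "inverse (real (Suc n)) \<le> inverse (real (Suc N))"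
        using that by (auto intro!: le_imp_inverse_le)
      then show ?thesis
        using z_diff[of m n] N by linarith
    qed
    then show "\<exists>N. \<forall>m n. N \<le> m \<longrightarrow> N \<le> n \<longrightarrow> \<parallel>z m \<ominus> z n\<parallel> < \<epsilon>"
      by blast
  qed (use z in blast)
  show ?thesis
  proof (rule that[OF y(1)])
    fix f assume f: "f \<in> car (dual V)"
    have "(\<lambda>n. inverse (real (Suc n)) * \<parallel>f\<parallel>\<^bsub>dual V\<^esub> + \<parallel>f\<parallel>\<^bsub>dual V\<^esub> * \<parallel>z n \<ominus> y\<parallel>) \<longlonglongrightarrow>
        0 * \<parallel>f\<parallel>\<^bsub>dual V\<^esub> + \<parallel>f\<parallel>\<^bsub>dual V\<^esub> * 0"
      by (intro tendsto_intros LIMSEQ_inverse_real_of_nat y(2))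
    moreover have "cmod (\<Xi> (adjoint_op V T f) - f y) \<le>
        inverse (real (Suc n)) * \<parallel>f\<parallel>\<^bsub>dual V\<^esub> + \<parallel>f\<parallel>\<^bsub>dual V\<^esub> * \<parallel>z n \<ominus> y\<parallel>" for n
    proof -
      have split: "\<Xi> (adjoint_op V T f) - f y = (\<Xi> (adjoint_op V T f) - f (z n)) + f (z n \<ominus> y)"
        by (simp add: dual_diff[OF f z y(1)])
      show ?thesis
        unfolding split using z_le[OF f, of n] dual_bound[OF f diff_closed[OF z[of n] y(1)]]
          norm_triangle_ineq[of "\<Xi> (adjoint_op V T f) - f (z n)" "f (z n \<ominus> y)"] by linarith
    qed
    ultimately have "cmod (\<Xi> (adjoint_op V T f) - f y) \<le> 0"
      using LIMSEQ_le_const by fastforce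
    then show "\<Xi> (adjoint_op V T f) = f y"
      by simp
  qed
qed

text \<open>
  By \<open>compact_second_adjoint\<close> the adjoint \<open>T\<^sup>*\<^sup>* S\<^sup>*\<close> of \<open>S T\<^sup>*\<close> maps the space into itself; its
  restriction \<open>R\<close> satisfies \<open>R\<^sup>* = S T\<^sup>*\<close> and is compact by Schauder's theorem.
\<close>

lemma adjoints_left_ideal:
  assumes S: "S \<in> car (compact_operators (dual V))" and T: "T \<in> car (compact_operators V)"
  obtains R where "R \<in> car (compact_operators V)"
    "S \<otimes>\<^bsub>compact_operators (dual V)\<^esub> adjoint_op V T = adjoint_op V R"
proof -
  let ?opnorm = "opnorm (dual V) (dual V)"
  interpret K: complex_banach_algebra "compact_operators (dual V)"
    by (rule complex_banach_algebra_compact_operators) unfold_locales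
  have S_bl: "bounded_linear_map (dual V) (dual V) S"
    using S dVdV.compact_operator_bounded by simp
  note S_lin = bounded_linear_map_linear[OF S_bl] and Scl = bounded_linear_map_closed[OF S_bl]
  have T_bl: "bounded_linear_map V V T"
    using T VV.compact_operator_bounded by simp
  note adj = adjoint_closed[OF T_bl]
  define P where "P = S \<otimes>\<^bsub>compact_operators (dual V)\<^esub> adjoint_op V T"
  have P: "P \<in> car (compact_operators (dual V))"
    unfolding P_def by (intro K.mult_closed S adjoint_in_compact_operators T)
  have P_bl: "bounded_linear_map (dual V) (dual V) P"
    using P dVdV.compact_operator_bounded by simp
  note Pcl = bounded_linear_map_closed[OF P_bl]
  have P_eq: "P f = S (adjoint_op V T f)" if "f \<in> car (dual V)" for f
    using that unfolding P_def by (simp only: compact_operators_simps compose_eq)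
  have "\<exists>z \<in> car V. \<forall>f \<in> car (dual V). P f x = f z" if x: "x \<in> car V" for x
  proof -
    let ?\<Xi> = "\<lambda>f \<in> car (dual V). S f x"
    have "linear_map (dual V) complex_line (\<lambda>f. S f x)"
      by (rule linear_mapI) (use x in \<open>simp_all add: linear_map_add[OF S_lin, simplified]
          linear_map_scale[OF S_lin, simplified]\<close>)
    moreover have "cmod (S f x) \<le> (?opnorm S * \<parallel>x\<parallel>) * \<parallel>f\<parallel>\<^bsub>dual V\<^esub>"
      if f: "f \<in> car (dual V)" for f
    proof -
      have "cmod (S f x) \<le> \<parallel>S f\<parallel>\<^bsub>dual V\<^esub> * \<parallel>x\<parallel>"
        by (rule dual_bound[OF Scl[OF f] x])
      also have "\<dots> \<le> (?opnorm S * \<parallel>f\<parallel>\<^bsub>dual V\<^esub>) * \<parallel>x\<parallel>"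
        by (intro mult_right_mono dVdV.opnorm_bound[OF S_bl f] norm_nonneg x)
      finally show ?thesis
        by (simp add: mult_ac del: dual_simps)
    qed
    ultimately have "bounded_linear_map (dual V) complex_line (\<lambda>f. S f x)"
      unfolding bounded_linear_map_def complex_line_simps by blast
    then have \<Xi>: "?\<Xi> \<in> car (dual (dual V))"
      unfolding dual_simps(1)[of "dual V"] by (simp del: dual_simps)
    obtain z where "z \<in> car V" "\<And>f. f \<in> car (dual V) \<Longrightarrow> ?\<Xi> (adjoint_op V T f) = f z"
      using compact_second_adjoint[OF T \<Xi>] by blast
    then show ?thesis
      using adj P_eq by (intro bexI[of _ z]) (simp_all del: dual_simps)
  qed
  then obtain R0 where R0: "\<And>x. x \<in> car V \<Longrightarrow> R0 x \<in> car V"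
    "\<And>x f. \<lbrakk>x \<in> car V; f \<in> car (dual V)\<rbrakk> \<Longrightarrow> f (R0 x) = P f x"
    by metis
  define R where "R = restrict R0 (car V)"
  have R: "R x \<in> car V" "\<And>f. f \<in> car (dual V) \<Longrightarrow> f (R x) = P f x" if "x \<in> car V" for x
    using R0 that by (simp_all add: R_def del: dual_simps)
  have R_lin: "linear_map V V R"
  proof (rule linear_mapI)
    fix x y assume xy: "x \<in> car V" "y \<in> car V"
    show "R (x \<oplus> y) = R x \<oplus> R y"
      by (rule functionals_separate)
        (simp_all add: R xy add_closed dual_add Pcl del: dual_simps)
  next
    fix c x assume x: "x \<in> car V"
    show "R (c \<odot> x) = c \<odot> R x"
      by (rule functionals_separate)
        (simp_all add: R x scale_closed dual_scale Pcl del: dual_simps)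
  qed (rule R)
  have "\<parallel>R x\<parallel> \<le> ?opnorm P * \<parallel>x\<parallel>" if x: "x \<in> car V" for x
  proof -
    obtain f where "f \<in> unit_ball (dual V)" and le: "\<parallel>R x\<parallel> \<le> cmod (f (R x))"
      using norming_functional[OF R(1)[OF x]] by blast
    then have f: "f \<in> car (dual V)" "f \<in> unit_ball (dual V)"
      unfolding unit_ball_def by blast+
    have "cmod (f (R x)) \<le> \<parallel>P f\<parallel>\<^bsub>dual V\<^esub> * \<parallel>x\<parallel>"
      using dual_bound[OF Pcl[OF f(1)] x] R(2)[OF x f(1)] by simp
    also have "\<dots> \<le> ?opnorm P * \<parallel>x\<parallel>"
      by (intro mult_right_mono dVdV.opnorm_unit_ball[OF P_bl f(2)] norm_nonneg x)
    finally show ?thesis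
      using le by simp
  qed
  then have R_bl: "bounded_linear_map V V R"
    unfolding bounded_linear_map_def using R_lin by blast
  have P_adj: "P = adjoint_op V R"
  proof (rule extensionalityI[of _ "car (dual V)"])
    show "P \<in> extensional (car (dual V))"
      using P by (simp del: dual_simps)
    show "adjoint_op V R \<in> extensional (car (dual V))"
      unfolding adjoint_op_def by (rule restrict_extensional)
    fix f assume f: "f \<in> car (dual V)"
    show "P f = adjoint_op V R f"
    proof (rule extensionalityI[of _ "car V"])
      show "P f \<in> extensional (car V)" "adjoint_op V R f \<in> extensional (car V)"
        using Pcl[OF f] adjoint_closed[OF R_bl f] by simp_all
    qed (simp add: adjoint_apply[OF f] R f del: dual_simps)
  qed
  have "compact_operator V V R"
    using P P_adj compact_operator_adjoint_iff[OF R_bl] by simp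
  then have "R \<in> car (compact_operators V)"
    by (simp add: R_def)
  then show ?thesis
    using that P_adj by (simp add: P_def del: dual_simps compact_operators_simps)
qed

text \<open>
  Bounded approximate units \<open>u\<close> of the compact operators give adjoints \<open>u\<^sup>*\<close> acting as approximate
  units from the left.  Compactness of \<open>a\<close> and the bound on \<open>u\<close> reduce the claim to finitely many
  functionals; these are fixed by the adjoint of a compact \<open>U\<close>, and \<open>U u\<close> is close to \<open>U\<close>.
\<close>

lemma adjoint_approximate_units:
  assumes units: "\<And>v \<epsilon>. \<lbrakk>v \<in> car (compact_operators V); \<epsilon> > 0\<rbrakk> \<Longrightarrow>
      \<exists>u \<in> car (compact_operators V). \<parallel>u\<parallel>\<^bsub>compact_operators V\<^esub> \<le> M \<and>
        \<parallel>v \<ominus>\<^bsub>compact_operators V\<^esub> v \<otimes>\<^bsub>compact_operators V\<^esub> u\<parallel>\<^bsub>compact_operators V\<^esub> < \<epsilon>"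
    and a: "a \<in> car (compact_operators (dual V))" and \<epsilon>: "\<epsilon> > 0"
  obtains u where "u \<in> car (compact_operators V)"
    "\<parallel>adjoint_op V u \<otimes>\<^bsub>compact_operators (dual V)\<^esub> a \<ominus>\<^bsub>compact_operators (dual V)\<^esub> a\<parallel>\<^bsub>compact_operators (dual V)\<^esub>
      \<le> \<epsilon>"
proof -
  have a_cpt: "compact_operator (dual V) (dual V) a"
    using a by simp
  note a_bl = dVdV.compact_operator_bounded[OF a_cpt]
  note acl = bounded_linear_map_closed[OF a_bl]
  define k where "k = opnorm (dual V) (dual V) a"
  have k: "0 \<le> k"
    unfolding k_def by (rule dVdV.opnorm_nonneg[OF a_bl])
  \<comment> \<open>The error of the net counts at \<open>u x\<close> and at \<open>x\<close>, the error of \<open>U u\<close> under functionals of norm at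
    most \<open>k\<close>.\<close>
  define \<delta> where "\<delta> = \<epsilon> / (\<bar>M\<bar> + k + 1)"
  have \<delta>: "\<delta> > 0" "\<delta> * (\<bar>M\<bar> + k + 1) = \<epsilon>"
    using \<epsilon> k by (simp_all add: \<delta>_def)
  obtain G where G: "finite G" "G \<subseteq> unit_ball (dual V)"
    and net: "\<And>f. f \<in> unit_ball (dual V) \<Longrightarrow> \<exists>g \<in> G. \<parallel>a f \<ominus>\<^bsub>dual V\<^esub> a g\<parallel>\<^bsub>dual V\<^esub> \<le> \<delta>"
    using small_cover_net[OF dVdV.compact_operator_small_cover[OF a_cpt \<delta>(1)]] by blast
  have Gcl: "g \<in> car (dual V)" if "g \<in> G" for g
    using G(2) that unfolding unit_ball_def by blast
  obtain U where U: "U \<in> car (compact_operators V)"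
    and fixed: "\<And>f x. \<lbrakk>f \<in> a ` G; x \<in> car V\<rbrakk> \<Longrightarrow> f (U x) = f x"
    by (rule finite_functionals_fixed[of "a ` G"]) (use G(1) acl Gcl in blast)+
  obtain u where u: "u \<in> car (compact_operators V)" and u_le: "opnorm V V u \<le> M"
    and Uu: "\<parallel>U \<ominus>\<^bsub>compact_operators V\<^esub> U \<otimes>\<^bsub>compact_operators V\<^esub> u\<parallel>\<^bsub>compact_operators V\<^esub> < \<delta>"
    using units[OF U \<delta>(1)] by auto
  have U_bl: "bounded_linear_map V V U" and u_bl: "bounded_linear_map V V u"
    using U u VV.compact_operator_bounded by simp_all
  note Ucl = bounded_linear_map_closed[OF U_bl] and ucl = bounded_linear_map_closed[OF u_bl]
  have UUu_le: "\<parallel>U x \<ominus> U (u x)\<parallel> \<le> \<delta>" if x: "x \<in> unit_ball V" for x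
  proof -
    have "bounded_linear_map V V (\<lambda>x. U (u x))"
      using VV.compact_operator_bounded[OF compact_operator_compose[of V V V u U]] u U_bl
        complex_normed_space_axioms complex_banach_space_axioms by simp
    then have "\<parallel>U x \<ominus> U (u x)\<parallel> \<le> opnorm V V (\<lambda>x. U x \<ominus> U (u x))"
      by (rule VV.opnorm_unit_ball[OF VV.bounded_linear_map_diff[OF U_bl] x])
    moreover have "opnorm V V (\<lambda>x. U x \<ominus> U (u x)) =
        \<parallel>U \<ominus>\<^bsub>compact_operators V\<^esub> U \<otimes>\<^bsub>compact_operators V\<^esub> u\<parallel>\<^bsub>compact_operators V\<^esub>"
      unfolding compact_operators_simps by (rule VV.opnorm_cong) (simp add: compose_eq)
    ultimately show ?thesis
      using Uu by simp
  qed
  have main: "\<parallel>adjoint_op V u (a f) \<ominus>\<^bsub>dual V\<^esub> a f\<parallel>\<^bsub>dual V\<^esub> \<le> \<epsilon>" if f: "f \<in> unit_ball (dual V)" for f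
  proof (rule dual_norm_le)
    fix x assume x: "x \<in> unit_ball V"
    have xV: "x \<in> car V" and fV: "f \<in> car (dual V)"
      using x f unfolding unit_ball_def by blast+
    obtain g where g: "g \<in> G" and near: "\<parallel>a f \<ominus>\<^bsub>dual V\<^esub> a g\<parallel>\<^bsub>dual V\<^esub> \<le> \<delta>"
      using net[OF f] by blast
    let ?d = "a f \<ominus>\<^bsub>dual V\<^esub> a g"
    have ag: "a g \<in> car (dual V)"
      by (rule acl[OF Gcl[OF g]])
    have d: "?d \<in> car (dual V)"
      by (rule dV.diff_closed[OF acl[OF fV] ag])
    have d_eq: "?d y = a f y - a g y" if "y \<in> car V" for y
      using that by simp
    have ux: "u x \<in> car V"
      by (rule ucl[OF xV])
    have "cmod (?d (u x)) \<le> \<parallel>?d\<parallel>\<^bsub>dual V\<^esub> * \<parallel>u x\<parallel>"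
      by (rule dual_bound[OF d ux])
    also have "\<dots> \<le> \<delta> * \<bar>M\<bar>"
      using near VV.opnorm_unit_ball[OF u_bl x] u_le \<delta>(1) norm_nonneg[OF ux] by (intro mult_mono) auto
    finally have 1: "cmod (?d (u x)) \<le> \<delta> * \<bar>M\<bar>" .
    have 2: "cmod (?d x) \<le> \<delta>"
      using dual_bound_unit_ball[OF d x] near by simp
    have "cmod (a g (U x \<ominus> U (u x))) \<le> \<parallel>a g\<parallel>\<^bsub>dual V\<^esub> * \<parallel>U x \<ominus> U (u x)\<parallel>"
      by (rule dual_bound[OF ag diff_closed[OF Ucl[OF xV] Ucl[OF ux]]])
    also have "\<dots> \<le> k * \<delta>"
      using dVdV.opnorm_unit_ball[OF a_bl, of g] G(2) g UUu_le[OF x] k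
        norm_nonneg[OF diff_closed[OF Ucl[OF xV] Ucl[OF ux]]]
      by (intro mult_mono) (auto simp: k_def simp del: dual_simps)
    also have "a g (U x \<ominus> U (u x)) = a g x - a g (u x)"
      using fixed[of "a g"] g by (simp add: dual_diff[OF ag Ucl[OF xV] Ucl[OF ux]] xV ux)
    finally have 3: "cmod (a g x - a g (u x)) \<le> k * \<delta>" .
    have split: "(adjoint_op V u (a f) \<ominus>\<^bsub>dual V\<^esub> a f) x = ?d (u x) - ?d x - (a g x - a g (u x))"
      using xV ux by (simp add: adjoint_apply[OF acl[OF fV]])
    have "cmod ((adjoint_op V u (a f) \<ominus>\<^bsub>dual V\<^esub> a f) x)
        \<le> cmod (?d (u x)) + cmod (?d x) + cmod (a g x - a g (u x))"
      unfolding split using norm_triangle_ineq4[of "?d (u x)" "?d x"]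
        norm_triangle_ineq4[of "?d (u x) - ?d x" "a g x - a g (u x)"] by linarith
    also have "\<dots> \<le> \<delta> * \<bar>M\<bar> + \<delta> + k * \<delta>"
      using 1 2 3 by (intro add_mono)
    also have "\<dots> = \<epsilon>"
      using \<delta>(2) by (simp add: algebra_simps)
    finally show "cmod ((adjoint_op V u (a f) \<ominus>\<^bsub>dual V\<^esub> a f) x) \<le> \<epsilon>" .
  qed
  have "opnorm (dual V) (dual V) (\<lambda>f. adjoint_op V u (a f) \<ominus>\<^bsub>dual V\<^esub> a f) \<le> \<epsilon>"
    using main by (rule dVdV.opnorm_le)
  moreover have "opnorm (dual V) (dual V) (\<lambda>f. adjoint_op V u (a f) \<ominus>\<^bsub>dual V\<^esub> a f) =
      \<parallel>adjoint_op V u \<otimes>\<^bsub>compact_operators (dual V)\<^esub> a \<ominus>\<^bsub>compact_operators (dual V)\<^esub> a\<parallel>\<^bsub>compact_operators (dual V)\<^esub>"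
    unfolding compact_operators_simps by (rule dVdV.opnorm_cong) (simp add: compose_eq del: dual_simps)
  ultimately show ?thesis
    using that[OF u] by simp
qed

end

section \<open>Passing amenability along an anti-homomorphism\<close>

text \<open>
  Let \<open>D\<close> be a derivation on \<open>A\<close>.  Through \<open>\<theta>\<close> every \<open>A\<close>-bimodule becomes a \<open>B\<close>-bimodule with the two
  sides exchanged, and \<open>D \<circ> \<theta>\<close> a derivation, which is inner.  Subtracting the inner derivation leaves
  a derivation \<open>\<Delta>\<close> with \<open>\<Delta> \<circ> \<theta> = 0\<close>.  Since \<open>a \<theta>(b)\<close> lies in the range of \<open>\<theta>\<close>, the product rule
  gives \<open>\<Delta>(a) \<cdot> \<theta>(b) = 0\<close>, and by approximation \<open>\<Delta>(a) \<cdot> c = 0\<close> for all \<open>c\<close> in \<open>A\<close>.  Thus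
  \<open>\<Delta>(a c) = a \<cdot> \<Delta>(c)\<close>, and a limit \<open>\<psi>\<close> of \<open>\<Delta>(e\<^sub>i)\<close> along the right approximate identity satisfies
  \<open>a \<cdot> \<psi> = \<Delta>(a)\<close> and \<open>\<psi> \<cdot> a = 0\<close>.
\<close>

theorem amenable_of_antihomomorphism:
  fixes A :: "('a, 'm) normed_alg_scheme" (structure) and B :: "('b, 'n) normed_alg_scheme"
  assumes amenable: "amenable TYPE('z) B"
    and A: "complex_banach_algebra A"
    and \<theta>: "bounded_linear_map B A \<theta>"
    and anti: "\<And>b c. \<lbrakk>b \<in> car B; c \<in> car B\<rbrakk> \<Longrightarrow> \<theta> (b \<otimes>\<^bsub>B\<^esub> c) = \<theta> c \<otimes> \<theta> b"
    and left_ideal: "\<And>a b. \<lbrakk>a \<in> car A; b \<in> car B\<rbrakk> \<Longrightarrow> \<exists>c \<in> car B. a \<otimes> \<theta> b = \<theta> c"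
    and left_units: "\<And>a \<epsilon>. \<lbrakk>a \<in> car A; \<epsilon> > 0\<rbrakk> \<Longrightarrow>
      \<exists>b \<in> car B. \<parallel>\<theta> b \<otimes> a \<ominus> a\<parallel> \<le> \<epsilon>"
    and bai: "bounded_approximate_identity A I le e"
  shows "amenable TYPE('z) A"
  unfolding amenable_def
proof (intro conjI allI impI A, goal_cases)
  case (1 Z lact ract D)
  then interpret M: banach_bimodule A Z lact ract
    by blast
  have D: "continuous_dual_derivation A Z lact ract D"
    using 1 by blast
  interpret dZ: complex_banach_space "dual Z"
    by (rule complex_banach_space_dual) unfold_locales
  interpret B: complex_banach_algebra B
    using amenable by (simp add: amenable_def)
  interpret BA: normed_space_pair B A
    by unfold_locales
  interpret AZ: normed_space_pair A "dual Z"
    by unfold_locales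
  note \<theta>_lin = bounded_linear_map_linear[OF \<theta>] and \<theta>_cl = bounded_linear_map_closed[OF \<theta>]
  have D_bl: "bounded_linear_map A (dual Z) D"
    using D by (simp add: continuous_dual_derivation_def)
  note D_lin = bounded_linear_map_linear[OF D_bl] and D_cl = bounded_linear_map_closed[OF D_bl]
  have D_mult: "D (a \<otimes> b) z = D b (ract z a) + D a (lact b z)"
    if "a \<in> car A" "b \<in> car A" "z \<in> car Z" for a b z
    using D that by (simp add: continuous_dual_derivation_def dual_lact_def dual_ract_def)

  let ?lact = "\<lambda>b z. ract z (\<theta> b)" and ?ract = "\<lambda>z b. lact (\<theta> b) z"
  obtain L R where L: "\<And>a z. \<lbrakk>a \<in> car A; z \<in> car Z\<rbrakk> \<Longrightarrow> \<parallel>lact a z\<parallel>\<^bsub>Z\<^esub> \<le> L * \<parallel>a\<parallel> * \<parallel>z\<parallel>\<^bsub>Z\<^esub>"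
    and R: "\<And>a z. \<lbrakk>a \<in> car A; z \<in> car Z\<rbrakk> \<Longrightarrow> \<parallel>ract z a\<parallel>\<^bsub>Z\<^esub> \<le> R * \<parallel>a\<parallel> * \<parallel>z\<parallel>\<^bsub>Z\<^esub>"
    using M.lact_bounded M.ract_bounded by blast
  have bound: "K * \<parallel>\<theta> b\<parallel> * \<parallel>z\<parallel>\<^bsub>Z\<^esub> \<le> \<bar>K\<bar> * opnorm B A \<theta> * \<parallel>b\<parallel>\<^bsub>B\<^esub> * \<parallel>z\<parallel>\<^bsub>Z\<^esub>"
    if "b \<in> car B" "z \<in> car Z" for K b z
  proof -
    have "K * \<parallel>\<theta> b\<parallel> \<le> \<bar>K\<bar> * (opnorm B A \<theta> * \<parallel>b\<parallel>\<^bsub>B\<^esub>)"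
      using BA.opnorm_bound[OF \<theta> that(1)] M.A.norm_nonneg[OF \<theta>_cl[OF that(1)]]
      by (intro mult_mono) auto
    then have "K * \<parallel>\<theta> b\<parallel> * \<parallel>z\<parallel>\<^bsub>Z\<^esub> \<le> \<bar>K\<bar> * (opnorm B A \<theta> * \<parallel>b\<parallel>\<^bsub>B\<^esub>) * \<parallel>z\<parallel>\<^bsub>Z\<^esub>"
      by (rule mult_right_mono) (rule M.Z.norm_nonneg[OF that(2)])
    then show ?thesis
      by (simp add: mult.assoc)
  qed
  have "banach_bimodule B Z ?lact ?ract"
  proof
    show "\<exists>K. \<forall>b \<in> car B. \<forall>z \<in> car Z. \<parallel>?lact b z\<parallel>\<^bsub>Z\<^esub> \<le> K * \<parallel>b\<parallel>\<^bsub>B\<^esub> * \<parallel>z\<parallel>\<^bsub>Z\<^esub>"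
      using order_trans[OF R[OF \<theta>_cl] bound] by blast
    show "\<exists>K. \<forall>b \<in> car B. \<forall>z \<in> car Z. \<parallel>?ract z b\<parallel>\<^bsub>Z\<^esub> \<le> K * \<parallel>b\<parallel>\<^bsub>B\<^esub> * \<parallel>z\<parallel>\<^bsub>Z\<^esub>"
      using order_trans[OF L[OF \<theta>_cl] bound] by blast
  qed (simp_all add: \<theta>_cl linear_map_add[OF \<theta>_lin] linear_map_scale[OF \<theta>_lin] anti
      M.lact_closed M.ract_closed M.lact_add_left M.lact_add_right M.lact_scale_left
      M.lact_scale_right M.ract_add_left M.ract_add_right M.ract_scale_left M.ract_scale_right
      M.lact_mult M.ract_mult M.lact_ract)
  moreover have "continuous_dual_derivation B Z ?lact ?ract (\<lambda>b. D (\<theta> b))"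
    unfolding continuous_dual_derivation_def
  proof (intro conjI ballI)
    have "linear_map B (dual Z) (\<lambda>b. D (\<theta> b))"
      by (rule linear_mapI) (simp_all only: \<theta>_cl D_cl linear_map_add[OF \<theta>_lin]
          linear_map_scale[OF \<theta>_lin] linear_map_add[OF D_lin] linear_map_scale[OF D_lin])
    moreover have "\<parallel>D (\<theta> b)\<parallel>\<^bsub>dual Z\<^esub> \<le> (opnorm A (dual Z) D * opnorm B A \<theta>) * \<parallel>b\<parallel>\<^bsub>B\<^esub>"
      if b: "b \<in> car B" for b
      using AZ.opnorm_bound[OF D_bl \<theta>_cl[OF b]]
        mult_left_mono[OF BA.opnorm_bound[OF \<theta> b] AZ.opnorm_nonneg[OF D_bl]]
      by (simp add: mult.assoc del: dual_simps)
    ultimately show "bounded_linear_map B (dual Z) (\<lambda>b. D (\<theta> b))"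
      unfolding bounded_linear_map_def by blast
    fix a b assume ab: "a \<in> car B" "b \<in> car B"
    have ext: "D (\<theta> b \<otimes> \<theta> a) \<in> extensional (car Z)"
      using D_cl[OF M.A.mult_closed[OF \<theta>_cl \<theta>_cl]] ab by simp
    show "D (\<theta> (a \<otimes>\<^bsub>B\<^esub> b)) = dual_lact Z ?ract a (D (\<theta> b)) \<oplus>\<^bsub>dual Z\<^esub> dual_ract Z ?lact (D (\<theta> a)) b"
      unfolding anti[OF ab]
      by (rule extensionalityI[OF ext])
        (use ab in \<open>simp_all add: D_mult \<theta>_cl dual_lact_def dual_ract_def\<close>)
  qed
  ultimately obtain \<phi> where \<phi>: "\<phi> \<in> car (dual Z)"
    and inner: "\<And>b z. \<lbrakk>b \<in> car B; z \<in> car Z\<rbrakk> \<Longrightarrow> D (\<theta> b) z = \<phi> (lact (\<theta> b) z) - \<phi> (ract z (\<theta> b))"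
    using amenableD[OF amenable] by blast

  \<comment> \<open>\<open>D\<close> plus an inner derivation, chosen to vanish on the range of \<open>\<theta>\<close>.\<close>
  define \<Delta> where "\<Delta> a z = D a z - \<phi> (lact a z) + \<phi> (ract z a)" for a z
  have \<Delta>_\<theta>: "\<Delta> (\<theta> b) z = 0" if "b \<in> car B" "z \<in> car Z" for b z
    using inner[OF that] by (simp add: \<Delta>_def)
  have \<Delta>_mult: "\<Delta> (a \<otimes> b) z = \<Delta> b (ract z a) + \<Delta> a (lact b z)"
    if "a \<in> car A" "b \<in> car A" "z \<in> car Z" for a b z
    using that by (simp add: \<Delta>_def D_mult M.lact_mult M.ract_mult M.lact_ract)
  have \<Delta>_diff: "\<Delta> (a \<ominus> b) z = \<Delta> a z - \<Delta> b z" if ab: "a \<in> car A" "b \<in> car A" and z: "z \<in> car Z" for a b z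
  proof -
    have "D (a \<ominus> b) z = D a z - D b z"
      using z by (simp add: AZ.linear_map_diff[OF D_lin ab])
    moreover have "lact (a \<ominus> b) z = lact a z \<ominus>\<^bsub>Z\<^esub> lact b z" "ract z (a \<ominus> b) = ract z a \<ominus>\<^bsub>Z\<^esub> ract z b"
      using ab z by (simp_all add: vdiff_def M.lact_add_left M.lact_scale_left M.ract_add_right
          M.ract_scale_right M.A.scale_closed)
    ultimately show ?thesis
      using ab z by (simp add: \<Delta>_def M.Z.dual_diff[OF \<phi>] M.lact_closed M.ract_closed)
  qed
  have \<Delta>_lin: "linear_map Z complex_line (\<Delta> a)" if a: "a \<in> car A" for a
    using a M.Z.dual_add[OF D_cl[OF a]] M.Z.dual_scale[OF D_cl[OF a]]
    by (intro linear_mapI) (simp_all add: \<Delta>_def M.lact_add_right M.ract_add_left M.lact_scale_right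
        M.ract_scale_left M.Z.dual_add[OF \<phi>] M.Z.dual_scale[OF \<phi>] M.lact_closed M.ract_closed
        algebra_simps del: dual_simps)
  define K where "K = opnorm A (dual Z) D + \<parallel>\<phi>\<parallel>\<^bsub>dual Z\<^esub> * L + \<parallel>\<phi>\<parallel>\<^bsub>dual Z\<^esub> * R"
  have \<Delta>_le: "cmod (\<Delta> a z) \<le> K * \<parallel>a\<parallel> * \<parallel>z\<parallel>\<^bsub>Z\<^esub>" if a: "a \<in> car A" and z: "z \<in> car Z" for a z
  proof -
    have "cmod (D a z) \<le> \<parallel>D a\<parallel>\<^bsub>dual Z\<^esub> * \<parallel>z\<parallel>\<^bsub>Z\<^esub>"
      by (rule M.Z.dual_bound[OF D_cl[OF a] z])
    also have "\<dots> \<le> (opnorm A (dual Z) D * \<parallel>a\<parallel>) * \<parallel>z\<parallel>\<^bsub>Z\<^esub>"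
      by (intro mult_right_mono AZ.opnorm_bound[OF D_bl a] M.Z.norm_nonneg z)
    finally have D_le: "cmod (D a z) \<le> opnorm A (dual Z) D * \<parallel>a\<parallel> * \<parallel>z\<parallel>\<^bsub>Z\<^esub>" .
    have \<phi>_le: "cmod (\<phi> w) \<le> \<parallel>\<phi>\<parallel>\<^bsub>dual Z\<^esub> * c" if "w \<in> car Z" "\<parallel>w\<parallel>\<^bsub>Z\<^esub> \<le> c" for w c
      using M.Z.dual_bound[OF \<phi> that(1)] mult_left_mono[OF that(2) M.Z.dual_norm_nonneg[OF \<phi>]]
      by linarith
    have "cmod (\<Delta> a z) \<le> cmod (D a z) + cmod (\<phi> (lact a z)) + cmod (\<phi> (ract z a))"
      unfolding \<Delta>_def using norm_triangle_ineq[of "D a z - \<phi> (lact a z)" "\<phi> (ract z a)"]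
        norm_triangle_ineq4[of "D a z" "\<phi> (lact a z)"] by linarith
    also have "\<dots> \<le> opnorm A (dual Z) D * \<parallel>a\<parallel> * \<parallel>z\<parallel>\<^bsub>Z\<^esub> + \<parallel>\<phi>\<parallel>\<^bsub>dual Z\<^esub> * (L * \<parallel>a\<parallel> * \<parallel>z\<parallel>\<^bsub>Z\<^esub>)
        + \<parallel>\<phi>\<parallel>\<^bsub>dual Z\<^esub> * (R * \<parallel>a\<parallel> * \<parallel>z\<parallel>\<^bsub>Z\<^esub>)"
      by (intro add_mono D_le \<phi>_le L R M.lact_closed M.ract_closed a z)
    finally show ?thesis
      by (simp add: K_def algebra_simps del: dual_simps)
  qed

  have \<Delta>_lact_\<theta>: "\<Delta> a (lact (\<theta> b) z) = 0" if "a \<in> car A" "b \<in> car B" "z \<in> car Z" for a b z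
  proof -
    obtain c where "c \<in> car B" "a \<otimes> \<theta> b = \<theta> c"
      using left_ideal[OF \<open>a \<in> car A\<close> \<open>b \<in> car B\<close>] by blast
    then show ?thesis
      using \<Delta>_mult[OF that(1) \<theta>_cl[OF that(2)] that(3)] \<Delta>_\<theta> that M.ract_closed by simp
  qed
  have \<Delta>_lact: "\<Delta> a (lact c z) = 0" if a: "a \<in> car A" and c: "c \<in> car A" and z: "z \<in> car Z" for a c z
  proof -
    define k where "k = \<bar>K\<bar> * \<parallel>a\<parallel> * \<bar>L\<bar> * \<parallel>z\<parallel>\<^bsub>Z\<^esub>"
    have k: "0 \<le> k"
      unfolding k_def by (intro mult_nonneg_nonneg M.A.norm_nonneg M.Z.norm_nonneg a z) simp_all
    have "cmod (\<Delta> a (lact c z)) \<le> 0 + \<epsilon>" if "\<epsilon> > 0" for \<epsilon>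
    proof -
      obtain b where b: "b \<in> car B" "\<parallel>\<theta> b \<otimes> c \<ominus> c\<parallel> \<le> \<epsilon> / (k + 1)"
        using left_units[OF c, of "\<epsilon> / (k + 1)"] k \<open>\<epsilon> > 0\<close> by auto
      let ?d = "\<theta> b \<otimes> c \<ominus> c"
      have bc: "\<theta> b \<otimes> c \<in> car A"
        by (intro M.A.mult_closed \<theta>_cl b c)
      have d: "?d \<in> car A"
        by (rule M.A.diff_closed[OF bc c])
      have "lact ?d z = lact (\<theta> b) (lact c z) \<ominus>\<^bsub>Z\<^esub> lact c z"
        using b c z bc by (simp add: vdiff_def M.lact_add_left M.lact_scale_left M.lact_mult
            M.A.scale_closed \<theta>_cl)
      moreover have "\<Delta> a (lact (\<theta> b) (lact c z) \<ominus>\<^bsub>Z\<^esub> lact c z) = - \<Delta> a (lact c z)"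
        using M.Z.functional.linear_map_diff[OF \<Delta>_lin[OF a]] \<Delta>_lact_\<theta>[OF a b(1)] b(1) c z
        by (simp add: M.lact_closed \<theta>_cl)
      ultimately have "cmod (\<Delta> a (lact c z)) = cmod (\<Delta> a (lact ?d z))"
        by simp
      also have "\<dots> \<le> K * \<parallel>a\<parallel> * \<parallel>lact ?d z\<parallel>\<^bsub>Z\<^esub>"
        by (rule \<Delta>_le[OF a M.lact_closed[OF d z]])
      also have "\<dots> \<le> \<bar>K\<bar> * \<parallel>a\<parallel> * (\<bar>L\<bar> * \<parallel>?d\<parallel> * \<parallel>z\<parallel>\<^bsub>Z\<^esub>)"
      proof (intro mult_mono)
        have "L * (\<parallel>?d\<parallel> * \<parallel>z\<parallel>\<^bsub>Z\<^esub>) \<le> \<bar>L\<bar> * (\<parallel>?d\<parallel> * \<parallel>z\<parallel>\<^bsub>Z\<^esub>)"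
          using M.A.norm_nonneg[OF d] M.Z.norm_nonneg[OF z] by (intro mult_right_mono) auto
        then show "\<parallel>lact ?d z\<parallel>\<^bsub>Z\<^esub> \<le> \<bar>L\<bar> * \<parallel>?d\<parallel> * \<parallel>z\<parallel>\<^bsub>Z\<^esub>"
          using L[OF d z] by (simp add: mult.assoc)
      qed (use M.A.norm_nonneg[OF a] M.Z.norm_nonneg[OF M.lact_closed[OF d z]] in auto)
      also have "\<dots> = k * \<parallel>?d\<parallel>"
        by (simp add: k_def mult_ac)
      also have "\<dots> \<le> (k + 1) * (\<epsilon> / (k + 1))"
        using b(2) k M.A.norm_nonneg[OF d] by (intro mult_mono) auto
      also have "\<dots> = 0 + \<epsilon>"
        using k by simp
      finally show ?thesis .
    qed
    then have "cmod (\<Delta> a (lact c z)) \<le> 0"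
      by (rule field_le_epsilon)
    then show ?thesis
      by simp
  qed

  have net: "I \<noteq> {}" "\<forall>i \<in> I. le i i"
    "\<forall>i \<in> I. \<forall>j \<in> I. \<forall>k \<in> I. le i j \<longrightarrow> le j k \<longrightarrow> le i k"
    "\<forall>i \<in> I. \<forall>j \<in> I. \<exists>k \<in> I. le i k \<and> le j k"
    and e_in: "e \<in> I \<rightarrow> car A" and bounded: "\<exists>N. \<forall>i \<in> I. \<parallel>e i\<parallel> \<le> N"
    and lim: "\<forall>a \<in> car A. \<forall>\<epsilon> > 0. \<exists>i \<in> I. \<forall>j \<in> I. le i j \<longrightarrow>
      \<parallel>e j \<otimes> a \<ominus> a\<parallel> < \<epsilon> \<and> \<parallel>a \<otimes> e j \<ominus> a\<parallel> < \<epsilon>"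
    using bai unfolding bounded_approximate_identity_def by - (elim conjE, assumption)+
  have e: "e i \<in> car A" if "i \<in> I" for i
    using e_in that by (rule funcset_mem)
  obtain N where N: "\<And>i. i \<in> I \<Longrightarrow> \<parallel>e i\<parallel> \<le> N"
    using bounded by blast
  have e_lim: "\<exists>i \<in> I. \<forall>j \<in> I. le i j \<longrightarrow> \<parallel>a \<otimes> e j \<ominus> a\<parallel> < \<epsilon>"
    if "a \<in> car A" "\<epsilon> > 0" for a \<epsilon>
    using lim that by meson
  have K_le: "cmod (\<Delta> (e i) z) \<le> (\<bar>K\<bar> * \<bar>N\<bar>) * \<parallel>z\<parallel>\<^bsub>Z\<^esub>" if i: "i \<in> I" and z: "z \<in> car Z" for i z
  proof -
    have "K * \<parallel>e i\<parallel> \<le> \<bar>K\<bar> * \<bar>N\<bar>"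
      using N[OF i] M.A.norm_nonneg[OF e[OF i]] by (intro mult_mono) auto
    then have "K * \<parallel>e i\<parallel> * \<parallel>z\<parallel>\<^bsub>Z\<^esub> \<le> (\<bar>K\<bar> * \<bar>N\<bar>) * \<parallel>z\<parallel>\<^bsub>Z\<^esub>"
      by (rule mult_right_mono) (rule M.Z.norm_nonneg[OF z])
    then show ?thesis
      using \<Delta>_le[OF e[OF i] z] by linarith
  qed
  obtain \<psi> where \<psi>: "\<psi> \<in> car (dual Z)"
    and \<psi>_lim: "\<And>z c. \<lbrakk>z \<in> car Z; \<And>\<epsilon>. \<epsilon> > 0 \<Longrightarrow>
      \<exists>i \<in> I. \<forall>j \<in> I. le i j \<longrightarrow> cmod (\<Delta> (e j) z - c) < \<epsilon>\<rbrakk> \<Longrightarrow> \<psi> z = c"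
  proof (rule M.Z.generalized_limit[of I le "\<lambda>i. \<Delta> (e i)", OF _ _ _ _ \<Delta>_lin[OF e] K_le])
    show "le i k" if "i \<in> I" "j \<in> I" "k \<in> I" "le i j" "le j k" for i j k
      using net(3) that by blast
  qed (use net(1,2,4) that in simp_all)
  have \<psi>_lact: "\<psi> (lact a z) = 0" if a: "a \<in> car A" and z: "z \<in> car Z" for a z
    using net(1) by (intro \<psi>_lim M.lact_closed a z) (auto simp: \<Delta>_lact e a z)
  have \<psi>_ract: "\<psi> (ract z a) = \<Delta> a z" if a: "a \<in> car A" and z: "z \<in> car Z" for a z
  proof (rule \<psi>_lim[OF M.ract_closed[OF z a]])
    fix \<epsilon> :: real assume \<epsilon>: "\<epsilon> > 0"
    define k where "k = \<bar>K\<bar> * \<parallel>z\<parallel>\<^bsub>Z\<^esub>"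
    have k: "0 \<le> k"
      unfolding k_def by (intro mult_nonneg_nonneg M.Z.norm_nonneg z) simp
    obtain i where i: "i \<in> I" "\<And>j. \<lbrakk>j \<in> I; le i j\<rbrakk> \<Longrightarrow> \<parallel>a \<otimes> e j \<ominus> a\<parallel> < \<epsilon> / (k + 1)"
      using e_lim[OF a, of "\<epsilon> / (k + 1)"] k \<epsilon> by auto
    have "cmod (\<Delta> (e j) (ract z a) - \<Delta> a z) < \<epsilon>" if j: "j \<in> I" "le i j" for j
    proof -
      let ?d = "a \<otimes> e j \<ominus> a"
      have ae: "a \<otimes> e j \<in> car A"
        by (intro M.A.mult_closed a e j)
      have d: "?d \<in> car A"
        by (rule M.A.diff_closed[OF ae a])
      have "\<Delta> (e j) (ract z a) - \<Delta> a z = \<Delta> ?d z"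
        using \<Delta>_diff[OF ae a z] \<Delta>_mult[OF a e[OF j(1)] z] \<Delta>_lact[OF a e[OF j(1)] z] by simp
      then have "cmod (\<Delta> (e j) (ract z a) - \<Delta> a z) \<le> K * \<parallel>?d\<parallel> * \<parallel>z\<parallel>\<^bsub>Z\<^esub>"
        using \<Delta>_le[OF d z] by simp
      also have "\<dots> \<le> \<bar>K\<bar> * \<parallel>?d\<parallel> * \<parallel>z\<parallel>\<^bsub>Z\<^esub>"
        using M.A.norm_nonneg[OF d] M.Z.norm_nonneg[OF z] by (intro mult_right_mono) auto
      also have "\<dots> = k * \<parallel>?d\<parallel>"
        by (simp add: k_def mult_ac)
      also have "\<dots> \<le> (k + 1) * \<parallel>?d\<parallel>"
        using M.A.norm_nonneg[OF d] by (intro mult_right_mono) auto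
      also have "\<dots> < (k + 1) * (\<epsilon> / (k + 1))"
        using i(2)[OF j] k by (intro mult_strict_left_mono) auto
      also have "\<dots> = \<epsilon>"
        using k by simp
      finally show ?thesis .
    qed
    then show "\<exists>i \<in> I. \<forall>j \<in> I. le i j \<longrightarrow> cmod (\<Delta> (e j) (ract z a) - \<Delta> a z) < \<epsilon>"
      using i(1) by blast
  qed
  show ?case
    unfolding inner_dual_derivation_def
  proof (intro bexI[of _ "\<psi> \<ominus>\<^bsub>dual Z\<^esub> \<phi>"] ballI dZ.diff_closed \<psi> \<phi>)
    fix a assume a: "a \<in> car A"
    have ext: "D a \<in> extensional (car Z)"
      using D_cl[OF a] by simp
    show "D a = dual_lact Z ract a (\<psi> \<ominus>\<^bsub>dual Z\<^esub> \<phi>) \<ominus>\<^bsub>dual Z\<^esub> dual_ract Z lact (\<psi> \<ominus>\<^bsub>dual Z\<^esub> \<phi>) a"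
    proof (rule extensionalityI[OF ext])
      fix z assume z: "z \<in> car Z"
      have "D a z = \<psi> (ract z a) - \<phi> (ract z a) - (\<psi> (lact a z) - \<phi> (lact a z))"
        using \<psi>_ract[OF a z] \<psi>_lact[OF a z] by (simp add: \<Delta>_def)
      then show "D a z = (dual_lact Z ract a (\<psi> \<ominus>\<^bsub>dual Z\<^esub> \<phi>) \<ominus>\<^bsub>dual Z\<^esub> dual_ract Z lact (\<psi> \<ominus>\<^bsub>dual Z\<^esub> \<phi>) a) z"
        using a z by (simp add: dual_lact_def dual_ract_def M.lact_closed M.ract_closed)
    qed simp
  qed
qed

section \<open>Amenability of the compact operators on the dual\<close>

theorem corollary5p5:
  fixes X :: "'x normed_vs"
    and I :: "'i set" and le :: "'i \<Rightarrow> 'i \<Rightarrow> bool"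
    and e :: "'i \<Rightarrow> ('x \<Rightarrow> complex) \<Rightarrow> ('x \<Rightarrow> complex)"
  assumes "complex_banach_space X"
    and "infinite_dimensional X"
    and "amenable TYPE(('x \<Rightarrow> 'x, 'z) bimodule_universe) (compact_operators X)"
    and "bounded_approximate_identity (compact_operators (dual X)) I le e"
  shows "amenable TYPE('z) (compact_operators (dual X))"
proof -
  interpret X: complex_banach_space X by fact
  interpret dX: complex_banach_space "dual X"
    by (rule complex_banach_space_dual) unfold_locales
  interpret XX: banach_space_pair X X
    by unfold_locales
  let ?K = "compact_operators X" and ?K' = "compact_operators (dual X)"
  have bl: "bounded_linear_map X X T" if "T \<in> car ?K" for T
    using that XX.compact_operator_bounded by simp
  have "inj (Inl :: 'z \<Rightarrow> ('x \<Rightarrow> 'x, 'z) bimodule_universe)"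
    by simp
  then have amenable: "amenable TYPE('z) ?K"
    using assms(3) by (rule amenable_transfer)
  \<comment> \<open>A functional \<open>f\<close> is coded as the singleton of the function \<open>(a, b) \<mapsto> f b\<close>.\<close>
  let ?\<iota> = "\<lambda>f :: ('x \<Rightarrow> 'x) \<Rightarrow> complex. Inr {\<lambda>a. f} :: ('x \<Rightarrow> 'x, 'z) bimodule_universe"
  have "inj ?\<iota>"
    by (rule injI) (auto dest: fun_cong)
  then have "amenable TYPE(('x \<Rightarrow> 'x) \<Rightarrow> complex) ?K"
    using assms(3) by (rule amenable_transfer)
  then obtain M where units: "\<And>v \<epsilon>. \<lbrakk>v \<in> car ?K; \<epsilon> > 0\<rbrakk> \<Longrightarrow>
      \<exists>u \<in> car ?K. \<parallel>u\<parallel>\<^bsub>?K\<^esub> \<le> M \<and> \<parallel>v \<ominus>\<^bsub>?K\<^esub> v \<otimes>\<^bsub>?K\<^esub> u\<parallel>\<^bsub>?K\<^esub> < \<epsilon>"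
    using amenable_bounded_approximate_units by blast
  show ?thesis
  proof (rule amenable_of_antihomomorphism[OF amenable _ _ _ _ _ assms(4)])
    show "complex_banach_algebra ?K'"
      by (rule complex_banach_algebra_compact_operators) unfold_locales
    have "linear_map ?K ?K' (adjoint_op X)"
    proof (rule linear_mapI)
      fix S T assume "S \<in> car ?K" "T \<in> car ?K"
      then have "f (S x \<oplus>\<^bsub>X\<^esub> T x) = f (S x) + f (T x)" if "f \<in> car (dual X)" "x \<in> car X" for f x
        using that X.dual_add bl bounded_linear_map_closed by metis
      then show "adjoint_op X (S \<oplus>\<^bsub>?K\<^esub> T) = adjoint_op X S \<oplus>\<^bsub>?K'\<^esub> adjoint_op X T"
        by (simp add: adjoint_op_def fun_eq_iff)
    next
      fix c T assume "T \<in> car ?K"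
      then have "f (c \<odot>\<^bsub>X\<^esub> T x) = c * f (T x)" if "f \<in> car (dual X)" "x \<in> car X" for f x
        using that X.dual_scale bl bounded_linear_map_closed by metis
      then show "adjoint_op X (c \<odot>\<^bsub>?K\<^esub> T) = c \<odot>\<^bsub>?K'\<^esub> adjoint_op X T"
        by (simp add: adjoint_op_def fun_eq_iff)
    qed (rule X.adjoint_in_compact_operators)
    moreover have "\<parallel>adjoint_op X T\<parallel>\<^bsub>?K'\<^esub> \<le> 1 * \<parallel>T\<parallel>\<^bsub>?K\<^esub>" if "T \<in> car ?K" for T
      using X.opnorm_adjoint_le[OF bl[OF that]] by simp
    ultimately show "bounded_linear_map ?K ?K' (adjoint_op X)"
      unfolding bounded_linear_map_def by blast
    show "adjoint_op X (S \<otimes>\<^bsub>?K\<^esub> T) = adjoint_op X T \<otimes>\<^bsub>?K'\<^esub> adjoint_op X S"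
      if "S \<in> car ?K" "T \<in> car ?K" for S T
      using X.adjoint_compose[OF bl bl] that by simp
    show "\<exists>R \<in> car ?K. S \<otimes>\<^bsub>?K'\<^esub> adjoint_op X T = adjoint_op X R"
      if "S \<in> car ?K'" "T \<in> car ?K" for S T
      using X.adjoints_left_ideal[OF that] by metis
    show "\<exists>u \<in> car ?K. \<parallel>adjoint_op X u \<otimes>\<^bsub>?K'\<^esub> a \<ominus>\<^bsub>?K'\<^esub> a\<parallel>\<^bsub>?K'\<^esub> \<le> \<epsilon>"
      if "a \<in> car ?K'" "\<epsilon> > 0" for a \<epsilon>
      using X.adjoint_approximate_units[OF units that] by metis
  qed
qed

end
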